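(* A real algebraic projective variety of codimension $2$ is a slice if and only if it is a base of a generic real pencil of projective hypersurfaces (and, in particular, it is a regular complete intersection of two hypersurfaces of the same degree).
   Context: The ambient variety is the $n$-dimensional projective space, with complex point set $\mathbb{C}P^n$ and real point set $\mathbb{R}P^n$. For a real algebraic variety $X$ in it, $\mathbb{C}X\subset\mathbb{C}P^n$ is the set of complex points and $\mathbb{R}X=\mathbb{C}X\cap\mathbb{R}P^n$ the set of real points. The varieties under consideration (the real variety and the complex variety slicing it) are nonsingular. Slice: a real algebraic variety $X$ in the projective space is called a slice if there is a complex subvariety $V\subset\mathbb{C}P^n$ transverse to $\mathbb{R}P^n$ such that $\mathbb{R}X=V\cap\mathbb{R}P^n$. Transverse means that $T_pV+T_p\mathbb{R}P^n=T_p\mathbb{C}P^n$ at each point $p\in V\cap\mathbb{R}P^n$. Pencils: a projective hypersurface of degree $d$ is defined by a single equation $P(x_0,\dots,x_n)=0$ with $P$ a nonzero homogeneous polynomial of degree $d$, considered up to a nonzero factor, so hypersurfaces of degree $d$ form a projective space. A real pencil of hypersurfaces of degree $d$ is a projective line in the space of real hypersurfaces of degree $d$; it is determined by any two of its members $R=0$ and $S=0$ ($R,S$ real homogeneous polynomials of degree $d$) and consists of the hypersurfaces $\lambda R(x_0,\dots,x_n)+\mu S(x_0,\dots,x_n)=0$ with $(\lambda:\mu)\in\mathbb{R}P^1$. For a generic pencil, the two determining hypersurfaces can be chosen nonsingular and transverse to each other; their intersection is then a nonsingular subvariety of codimension two in the projective space, and it is called the base of the pencil. A regular complete intersection of two hypersurfaces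 means here such an intersection of two nonsingular hypersurfaces transverse to each other.
   Formalization: Being a base of the pencil (or a complete intersection) means having the same real points, and the two nonsingular hypersurfaces are required to be transverse only at real common points; with complex points the claim fails, e.g. for a plane cubic in 3-space. *)

theory Defs
  imports "HOL-Analysis.Analysis" "HOL-Library.Poly_Mapping"
begin

text \<open>
  Projective \<open>n\<close>-space is handled through homogeneous coordinates indexed by a type \<open>'n\<close> with
  \<open>n + 1\<close> elements: a point is represented by its nonzero coordinate vectors, and a subset of
  projective space by the set of all nonzero vectors representing its points. A linear subspace
  of \<open>T\<^sub>p P\<^sup>n = K\<^sup>n\<^sup>+\<^sup>1 / K x\<close>, where \<open>x\<close> represents \<open>p\<close>, is represented by its preimage in
  \<open>K\<^sup>n\<^sup>+\<^sup>1\<close>.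
\<close>

type_synonym ('n, 'a) mpoly = "('n \<Rightarrow>\<^sub>0 nat) \<Rightarrow>\<^sub>0 'a"

definition peval :: "('n::finite, 'a::comm_semiring_1) mpoly \<Rightarrow> 'a ^ 'n \<Rightarrow> 'a" where
  "peval p x = (\<Sum>m\<in>Poly_Mapping.keys p.
     Poly_Mapping.lookup p m * (\<Prod>i\<in>UNIV. (x $ i) ^ Poly_Mapping.lookup m i))"

text \<open>The zero polynomial is homogeneous of every degree.\<close>

definition homogeneous :: "nat \<Rightarrow> ('n::finite, 'a::zero) mpoly \<Rightarrow> bool" where
  "homogeneous d p \<longleftrightarrow>
     (\<forall>m\<in>Poly_Mapping.keys p. (\<Sum>i\<in>UNIV. Poly_Mapping.lookup m i) = d)"

definition scale :: "'a::comm_semiring_1 \<Rightarrow> ('n, 'a) mpoly \<Rightarrow> ('n, 'a) mpoly" where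
  "scale c p = Poly_Mapping.map (\<lambda>a. c * a) p"

definition complexify :: "('n, real) mpoly \<Rightarrow> ('n, complex) mpoly" where
  "complexify p = Poly_Mapping.map complex_of_real p"

definition cvec :: "real ^ 'n \<Rightarrow> complex ^ 'n" where
  "cvec x = (\<chi> i. complex_of_real (x $ i))"

abbreviation differential ::
  "('n::finite, 'a::real_normed_field) mpoly \<Rightarrow> 'a ^ 'n \<Rightarrow> 'a ^ 'n \<Rightarrow> 'a" where
  "differential p x \<equiv> frechet_derivative (peval p) (at x)"


subsection \<open>Projective varieties\<close>

definition zero_locus :: "('n::finite, complex) mpoly set \<Rightarrow> (complex ^ 'n) set" where
  "zero_locus F = {x. x \<noteq> 0 \<and> (\<forall>f\<in>F. peval f x = 0)}"

definition complex_variety :: "(complex ^ 'n::finite) set \<Rightarrow> bool" where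
  "complex_variety V \<longleftrightarrow>
     (\<exists>F. finite F \<and> (\<forall>f\<in>F. \<exists>d. homogeneous d f) \<and> V = zero_locus F)"

definition real_variety :: "(complex ^ 'n::finite) set \<Rightarrow> bool" where
  "real_variety X \<longleftrightarrow>
     (\<exists>F. finite F \<and> (\<forall>f\<in>F. \<exists>d. homogeneous d f) \<and> X = zero_locus (complexify ` F))"

definition real_points :: "(complex ^ 'n::finite) set \<Rightarrow> (real ^ 'n) set" where
  "real_points V = {x. x \<noteq> 0 \<and> cvec x \<in> V}"

text \<open>Regular point of codimension \<open>c\<close>: in a Zariski neighbourhood \<open>g \<noteq> 0\<close> of \<open>x\<close>, the variety
  is cut out by \<open>c\<close> forms whose differentials at \<open>x\<close> are linearly independent. By Euler's
  identity these differentials vanish on \<open>x\<close> itself, so independence on \<open>\<complex>\<^sup>n\<^sup>+\<^sup>1\<close> is independence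
  on \<open>T\<^sub>p P\<^sup>n\<close>.\<close>

definition nonsingular_at :: "nat \<Rightarrow> (complex ^ 'n::finite) set \<Rightarrow> complex ^ 'n \<Rightarrow> bool" where
  "nonsingular_at c V x \<longleftrightarrow>
     (\<exists>f g. (\<forall>i<c. \<exists>d. homogeneous d (f i)) \<and> (\<exists>d. homogeneous d g) \<and> peval g x \<noteq> 0 \<and>
        V \<inter> {y. peval g y \<noteq> 0} = zero_locus (f ` {..<c}) \<inter> {y. peval g y \<noteq> 0} \<and>
        (\<forall>a. (\<forall>v. (\<Sum>i<c. a i * differential (f i) x v) = 0) \<longrightarrow> (\<forall>i<c. a i = 0)))"

text \<open>Different components of a nonsingular variety may have different dimensions.\<close>

definition nonsingular :: "(complex ^ 'n::finite) set \<Rightarrow> bool" where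
  "nonsingular V \<longleftrightarrow> (\<forall>x\<in>V. \<exists>c. nonsingular_at c V x)"

definition nonsingular_of_codim :: "nat \<Rightarrow> (complex ^ 'n::finite) set \<Rightarrow> bool" where
  "nonsingular_of_codim c V \<longleftrightarrow> (\<forall>x\<in>V. nonsingular_at c V x)"


subsection \<open>Slices\<close>

definition tangent_space :: "(complex ^ 'n::finite) set \<Rightarrow> complex ^ 'n \<Rightarrow> (complex ^ 'n) set" where
  "tangent_space V x =
     {v. \<forall>f d. homogeneous d f \<and> (\<forall>y\<in>V. peval f y = 0) \<longrightarrow> differential f x v = 0}"

text \<open>The preimage in \<open>\<complex>\<^sup>n\<^sup>+\<^sup>1\<close> of the real subspace \<open>T\<^sub>p \<real>P\<^sup>n\<close> of \<open>T\<^sub>p \<complex>P\<^sup>n\<close>, where \<open>p\<close> has the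
  real coordinate vector \<open>x\<close>.\<close>

definition tangent_space_RP :: "real ^ 'n::finite \<Rightarrow> (complex ^ 'n) set" where
  "tangent_space_RP x = {cvec u + c *s cvec x | u c. True}"

definition transverse_to_RP :: "(complex ^ 'n::finite) set \<Rightarrow> bool" where
  "transverse_to_RP V \<longleftrightarrow>
     (\<forall>x\<in>real_points V.
        {v + w | v w. v \<in> tangent_space V (cvec x) \<and> w \<in> tangent_space_RP x} = UNIV)"

definition slice :: "(complex ^ 'n::finite) set \<Rightarrow> bool" where
  "slice X \<longleftrightarrow>
     (\<exists>V. complex_variety V \<and> nonsingular V \<and> transverse_to_RP V \<and>
          real_points X = real_points V)"


subsection \<open>Real hypersurfaces and pencils\<close>

text \<open>A hypersurface is given by its equation, so multiplicities count: it is nonsingular if the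
  differential of the equation vanishes at no complex point of the hypersurface.\<close>

definition nonsingular_hypersurface :: "('n::finite, real) mpoly \<Rightarrow> bool" where
  "nonsingular_hypersurface P \<longleftrightarrow>
     (\<forall>x\<in>zero_locus {complexify P}. \<exists>v. differential (complexify P) x v \<noteq> 0)"

definition hypersurface_tangent :: "('n::finite, real) mpoly \<Rightarrow> real ^ 'n \<Rightarrow> (real ^ 'n) set" where
  "hypersurface_tangent P x = {v. differential P x v = 0}"

text \<open>
  Transversality of the hypersurfaces \<open>R = 0\<close> and \<open>S = 0\<close> in \<open>\<real>P\<^sup>n\<close>. It is not imposed at
  imaginary common points, and a base is compared with a variety through real points only, because
  the definition of a slice involves only the real points of the sliced variety. Example: let \<open>X\<close>
  be the plane cubic \<open>w = 0, x\<^sup>3 + y\<^sup>3 + z\<^sup>3 = 0\<close> in 3-space. For small real \<open>t \<noteq> 0\<close>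
  it is the slice by the nonsingular surface
  \<open>x\<^sup>3 + y\<^sup>3 + z\<^sup>3 + w\<^sup>3 + \<i> t w (x\<^sup>2 + y\<^sup>2 + z\<^sup>2 + w\<^sup>2) = 0\<close>, but its real points are not
  the real points of a complete intersection of two surfaces of one degree \<open>d\<close> that are transverse
  at all complex points: that would be a smooth connected curve of degree \<open>d\<^sup>2\<close> sharing infinitely
  many points with the irreducible cubic \<open>X\<close>, so \<open>d\<^sup>2 = 3\<close>.
\<close>

definition transverse_hypersurfaces ::
  "('n::finite, real) mpoly \<Rightarrow> ('n, real) mpoly \<Rightarrow> bool" where
  "transverse_hypersurfaces R S \<longleftrightarrow>
     (\<forall>x\<in>real_points (zero_locus {complexify R, complexify S}).
        {v + w | v w. v \<in> hypersurface_tangent R x \<and> w \<in> hypersurface_tangent S x} = UNIV)"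

text \<open>The equations are nonzero and not proportional; for equal degrees this says that they define
  two distinct hypersurfaces.\<close>

definition independent_pair :: "('n, real) mpoly \<Rightarrow> ('n, real) mpoly \<Rightarrow> bool" where
  "independent_pair R S \<longleftrightarrow> (\<forall>a b. scale a R + scale b S = 0 \<longrightarrow> a = 0 \<and> b = 0)"

text \<open>A pencil is represented by the set of all equations of its members.\<close>

definition pencil :: "('n, real) mpoly \<Rightarrow> ('n, real) mpoly \<Rightarrow> ('n, real) mpoly set" where
  "pencil R S = {scale l R + scale m S | l m. (l, m) \<noteq> (0, 0)}"

definition real_pencil :: "nat \<Rightarrow> ('n::finite, real) mpoly set \<Rightarrow> bool" where
  "real_pencil d L \<longleftrightarrow>
     (\<exists>R S. homogeneous d R \<and> homogeneous d S \<and> independent_pair R S \<and> L = pencil R S)"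

definition generic_pencil :: "('n::finite, real) mpoly set \<Rightarrow> bool" where
  "generic_pencil L \<longleftrightarrow>
     (\<exists>R\<in>L. \<exists>S\<in>L. independent_pair R S \<and>
        nonsingular_hypersurface R \<and> nonsingular_hypersurface S \<and> transverse_hypersurfaces R S)"

definition pencil_base :: "('n::finite, real) mpoly set \<Rightarrow> (complex ^ 'n) set" where
  "pencil_base L = zero_locus (complexify ` L)"

definition is_base_of_generic_pencil :: "(complex ^ 'n::finite) set \<Rightarrow> bool" where
  "is_base_of_generic_pencil X \<longleftrightarrow>
     (\<exists>d L. real_pencil d L \<and> generic_pencil L \<and> real_points X = real_points (pencil_base L))"

definition regular_complete_intersection :: "nat \<Rightarrow> nat \<Rightarrow> (complex ^ 'n::finite) set \<Rightarrow> bool" where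
  "regular_complete_intersection d e X \<longleftrightarrow>
     (\<exists>R S. homogeneous d R \<and> homogeneous e S \<and> independent_pair R S \<and>
        nonsingular_hypersurface R \<and> nonsingular_hypersurface S \<and> transverse_hypersurfaces R S \<and>
        real_points X = real_points (zero_locus {complexify R, complexify S}))"

end

theory Submission
  imports Defs "HOL-Computational_Algebra.Fundamental_Theorem_Algebra"
    "HOL-Computational_Algebra.Field_as_Ring" "Subresultants.Subresultant_Gcd"
begin

text \<open>
  If \<open>R = S = 0\<close> is the base of a generic pencil, then all but finitely many of the hypersurfaces
  \<open>R + t S = 0\<close> are nonsingular; for such a \<open>t\<close> in \<open>\<i> \<real> \<setminus> {0}\<close> this hypersurface slices the base.

  Conversely, let \<open>V\<close> slice \<open>X\<close>. By transversality, \<open>V\<close> has codimension 1 at the real points of \<open>X\<close>,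
  and the ideal of the functions that vanish on \<open>V\<close> near these points is generated by one form \<open>P\<close>:
  the product of the equations of those components of \<open>V\<close> that have real points. Every form
  vanishing on \<open>V\<close> is a multiple of \<open>P\<close>, so the zeros of \<open>P\<close> lie in \<open>V\<close>, and since \<open>V\<close> is
  nonsingular, so is \<open>P = 0\<close>. Write \<open>P = A + \<i> B\<close> with real \<open>A\<close>, \<open>B\<close>. Then \<open>A + t B\<close> is nonsingular
  for \<open>t = \<i>\<close>, hence for all but finitely many \<open>t\<close>, and two real values of \<open>t\<close> give the two
  hypersurfaces.

  That a pencil with one nonsingular member has only finitely many singular ones is elimination
  theory, done here with Sylvester determinants. The generator \<open>P\<close> is found without unique
  factorization: take in the ideal a nonzero form \<open>h\<close> of least degree along a direction \<open>e\<close> in which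
  some form of the ideal is monic. Its leading coefficient \<open>b\<close> along \<open>e\<close> divides it, because
  pseudo-division bounds \<open>h / b\<close> locally, and \<open>P = h / b\<close>.
\<close>

text \<open>The real points of \<open>X\<close> and \<open>V\<close> agree, but the two varieties
  may differ everywhere else: each may have components without real points. Information passes
  between them only through germs at real points, so the implicit function theorem replaces a
  comparison of ideals. The same restriction shapes the search for \<open>P\<close>: membership in
  the ideal is a condition near the real points, while the generator has to be a global form, so
  divisibility of forms must be detected locally, on lines and by size.

  Both directions rest on one translation. At a real point, transversality of \<open>P = 0\<close>
  to the real projective space says that the differential of \<open>P = A + \<i> B\<close> takes
  every complex value on real vectors, that is, that the differentials of \<open>A\<close> and
  \<open>B\<close> are independent over the reals.

  If \<open>X\<close> has no real points, then \<open>V\<close> carries no information, and two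
  definite quadrics span the pencil.\<close>

hide_const (open) Poly_Mapping.degree
no_notation Matrix.vec_index (infixl \<open>$\<close> 100)

subsection \<open>Forms depending polynomially on a parameter\<close>

text \<open>
  \<open>gform d F\<close>: \<open>F t x\<close> is polynomial in \<open>t\<close> and \<open>x\<close>, homogeneous of degree \<open>d\<close> in \<open>x\<close>. The degree is
  an integer so that degrees can be subtracted freely; only \<open>0\<close> has negative degree.
\<close>

inductive gform :: "int \<Rightarrow> (complex \<Rightarrow> complex ^ 'n::finite \<Rightarrow> complex) \<Rightarrow> bool" where
  coef: "gform 0 (\<lambda>t x. poly c t)"
| coord: "gform 1 (\<lambda>t x. x $ i)"
| zero: "gform d (\<lambda>t x. 0)"
| add: "gform d F \<Longrightarrow> gform d G \<Longrightarrow> gform d (\<lambda>t x. F t x + G t x)"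
| mult: "gform d F \<Longrightarrow> gform e G \<Longrightarrow> gform (d + e) (\<lambda>t x. F t x * G t x)"

lemma gform_const: "gform 0 (\<lambda>t x. a)"
  using gform.coef[of "[:a:]"] by simp

lemma gform_cmult: "gform d F \<Longrightarrow> gform d (\<lambda>t x. a * F t x)"
  using gform.mult[OF gform_const] by fastforce

lemma gform_diff: "gform d F \<Longrightarrow> gform d G \<Longrightarrow> gform d (\<lambda>t x. F t x - G t x)"
  using gform.add[OF _ gform_cmult[of d G "-1"]] by simp

lemma gform_sum: "(\<And>i. i \<in> A \<Longrightarrow> gform d (F i)) \<Longrightarrow> gform d (\<lambda>t x. \<Sum>i\<in>A. F i t x)"
  by (induction A rule: infinite_finite_induct) (auto intro: gform.intros)

lemma gform_prod:
  "(\<And>i. i \<in> A \<Longrightarrow> gform (d i) (F i)) \<Longrightarrow> gform (\<Sum>i\<in>A. d i) (\<lambda>t x. \<Prod>i\<in>A. F i t x)"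
  by (induction A rule: infinite_finite_induct) (auto intro: gform.mult gform_const)

lemma gform_power: "gform d F \<Longrightarrow> gform (int k * d) (\<lambda>t x. F t x ^ k)"
  using gform_prod[of "{..<k}" "\<lambda>_. d" "\<lambda>_. F"] by simp

lemma gform_neg: "gform d F \<Longrightarrow> d < 0 \<Longrightarrow> F t x = 0"
proof (induction arbitrary: t x rule: gform.induct)
  case (mult d F e G)
  then have "d < 0 \<or> e < 0" by linarith
  then show ?case using mult by auto
qed auto

lemma gform_at_zero: "gform d F \<Longrightarrow> d \<noteq> 0 \<Longrightarrow> F t 0 = 0"
proof (induction arbitrary: t rule: gform.induct)
  case (mult d F e G)
  then show ?case by (cases "d = 0") auto
qed auto

lemma gform_scale:
  assumes "gform d F" "c \<noteq> 0" shows "F t (c *s x) = c powi d * F t x"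
  using assms by (induction rule: gform.induct) (auto simp: algebra_simps power_int_add)

lemma gform_degree_0: "gform 0 F \<Longrightarrow> F t x = F t 0"
proof -
  \<comment> \<open>The degree is freed for the induction. In a product of total degree 0 with
    factors of nonzero degree, one factor has negative degree and hence is 0.\<close>
  have "gform d F \<Longrightarrow> d = 0 \<Longrightarrow> F t x = F t 0" for d :: int and F :: "complex \<Rightarrow> complex ^ 'n::finite \<Rightarrow> complex" and x
  proof (induction arbitrary: rule: gform.induct)
    case (mult d F e G)
    show ?case
    proof (cases "d = 0")
      case False
      then have "d < 0 \<or> e < 0" using mult by linarith
      then show ?thesis using gform_neg[OF mult(1)] gform_neg[OF mult(2)] by auto
    qed (use mult in auto)
  qed auto
  then show "gform 0 F \<Longrightarrow> F t x = F t 0" by blast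
qed

text \<open>Expansion along the line through \<open>y\<close> with direction \<open>e\<close>: each
  power of \<open>s\<close> takes one from the degree in \<open>y\<close>, so coefficients beyond
  the \<open>d\<close>-th vanish by \<open>gform_neg\<close>. This opens the way to univariate roots
  and resultants.\<close>

lemma gform_shift:
  assumes "gform d F"
  shows "\<exists>p. (\<forall>t y s. F t (y + s *s e) = poly (p t y) s) \<and>
             (\<forall>i. gform (d - int i) (\<lambda>t y. coeff (p t y) i))"
  using assms
proof (induction rule: gform.induct)
  case (coef c)
  have "gform (0 - int i) (\<lambda>t y. coeff [:poly c t:] i)" for i
    by (cases i) (auto intro: gform.zero gform.coef)
  then show ?case
    by (intro exI[of _ "\<lambda>t y. [:poly c t:]"]) auto
next
  case (coord i)
  have "gform (1 - int j) (\<lambda>t y. coeff [:y $ i, e $ i:] j)" for j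
    by (cases j; cases "j - 1") (auto simp: coeff_pCons intro: gform.intros gform_const)
  then show ?case
    by (intro exI[of _ "\<lambda>t y. [:y $ i, e $ i:]"]) auto
next
  case (zero d)
  show ?case by (rule exI[of _ "\<lambda>t y. 0"]) (auto intro: gform.zero)
next
  case (add d F G)
  then obtain p q where
    "\<forall>t y s. F t (y + s *s e) = poly (p t y) s" "\<forall>i. gform (d - int i) (\<lambda>t y. coeff (p t y) i)"
    "\<forall>t y s. G t (y + s *s e) = poly (q t y) s" "\<forall>i. gform (d - int i) (\<lambda>t y. coeff (q t y) i)"
    by blast
  then show ?case by (intro exI[of _ "\<lambda>t y. p t y + q t y"]) (auto intro: gform.add)
next
  case (mult d F d' G)
  then obtain p q where
    pq: "\<forall>t y s. F t (y + s *s e) = poly (p t y) s" "\<forall>i. gform (d - int i) (\<lambda>t y. coeff (p t y) i)"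
    "\<forall>t y s. G t (y + s *s e) = poly (q t y) s" "\<forall>i. gform (d' - int i) (\<lambda>t y. coeff (q t y) i)"
    by blast
  have "gform (d + d' - int i) (\<lambda>t y. coeff (p t y * q t y) i)" for i
    unfolding coeff_mult
  proof (rule gform_sum)
    fix j assume "j \<in> {..i}"
    then have eq: "d + d' - int i = (d - int j) + (d' - int (i - j))" by auto
    show "gform (d + d' - int i) (\<lambda>t y. coeff (p t y) j * coeff (q t y) (i - j))"
      unfolding eq by (intro gform.mult pq(2)[rule_format] pq(4)[rule_format])
  qed
  then show ?case using pq by (intro exI[of _ "\<lambda>t y. p t y * q t y"]) auto
qed

lemma gform_param_poly: "gform d F \<Longrightarrow> \<exists>c. \<forall>t. F t x = poly c t"
proof (induction rule: gform.induct)
  case (coord i) show ?case by (rule exI[of _ "[:x $ i:]"]) simp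
next
  case (zero d) show ?case by (rule exI[of _ 0]) simp
next
  case (add d F G)
  then obtain p q where "\<forall>t. F t x = poly p t" "\<forall>t. G t x = poly q t" by blast
  then show ?case by (intro exI[of _ "p + q"]) simp
next
  case (mult d F e G)
  then obtain p q where "\<forall>t. F t x = poly p t" "\<forall>t. G t x = poly q t" by blast
  then show ?case by (intro exI[of _ "p * q"]) simp
qed auto

text \<open>The partial derivatives are again such forms, so being a singular point of a member of a
  pencil is a system of equations open to elimination.\<close>

lemma gform_has_derivative:
  fixes F :: "complex \<Rightarrow> complex ^ 'n::finite \<Rightarrow> complex"
  assumes "gform d F"
  shows "\<exists>g. (\<forall>i. gform (d - 1) (g i)) \<and>
    (\<forall>t x. (F t has_derivative (\<lambda>v. \<Sum>i\<in>UNIV. g i t x * v $ i)) (at x))"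
  using assms
proof (induction rule: gform.induct)
  case (coef c)
  show ?case by (rule exI[of _ "\<lambda>i t x. 0"]) (auto intro: gform.zero)
next
  case (coord k)
  have *: "(\<Sum>i\<in>UNIV. (if i = k then 1 else 0) * v $ i) = v $ k" for v :: "complex ^ 'n"
    by (simp add: if_distrib[of "\<lambda>c. c * _"] cong: if_cong)
  have "((\<lambda>x::complex ^ 'n. x $ k) has_derivative (\<lambda>v. v $ k)) (at x)" for x
    by (rule bounded_linear_imp_has_derivative[OF bounded_linear_vec_nth])
  then show ?case
    by (intro exI[of _ "\<lambda>i t x. if i = k then 1 else 0"]) (auto simp: * intro: gform_const gform.zero)
next
  case (zero d)
  show ?case by (rule exI[of _ "\<lambda>i t x. 0"]) (auto intro: gform.zero)
next
  case (add d F G)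
  then obtain f g where
    "\<forall>i. gform (d - 1) (f i)" "\<forall>t x. (F t has_derivative (\<lambda>v. \<Sum>i\<in>UNIV. f i t x * v $ i)) (at x)"
    "\<forall>i. gform (d - 1) (g i)" "\<forall>t x. (G t has_derivative (\<lambda>v. \<Sum>i\<in>UNIV. g i t x * v $ i)) (at x)"
    by blast
  then show ?case
    by (intro exI[of _ "\<lambda>i t x. f i t x + g i t x"])
       (auto simp: distrib_right sum.distrib intro: gform.add has_derivative_add)
next
  case (mult d F e G)
  then obtain f g where
    fg: "\<forall>i. gform (d - 1) (f i)" "\<forall>t x. (F t has_derivative (\<lambda>v. \<Sum>i\<in>UNIV. f i t x * v $ i)) (at x)"
    "\<forall>i. gform (e - 1) (g i)" "\<forall>t x. (G t has_derivative (\<lambda>v. \<Sum>i\<in>UNIV. g i t x * v $ i)) (at x)"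
    by blast
  have eq: "d + (e - 1) = d - 1 + e" by simp
  have "gform (d + e - 1) (\<lambda>t x. F t x * g i t x + f i t x * G t x)" for i
    using gform.add[OF gform.mult[OF mult.hyps(1) fg(3)[rule_format, of i]]
        gform.mult[OF fg(1)[rule_format, of i] mult.hyps(2), folded eq]]
    by (simp add: add_diff_eq)
  moreover have "((\<lambda>x. F t x * G t x) has_derivative
      (\<lambda>v. \<Sum>i\<in>UNIV. (F t x * g i t x + f i t x * G t x) * v $ i)) (at x)" for t x
  proof -
    have "((\<lambda>x. F t x * G t x) has_derivative
      (\<lambda>v. F t x * (\<Sum>i\<in>UNIV. g i t x * v $ i) + (\<Sum>i\<in>UNIV. f i t x * v $ i) * G t x)) (at x)"
      using fg by (intro has_derivative_mult) auto
    then show ?thesis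
      by (simp add: sum_distrib_left sum_distrib_right sum.distrib algebra_simps)
  qed
  ultimately show ?case
    by (intro exI[of _ "\<lambda>i t x. F t x * g i t x + f i t x * G t x"]) auto
qed

section \<open>Polynomials and the functions they define\<close>

definition form :: "int \<Rightarrow> (complex ^ 'n::finite \<Rightarrow> complex) \<Rightarrow> bool" where
  "form d f \<longleftrightarrow> gform d (\<lambda>t. f)"

lemma peval_superset:
  assumes "finite K" "Poly_Mapping.keys p \<subseteq> K"
  shows "peval p x = (\<Sum>m\<in>K. Poly_Mapping.lookup p m * (\<Prod>i\<in>UNIV. (x $ i) ^ Poly_Mapping.lookup m i))"
  unfolding peval_def using assms
  by (intro sum.mono_neutral_left) (auto simp: in_keys_iff)

lemma peval_zero [simp]: "peval 0 x = 0"
  by (simp add: peval_def)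

lemma peval_add: "peval (p + q) x = peval p x + peval q x"
proof -
  let ?K = "Poly_Mapping.keys p \<union> Poly_Mapping.keys q"
  have "Poly_Mapping.keys (p + q) \<subseteq> ?K" by (rule keys_add)
  then show ?thesis
    by (simp add: peval_superset[of ?K] lookup_add distrib_right sum.distrib)
qed

lemma peval_sum: "peval (\<Sum>i\<in>I. f i) x = (\<Sum>i\<in>I. peval (f i) x)"
  by (induction I rule: infinite_finite_induct) (simp_all add: peval_add)

lemma lookup_map: "f 0 = 0 \<Longrightarrow> Poly_Mapping.lookup (Poly_Mapping.map f p) m = f (Poly_Mapping.lookup p m)"
  by (simp add: Poly_Mapping.map.rep_eq when_def)

lemma keys_map_subset: "Poly_Mapping.keys (Poly_Mapping.map f p) \<subseteq> Poly_Mapping.keys p"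
  by (auto simp: in_keys_iff Poly_Mapping.map.rep_eq when_def)

lemma peval_map:
  assumes "f 0 = 0"
  shows "peval (Poly_Mapping.map f p) x = (\<Sum>m\<in>Poly_Mapping.keys p.
     f (Poly_Mapping.lookup p m) * (\<Prod>i\<in>UNIV. (x $ i) ^ Poly_Mapping.lookup m i))"
  by (subst peval_superset[OF finite_keys keys_map_subset]) (simp add: lookup_map assms)

lemma peval_scale: "peval (scale c p) x = c * peval p x"
  by (simp add: scale_def peval_map) (simp add: peval_def sum_distrib_left mult.assoc)

lemma peval_single: "peval (Poly_Mapping.single m a) x = a * (\<Prod>i\<in>UNIV. (x $ i) ^ Poly_Mapping.lookup m i)"
  by (subst peval_superset[of "{m}"]) auto

lemma peval_mult: "peval (p * q) x = peval p x * peval q (x :: 'a::comm_semiring_1 ^ 'n::finite)"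
proof -
  have mono: "(\<Prod>i\<in>UNIV. (x $ i) ^ Poly_Mapping.lookup (m + n) i) =
    (\<Prod>i\<in>UNIV. (x $ i) ^ Poly_Mapping.lookup m i) * (\<Prod>i\<in>UNIV. (x $ i) ^ Poly_Mapping.lookup n i)" for m n
    by (simp add: lookup_add power_add prod.distrib)
  have sum: "p = (\<Sum>m\<in>Poly_Mapping.keys p. Poly_Mapping.single m (Poly_Mapping.lookup p m))" for p :: "('n, 'a) mpoly"
    by (rule poly_mapping_eqI) (auto simp: lookup_sum lookup_single when_def in_keys_iff)
  have "p * q = (\<Sum>m\<in>Poly_Mapping.keys p. \<Sum>n\<in>Poly_Mapping.keys q.
      Poly_Mapping.single (m + n) (Poly_Mapping.lookup p m * Poly_Mapping.lookup q n))"
    by (subst sum[of p], subst sum[of q]) (simp add: sum_product mult_single)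
  then have "peval (p * q) x = (\<Sum>m\<in>Poly_Mapping.keys p. \<Sum>n\<in>Poly_Mapping.keys q.
      peval (Poly_Mapping.single (m + n) (Poly_Mapping.lookup p m * Poly_Mapping.lookup q n)) x)"
    by (simp add: peval_sum)
  then show ?thesis
    unfolding peval_single mono unfolding peval_def sum_product by (simp add: mult_ac)
qed

lemma homogeneous_zero [simp]: "homogeneous d 0"
  by (simp add: homogeneous_def)

lemma homogeneous_add: "homogeneous d p \<Longrightarrow> homogeneous d q \<Longrightarrow> homogeneous d (p + q)"
  unfolding homogeneous_def using keys_add[of p q] by blast

lemma homogeneous_map: "homogeneous d p \<Longrightarrow> homogeneous d (Poly_Mapping.map f p)"
  unfolding homogeneous_def using keys_map_subset[of f p] by blast

lemma homogeneous_scale: "homogeneous d p \<Longrightarrow> homogeneous d (scale c p)"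
  unfolding scale_def by (rule homogeneous_map)

lemma homogeneous_complexify: "homogeneous d p \<Longrightarrow> homogeneous d (complexify p)"
  unfolding complexify_def by (rule homogeneous_map)

lemma homogeneous_mult:
  fixes p q :: "('n::finite, 'a::comm_semiring_1) mpoly"
  assumes "homogeneous d p" "homogeneous e q" shows "homogeneous (d + e) (p * q)"
  unfolding homogeneous_def
proof
  fix m assume "m \<in> Poly_Mapping.keys (p * q)"
  then obtain a b where "a \<in> Poly_Mapping.keys p" "b \<in> Poly_Mapping.keys q" "m = a + b"
    using keys_mult[of p q] by blast
  then show "(\<Sum>i\<in>UNIV. Poly_Mapping.lookup m i) = d + e"
    using assms by (simp add: homogeneous_def lookup_add sum.distrib)
qed

lemma homogeneous_imp_form: "homogeneous d p \<Longrightarrow> form (int d) (peval p)"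
  unfolding form_def peval_def
proof (rule gform_sum)
  fix m assume *: "homogeneous d p" and "m \<in> Poly_Mapping.keys p"
  then have d: "int d = (\<Sum>i\<in>UNIV. int (Poly_Mapping.lookup m i) * 1)"
    by (auto simp: homogeneous_def)
  show "gform (int d) (\<lambda>t x. Poly_Mapping.lookup p m * (\<Prod>i\<in>UNIV. x $ i ^ Poly_Mapping.lookup m i))"
    unfolding d by (intro gform_cmult gform_prod gform_power gform.coord)
qed

lemma gform_imp_homogeneous:
  assumes "gform d F" "d \<ge> 0"
  shows "\<exists>p. homogeneous (nat d) p \<and> F t = peval p"
  using assms
proof (induction rule: gform.induct)
  case (coef c)
  show ?case
    by (rule exI[of _ "Poly_Mapping.single 0 (poly c t)"]) (auto simp: homogeneous_def peval_single)
next
  case (coord k)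
  have eq: "(x $ i) ^ (if i = k then Suc 0 else 0) = (if i = k then x $ i else 1)" for x :: "complex ^ 'a" and i
    by simp
  have "peval (Poly_Mapping.single (Poly_Mapping.single k 1) 1) x = x $ k" for x :: "complex ^ 'a"
    by (simp add: peval_single lookup_single when_def eq eq_commute[of k])
  moreover have "homogeneous (nat 1) (Poly_Mapping.single (Poly_Mapping.single k 1) 1 :: ('a, complex) mpoly)"
    by (simp add: homogeneous_def lookup_single when_def)
  ultimately show ?case by (metis ext)
next
  case (zero d)
  show ?case by (rule exI[of _ 0]) auto
next
  case (add d F G)
  then obtain p q where "homogeneous (nat d) p \<and> F t = peval p" "homogeneous (nat d) q \<and> G t = peval q"
    by blast
  then show ?case by (intro exI[of _ "p + q"]) (auto simp: peval_add homogeneous_add)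
next
  case (mult d F e G)
  show ?case
  proof (cases "d < 0 \<or> e < 0")
    case True
    then have "F t x * G t x = 0" for x
      using gform_neg[OF mult(1)] gform_neg[OF mult(2)] by auto
    then show ?thesis by (intro exI[of _ 0]) auto
  next
    case False
    then obtain p q where "homogeneous (nat d) p \<and> F t = peval p" "homogeneous (nat e) q \<and> G t = peval q"
      using mult by force
    then show ?thesis using False
      by (intro exI[of _ "p * q"]) (auto simp: peval_mult nat_add_distrib homogeneous_mult)
  qed
qed

text \<open>Forms are handled as functions, whose identities are pointwise; this is the way back to
  polynomials.\<close>

lemma form_iff: "form d f \<longleftrightarrow> (if d < 0 then f = (\<lambda>x. 0) else (\<exists>p. homogeneous (nat d) p \<and> f = peval p))"
proof (cases "d < 0")
  case True
  then show ?thesis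
    using gform_neg[of d "\<lambda>t. f"] gform.zero[of d] by (auto simp: form_def)
next
  case False
  then show ?thesis
    using gform_imp_homogeneous[of d "\<lambda>t. f"] homogeneous_imp_form[of "nat d"] by (auto simp: form_def)
qed

lemma form_gform: "gform d F \<Longrightarrow> form d (F t)"
  using gform_imp_homogeneous[of d F t] gform_neg[of d F t] by (auto simp: form_iff)

section \<open>Resultants and elimination\<close>

text \<open>The Sylvester determinant, expanded by Leibniz' formula, is isobaric.\<close>

lemma resultant_form:
  fixes p q :: "complex \<Rightarrow> complex ^ 'n::finite \<Rightarrow> complex poly"
  assumes p: "\<And>i. gform (int m - int i) (\<lambda>t y. coeff (p t y) i)"
    and q: "\<And>i. gform (int n - int i) (\<lambda>t y. coeff (q t y) i)"
  shows "gform (int (m * n)) (\<lambda>t y. resultant_sub m n (p t y) (q t y))"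
proof -
  let ?E = "\<lambda>t y i j. sylvester_mat_sub m n (p t y) (q t y) $$ (i, j)"
  \<comment> \<open>\<open>?w i\<close> is the shift of row \<open>i\<close> of the Sylvester matrix
    against the first row of its block. An entry in column \<open>j\<close> then has degree
    \<open>j - ?w i\<close>, and along any permutation these degrees add up to the same number
    \<open>m * n\<close>.\<close>
  let ?w = "\<lambda>i. if i < n then int i else int i - int n"
  have E: "gform (int j - ?w i) (\<lambda>t y. ?E t y i j)" if ij: "i < m + n" "j < m + n" for i j
  proof -
    consider "i < n" "i \<le> j" "j - i \<le> m" | "\<not> i < n" "i - n \<le> j" "j \<le> i"
      | "i < n" "\<not> (i \<le> j \<and> j - i \<le> m)" | "\<not> i < n" "\<not> (i - n \<le> j \<and> j \<le> i)" by blast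
    then show ?thesis
    proof cases
      case 1
      then have "int j - ?w i = int m - int (m + i - j)" by auto
      then show ?thesis using 1 p[of "m + i - j"] by (simp add: sylvester_mat_sub_index ij)
    next
      case 2
      then have eq: "int j - ?w i = int n - int (i - j)" by auto
      show ?thesis unfolding eq using 2 q[of "i - j"] by (simp add: sylvester_mat_sub_index ij)
    qed (auto simp: sylvester_mat_sub_index ij intro: gform.zero)
  qed
  have w: "(\<Sum>i = 0..<m + n. ?w i) = (\<Sum>i = 0..<n. int i) + (\<Sum>i = 0..<m. int i)"
  proof -
    have "(\<Sum>i = 0..<m + n. ?w i) = (\<Sum>i = 0..<n. ?w i) + (\<Sum>i = n..<m + n. ?w i)"
      by (rule sum.atLeastLessThan_concat[symmetric]) auto
    also have "(\<Sum>i = n..<m + n. ?w i) = (\<Sum>i = 0..<m. ?w (i + n))"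
      using sum.shift_bounds_nat_ivl[of ?w 0 n m] by simp
    finally show ?thesis by simp
  qed
  have gauss: "2 * (\<Sum>i = 0..<k. int i) = int k * (int k - 1)" for k
    by (induction k) (auto simp: algebra_simps)
  have tot: "(\<Sum>i = 0..<m + n. int (s i) - ?w i) = int (m * n)" if "s permutes {0..<m + n}" for s
  proof -
    have "(\<Sum>i = 0..<m + n. int (s i)) = (\<Sum>i = 0..<m + n. int i)"
      using sum.permute[OF that, of int] by (simp add: o_def)
    then have "2 * (\<Sum>i = 0..<m + n. int (s i) - ?w i) = 2 * int (m * n)"
      unfolding sum_subtractf w right_diff_distrib distrib_left gauss
      by (simp add: gauss algebra_simps)
    then show ?thesis by simp
  qed
  have "gform (int (m * n)) (\<lambda>t y. \<Sum>s\<in>{s. s permutes {0..<m + n}}.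
     signof s * (\<Prod>i = 0..<m + n. ?E t y i (s i)))"
  proof (rule gform_sum)
    fix s assume "s \<in> {s. s permutes {0..<m + n}}"
    then have s: "s permutes {0..<m + n}" by simp
    have "gform (\<Sum>i = 0..<m + n. int (s i) - ?w i) (\<lambda>t y. \<Prod>i = 0..<m + n. ?E t y i (s i))"
      using permutes_in_image[OF s] by (intro gform_prod E) auto
    then show "gform (int (m * n)) (\<lambda>t y. signof s * (\<Prod>i = 0..<m + n. ?E t y i (s i)))"
      unfolding tot[OF s] by (rule gform_cmult)
  qed
  then show ?thesis
    by (simp add: resultant_sub_def Determinant.det_def'[OF sylvester_mat_sub_carrier])
qed

text \<open>Over the complex numbers a gcd of positive degree has a root;
  \<open>p \<noteq> 0\<close> keeps the gcd nonzero, so that a common linear factor makes its degree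
  positive.\<close>

lemma resultant_common_root:
  fixes p q :: "complex poly"
  assumes "p \<noteq> 0"
  shows "resultant p q = 0 \<longleftrightarrow> (\<exists>s. poly p s = 0 \<and> poly q s = 0)"
proof
  assume "resultant p q = 0"
  then have "degree (gcd p q) \<noteq> 0" using Subresultant_Gcd.resultant_0_gcd by blast
  then have "\<not> constant (poly (gcd p q))" by (simp add: constant_degree)
  then obtain s where "poly (gcd p q) s = 0" using fundamental_theorem_of_algebra by blast
  then show "\<exists>s. poly p s = 0 \<and> poly q s = 0"
    by (metis dvd_trans gcd_dvd1 gcd_dvd2 poly_eq_0_iff_dvd)
next
  assume "\<exists>s. poly p s = 0 \<and> poly q s = 0"
  then obtain s where "[:- s, 1:] dvd gcd p q" by (auto simp: poly_eq_0_iff_dvd)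
  moreover have "gcd p q \<noteq> 0" using assms by simp
  ultimately have "degree [:- s, 1:] \<le> degree (gcd p q)" by (rule dvd_imp_degree_le)
  then have "degree (gcd p q) \<noteq> 0" by simp
  then show "resultant p q = 0" using Subresultant_Gcd.resultant_0_gcd by blast
qed

text \<open>The top coefficient has degree 0 in \<open>y\<close>, hence is constant. At
  \<open>y = 0\<close> homogeneity leaves no other coefficient, and \<open>s = 1\<close> shows that
  the constant is \<open>F t e\<close>. So \<open>F t e \<noteq> 0\<close> makes \<open>F t\<close>
  monic along \<open>e\<close> up to a constant factor, on all lines at once.\<close>

lemma gform_shift_coeff_top:
  assumes pc: "\<And>i. gform (int d - int i) (\<lambda>t. \<lambda>y. coeff (q t y) i)"
    and q: "\<And>t y s. F t (y + s *s e) = poly (q t y) s"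
  shows "degree (q t y) \<le> d" "coeff (q t y) d = F t e"
proof -
  have "coeff (q t y) i = 0" if "i > d" for i
    using gform_neg[OF pc[of i]] that by simp
  then show "degree (q t y) \<le> d" by (simp add: degree_le)
  have c0: "coeff (q t 0) i = 0" if "i \<noteq> d" for i
    using gform_at_zero[OF pc[of i]] that by simp
  have "q t 0 = monom (coeff (q t 0) d) d"
    by (rule poly_eqI) (use c0 in auto)
  then have "F t e = coeff (q t 0) d"
    using q[of t 0 1] by (metis add_0 mult.right_neutral poly_monom power_one scaleR_one vector_smult_lid)
  also have "\<dots> = coeff (q t y) d"
    using gform_degree_0[of "\<lambda>t y. coeff (q t y) d" t y] pc[of d] by simp
  finally show "coeff (q t y) d = F t e" by simp
qed

text \<open>
  Induction over the coordinates. A coordinate \<open>k\<close> is eliminated by the resultants of one member \<open>H\<close>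
  of the family, monic in \<open>x\<^sub>k\<close>, with the combinations \<open>\<Sum>\<^sub>j s\<^sup>j F\<^sub>j\<close> for more values of \<open>s\<close> than
  \<open>deg H\<close> times the size of the family: by the pigeonhole principle some root of \<open>H\<close> is then shared
  by all \<open>F\<^sub>j\<close>.
\<close>

lemma elimination:
  fixes \<F> :: "(complex \<Rightarrow> complex ^ 'n::finite \<Rightarrow> complex) set"
  assumes "finite A" "finite \<F>" "\<And>F. F \<in> \<F> \<Longrightarrow> gform d F"
    and "\<And>x. x \<noteq> 0 \<Longrightarrow> \<forall>k. k \<notin> A \<longrightarrow> x $ k = 0 \<Longrightarrow> \<exists>F\<in>\<F>. F t0 x \<noteq> 0"
  shows "finite {t. \<exists>x. x \<noteq> 0 \<and> (\<forall>k. k \<notin> A \<longrightarrow> x $ k = 0) \<and> (\<forall>F\<in>\<F>. F t x = 0)}"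
  using assms
proof (induction A arbitrary: d \<F> rule: finite_induct)
  case empty
  have vec0: "x = 0" if "\<forall>k. k \<notin> {} \<longrightarrow> x $ k = 0" for x :: "complex ^ 'n"
    using that by (simp add: Finite_Cartesian_Product.vec_eq_iff)
  have "{t. \<exists>x. x \<noteq> 0 \<and> (\<forall>k. k \<notin> {} \<longrightarrow> x $ k = 0) \<and> (\<forall>F\<in>\<F>. F t x = 0)} = {}"
    using vec0 by blast
  then show ?case by (metis finite.emptyI)
next
  case (insert k A)
  define e :: "complex ^ 'n" where "e = axis k 1"
  have e: "e \<noteq> 0" "e $ k = 1" "\<And>j. j \<noteq> k \<Longrightarrow> e $ j = 0"
    by (auto simp: e_def axis_def Finite_Cartesian_Product.vec_eq_iff)
  then obtain H where H: "H \<in> \<F>" "H t0 e \<noteq> 0"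
    using insert.prems(3)[of e] by auto
  then have "d \<ge> 0" using gform_neg insert.prems(2) by (metis linorder_not_le)
  then obtain m where d: "d = int m" using nonneg_int_cases by blast
  obtain fs where fs: "set fs = \<F>" using insert.prems(1) finite_list by blast
  define r where "r = length fs"
  define L where "L = (\<lambda>s::complex. \<lambda>t x. \<Sum>j<r. s ^ j * (fs ! j) t x)"
  have L: "gform d (L s)" for s
    unfolding L_def r_def using fs insert.prems(2) by (intro gform_sum gform_cmult) auto
  \<comment> \<open>Adding \<open>H\<close> where \<open>L s\<close> vanishes at \<open>e\<close>
    gives every \<open>Q s\<close> full degree along \<open>e\<close> at the parameter
    \<open>t0\<close>, and on the zeros of \<open>H\<close> it changes nothing.\<close>
  define Q where "Q = (\<lambda>s t x. L s t x + (if L s t0 e = 0 then 1 else 0) * H t x)"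
  have Q: "gform d (Q s)" for s
    unfolding Q_def using insert.prems(2)[OF H(1)] L by (intro gform.add gform_cmult)
  have Qe: "Q s t0 e \<noteq> 0" for s using H(2) by (auto simp: Q_def)
  obtain h where h: "\<And>t y s. H t (y + s *s e) = poly (h t y) s"
      "\<And>i. gform (int m - int i) (\<lambda>t y. coeff (h t y) i)"
    using gform_shift[OF insert.prems(2)[OF H(1)], of e] d by auto
  have "\<forall>s. \<exists>q. (\<forall>t y u. Q s t (y + u *s e) = poly (q t y) u) \<and>
      (\<forall>i. gform (int m - int i) (\<lambda>t y. coeff (q t y) i))"
    using gform_shift[OF Q, of _ e] d by auto
  then obtain q where q: "\<And>s t y u. Q s t (y + u *s e) = poly (q s t y) u"
      "\<And>s i. gform (int m - int i) (\<lambda>t y. coeff (q s t y) i)"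
    by metis
  note h_top = gform_shift_coeff_top[OF h(2,1)]
  note q_top = gform_shift_coeff_top[OF q(2,1)]
  have h_deg: "degree (h t y) = m" "h t y \<noteq> 0" if "H t e \<noteq> 0" for t y
    using h_top that h(1) by (metis le_antisym le_degree, metis coeff_0)
  have q_deg: "degree (q s t y) = m" if "Q s t e \<noteq> 0" for s t y
    using q_top that q(1) by (metis le_antisym le_degree)
  define R where "R = (\<lambda>s t y. resultant_sub m m (h t y) (q s t y))"
  have R: "gform (int (m * m)) (R s)" for s
    unfolding R_def by (rule resultant_form[OF h(2) q(2)])
  have R0: "R s t y = 0 \<longleftrightarrow> (\<exists>u. H t (y + u *s e) = 0 \<and> Q s t (y + u *s e) = 0)"
    if "H t e \<noteq> 0" "Q s t e \<noteq> 0" for s t y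
    using resultant_common_root[of "h t y" "q s t y"] h_deg[OF that(1)] q_deg[OF that(2)]
    by (simp add: R_def resultant_sub h(1) q(1))
  \<comment> \<open>One value more than \<open>m * r\<close>: \<open>H\<close> has at most
    \<open>m\<close> roots on the line, so some root is shared for more than \<open>r\<close> values
    of \<open>s\<close>. These are too many for the polynomial \<open>P\<close> below unless all its
    coefficients, the values of the family at that root, vanish.\<close>
  define S where "S = complex_of_nat ` {..m * r}"
  have S: "finite S" "card S = Suc (m * r)"
    by (auto simp: S_def card_image inj_on_def)
  have "\<exists>G\<in>R ` S. G t0 y \<noteq> 0" if y: "y \<noteq> 0" "\<forall>j. j \<notin> A \<longrightarrow> y $ j = 0" for y
  proof (rule ccontr)
    assume "\<not> ?thesis"
    then have "\<forall>s\<in>S. \<exists>u. H t0 (y + u *s e) = 0 \<and> Q s t0 (y + u *s e) = 0"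
      using R0[OF H(2) Qe] by blast
    then obtain u where u: "\<And>s. s \<in> S \<Longrightarrow> H t0 (y + u s *s e) = 0"
        "\<And>s. s \<in> S \<Longrightarrow> Q s t0 (y + u s *s e) = 0" by metis
    have "u ` S \<subseteq> {v. poly (h t0 y) v = 0}" using u(1) h(1) by auto
    then have "card (u ` S) \<le> m"
      using card_poly_roots_bound[OF h_deg(2)[OF H(2)]] poly_roots_finite[OF h_deg(2)[OF H(2)]] h_deg(1)[OF H(2)]
      by (metis card_mono le_trans)
    then have "card (u ` S) * r < card S" using S(2) by (simp add: less_Suc_eq_le)
    have "\<exists>v. card {s\<in>S. u s = v} > r"
    proof (rule ccontr)
      assume "\<not> ?thesis"
      then have le: "card {s\<in>S. u s = v} \<le> r" for v by (meson not_less)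
      have "card S = card (\<Union>v\<in>u ` S. {s\<in>S. u s = v})" by (rule arg_cong[of _ _ card]) auto
      also have "\<dots> \<le> (\<Sum>v\<in>u ` S. card {s\<in>S. u s = v})"
        using S(1) by (intro card_UN_le) auto
      also have "\<dots> \<le> card (u ` S) * r" using sum_bounded_above[of "u ` S" "\<lambda>v. card {s\<in>S. u s = v}" r] le by simp
      finally show False using \<open>card (u ` S) * r < card S\<close> by simp
    qed
    then obtain v where v: "card {s\<in>S. u s = v} > r" by blast
    define z where "z = y + v *s e"
    have "{s\<in>S. u s = v} \<noteq> {}" using v by force
    then have Hz: "H t0 z = 0" using u(1) by (auto simp: z_def)
    define P where "P = (\<Sum>j<r. monom ((fs ! j) t0 z) j)"
    have "P = 0"
    proof (rule ccontr)
      assume "P \<noteq> 0"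
      have "degree P \<le> r"
        unfolding P_def by (intro degree_sum_le) (auto intro: order.trans[OF degree_monom_le])
      moreover have "{s\<in>S. u s = v} \<subseteq> {s. poly P s = 0}"
      proof safe
        fix s assume s: "s \<in> S" "v = u s"
        then have "Q s t0 z = 0" using u(2) by (auto simp: z_def)
        then show "poly P s = 0" by (simp add: Q_def Hz L_def P_def poly_sum poly_monom mult.commute)
      qed
      ultimately show False
        using card_poly_roots_bound[OF \<open>P \<noteq> 0\<close>] poly_roots_finite[OF \<open>P \<noteq> 0\<close>] v
        by (metis card_mono leD le_trans)
    qed
    then have "(fs ! j) t0 z = 0" if "j < r" for j
    proof -
      have "coeff P j = (fs ! j) t0 z" using that by (simp add: P_def coeff_sum)
      then show ?thesis using \<open>P = 0\<close> by simp
    qed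
    then have "\<forall>F\<in>\<F>. F t0 z = 0" using fs by (auto simp: r_def in_set_conv_nth)
    moreover obtain i where "y $ i \<noteq> 0" using y(1) by (auto simp: Finite_Cartesian_Product.vec_eq_iff)
    then have "i \<noteq> k" using y(2) insert.hyps by auto
    then have "z \<noteq> 0" using \<open>y $ i \<noteq> 0\<close> e by (auto simp: z_def Finite_Cartesian_Product.vec_eq_iff intro!: exI[of _ i])
    moreover have "\<forall>j. j \<notin> insert k A \<longrightarrow> z $ j = 0" using y(2) e by (auto simp: z_def)
    ultimately show False using insert.prems(3) by blast
  qed
  then have "finite {t. \<exists>x. x \<noteq> 0 \<and> (\<forall>j. j \<notin> A \<longrightarrow> x $ j = 0) \<and> (\<forall>G\<in>R ` S. G t x = 0)}" (is "finite ?B")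
    using S(1) R by (intro insert.IH[of _ "int (m * m)"]) auto
  moreover have fin: "finite {t. F t x = 0}" if F: "gform d F" "F t0 x \<noteq> 0" for F x
  proof -
    obtain c where c: "\<forall>t. F t x = poly c t" using gform_param_poly[OF F(1)] by blast
    then have "c \<noteq> 0" using F(2) by auto
    then show ?thesis using poly_roots_finite c by simp
  qed
  have "finite ({t. H t e = 0} \<union> (\<Union>s\<in>S. {t. Q s t e = 0}))"
    using fin[OF insert.prems(2)[OF H(1)] H(2)] fin[OF Q Qe] S(1) by blast
  moreover have "t \<in> ?B \<union> ({t. H t e = 0} \<union> (\<Union>s\<in>S. {t. Q s t e = 0}))"
    if x: "x \<noteq> 0" "\<forall>j. j \<notin> insert k A \<longrightarrow> x $ j = 0" "\<forall>F\<in>\<F>. F t x = 0" for t x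
  proof (rule ccontr)
    assume asm: "\<not> ?thesis"
    then have He: "H t e \<noteq> 0" and Qe': "\<And>s. s \<in> S \<Longrightarrow> Q s t e \<noteq> 0" by auto
    \<comment> \<open>\<open>y\<close> is the projection of \<open>x\<close> along \<open>e\<close>.
      It is nonzero, since \<open>H t\<close> vanishes at \<open>x\<close> but not at nonzero
      multiples of \<open>e\<close>, and it is a common zero of the resultants, so \<open>t\<close>
      belongs to the finite set supplied by the induction.\<close>
    define y where "y = x - x $ k *s e"
    have xy: "x = y + x $ k *s e" by (simp add: y_def)
    have "y \<noteq> 0"
    proof
      assume "y = 0"
      then have "x = x $ k *s e" "x $ k \<noteq> 0" using xy x(1) by auto
      then have "H t x = (x $ k) powi d * H t e"
        using gform_scale[OF insert.prems(2)[OF H(1)], of "x $ k" t e] by simp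
      then show False using x(3) H(1) He \<open>x $ k \<noteq> 0\<close> by auto
    qed
    moreover have "\<forall>j. j \<notin> A \<longrightarrow> y $ j = 0"
      using x(2) e by (auto simp: y_def) (metis e(2,3) mult.right_neutral mult_zero_right right_minus_eq x(2) insertE)
    moreover have "R s t y = 0" if "s \<in> S" for s
    proof -
      have "L s t x = 0" using x(3) fs by (auto simp: L_def r_def intro!: sum.neutral)
      then have "H t x = 0" "Q s t x = 0" using x(3) H(1) by (auto simp: Q_def)
      then show ?thesis using R0[OF He Qe'[OF that], of y] xy by metis
    qed
    ultimately show False using asm by blast
  qed
  then have "{t. \<exists>x. x \<noteq> 0 \<and> (\<forall>j. j \<notin> insert k A \<longrightarrow> x $ j = 0) \<and> (\<forall>F\<in>\<F>. F t x = 0)}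
     \<subseteq> ?B \<union> ({t. H t e = 0} \<union> (\<Union>s\<in>S. {t. Q s t e = 0}))"
    by blast
  ultimately show ?case by (meson finite_Un finite_subset)
qed

lemma homogeneous_derivative:
  fixes p :: "('n::finite, complex) mpoly"
  assumes "homogeneous d p"
  shows "\<exists>g. (\<forall>i. form (int d - 1) (g i)) \<and> (\<forall>x. differential p x = (\<lambda>v. \<Sum>i\<in>UNIV. g i x * v $ i)) \<and>
    (\<forall>x. (peval p has_derivative differential p x) (at x))"
proof -
  obtain g where g: "\<forall>i. gform (int d - 1) (g i)"
      "\<forall>t x. (peval p has_derivative (\<lambda>v. \<Sum>i\<in>UNIV. g i t x * v $ i)) (at x)"
    using gform_has_derivative[OF homogeneous_imp_form[OF assms, unfolded form_def]] by blast
  then have "differential p x = (\<lambda>v. \<Sum>i\<in>UNIV. g i 0 x * v $ i)" for x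
    using frechet_derivative_at[OF g(2)[rule_format, of 0 x]] by simp
  moreover have "form (int d - 1) (g i 0)" for i
    using form_gform[of "int d - 1" "g i" 0] g(1) by blast
  ultimately show ?thesis using g by (intro exI[of _ "\<lambda>i. g i 0"]) auto
qed

lemma singular_pencil_members_finite:
  fixes R S :: "('n::finite, complex) mpoly"
  assumes R: "homogeneous d R" and S: "homogeneous d S"
  defines "sing \<equiv> \<lambda>t. \<exists>x. x \<noteq> 0 \<and> peval R x + t * peval S x = 0 \<and>
    (\<forall>v. differential R x v + t * differential S x v = 0)"
  assumes "\<not> sing t0"
  shows "finite {t. sing t}"
proof -
  define F where "F = (\<lambda>t x. peval R x + t * peval S x)"
  have F: "gform (int d) F"
    unfolding F_def
    using homogeneous_imp_form[OF R, unfolded form_def]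
      gform.mult[OF gform.coef[of "[:0, 1:]"] homogeneous_imp_form[OF S, unfolded form_def]]
    by (auto intro: gform.add)
  then obtain g where g: "\<And>i. gform (int d - 1) (g i)"
      "\<And>t x. (F t has_derivative (\<lambda>v. \<Sum>i\<in>UNIV. g i t x * v $ i)) (at x)"
    using gform_has_derivative by blast
  have D: "differential R x v + t * differential S x v = (\<Sum>i\<in>UNIV. g i t x * v $ i)" for t x v
  proof -
    have "(F t has_derivative (\<lambda>v. differential R x v + t * differential S x v)) (at x)"
      unfolding F_def using homogeneous_derivative[OF R] homogeneous_derivative[OF S]
      by (intro has_derivative_add has_derivative_mult_right) auto
    then have "(\<lambda>v. differential R x v + t * differential S x v) = (\<lambda>v. \<Sum>i\<in>UNIV. g i t x * v $ i)"
      using g(2) by (rule has_derivative_unique)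
    then show ?thesis by metis
  qed
  \<comment> \<open>\<open>elimination\<close> wants a single degree: the products with coordinates
    lift the partial derivatives to degree \<open>d\<close>, and at a nonzero \<open>x\<close> they
    vanish together exactly when the derivatives do.\<close>
  define \<F> where "\<F> = insert F ((\<lambda>(i, j) t x. x $ j * g i t x) ` UNIV)"
  have "finite \<F>" by (simp add: \<F>_def)
  have "gform (int d) G" if "G \<in> \<F>" for G
    using that F gform.mult[OF gform.coord g(1)] by (auto simp: \<F>_def)
  have sing: "sing t \<longleftrightarrow> (\<exists>x. x \<noteq> 0 \<and> (\<forall>k. k \<notin> UNIV \<longrightarrow> x $ k = 0) \<and> (\<forall>F\<in>\<F>. F t x = 0))" for t
  proof -
    have "(\<forall>v. (\<Sum>i\<in>UNIV. g i t x * v $ i) = 0) \<longleftrightarrow> (\<forall>i j. x $ j * g i t x = 0)" if "x \<noteq> 0" for x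
    proof
      assume *: "\<forall>v. (\<Sum>i\<in>UNIV. g i t x * v $ i) = 0"
      have "g i t x = 0" for i
        using *[rule_format, of "axis i 1"]
        by (simp add: axis_def if_distrib[of "\<lambda>c. _ * c"] cong: if_cong)
      then show "\<forall>i j. x $ j * g i t x = 0" by simp
    next
      assume *: "\<forall>i j. x $ j * g i t x = 0"
      obtain j where "x $ j \<noteq> 0" using \<open>x \<noteq> 0\<close> by (auto simp: Finite_Cartesian_Product.vec_eq_iff)
      then have "g i t x = 0" for i using * by (metis mult_eq_0_iff)
      then show "\<forall>v. (\<Sum>i\<in>UNIV. g i t x * v $ i) = 0" by simp
    qed
    then show ?thesis unfolding sing_def D by (auto simp: \<F>_def F_def)
  qed
  show ?thesis
    unfolding sing
    by (rule elimination[OF _ \<open>finite \<F>\<close>, of _ "int d" t0]) (use \<open>\<not> sing t0\<close> sing \<open>\<And>G. G \<in> \<F> \<Longrightarrow> _\<close> in auto)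
qed

subsection \<open>Zero sets of submersions\<close>

text \<open>Continuity of the derivative is asked on each vector separately, which in finite
  dimension amounts to continuity in operator norm, the form wanted by the inverse function
  theorem.\<close>

definition C1_map :: "('a::euclidean_space \<Rightarrow> 'b::euclidean_space) \<Rightarrow> ('a \<Rightarrow> 'a \<Rightarrow> 'b) \<Rightarrow> bool" where
  "C1_map \<Phi> \<Phi>' \<longleftrightarrow> (\<forall>x. (\<Phi> has_derivative \<Phi>' x) (at x)) \<and> (\<forall>h. continuous_on UNIV (\<lambda>x. \<Phi>' x h))"

text \<open>
  \<open>G\<close> is a chart at \<open>p\<close> with \<open>L (G x) = \<Phi> x\<close>, in which the zero set of \<open>\<Phi>\<close> is the kernel of \<open>L\<close>.
  Two maps with the same \<open>L\<close> and \<open>B\<close> have charts that agree where both maps vanish.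
\<close>

lemma implicit_function_chart:
  fixes \<Phi> :: "'a::euclidean_space \<Rightarrow> 'b::euclidean_space"
  assumes C1_map: "C1_map \<Phi> \<Phi>'" and "\<Phi> p = 0" and L: "linear L" and B: "linear B" and LB: "\<And>y. L (B y) = y"
    and ker: "\<And>v. \<Phi>' p v = 0 \<Longrightarrow> L v = 0"
  defines "G \<equiv> \<lambda>x. x - p - B (L (x - p)) + B (\<Phi> x)"
  shows "\<exists>U V g g'. open U \<and> p \<in> U \<and> open V \<and> 0 \<in> V \<and> homeomorphism U V G g \<and>
    (g has_derivative g') (at 0) \<and> (\<forall>v. g' (v - B (L v) + B (\<Phi>' p v)) = v)"
proof -
  have D: "(\<Phi> has_derivative \<Phi>' x) (at x)" for x using C1_map by (simp add: C1_map_def)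
  have cont: "continuous_on UNIV (\<lambda>x. \<Phi>' x h)" for h using C1_map by (simp add: C1_map_def)
  define G' where "G' = (\<lambda>x v. v - B (L v) + B (\<Phi>' x v))"
  note bl = linear_conv_bounded_linear[THEN iffD1]
  have GD: "(G has_derivative G' x) (at x)" for x
  proof -
    have "((\<lambda>x. B (L (x - p))) has_derivative (\<lambda>v. B (L v))) (at x)"
      by (auto intro!: derivative_eq_intros bounded_linear.has_derivative[OF bl[OF B]] bounded_linear.has_derivative[OF bl[OF L]])
    moreover have "((\<lambda>x. B (\<Phi> x)) has_derivative (\<lambda>v. B (\<Phi>' x v))) (at x)"
      by (rule bounded_linear.has_derivative[OF bl[OF B] D])
    ultimately have "((\<lambda>x. x - p - B (L (x - p)) + B (\<Phi> x)) has_derivative (\<lambda>v. v - 0 - B (L v) + B (\<Phi>' x v))) (at x)"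
      by (intro has_derivative_add has_derivative_diff has_derivative_ident has_derivative_const)
    then show ?thesis by (simp add: G_def G'_def)
  qed
  have blG: "bounded_linear (G' x)" for x using GD has_derivative_bounded_linear by blast
  define f' where "f' = (\<lambda>x. Blinfun (G' x))"
  have f': "blinfun_apply (f' x) = G' x" for x
    by (simp add: f'_def bounded_linear_Blinfun_apply blG)
  have contf: "continuous_on UNIV f'"
  proof (rule continuous_on_blinfun_componentwise)
    fix i :: 'a
    have "continuous_on UNIV (\<lambda>x. B (\<Phi>' x i))"
      by (rule bounded_linear.continuous_on[OF bl[OF B] cont])
    then show "continuous_on UNIV (\<lambda>x. blinfun_apply (f' x) i)"
      unfolding f' G'_def by (intro continuous_intros)
  qed
  \<comment> \<open>\<open>L\<close> sends \<open>G' p v\<close> to \<open>\<Phi>' p v\<close>. For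
    \<open>v\<close> in the kernel this and, by \<open>ker\<close>, also \<open>L v\<close> vanish,
    and then \<open>G' p v\<close> is \<open>v\<close> itself.\<close>
  have inj: "inj (G' p)"
  proof (rule linear_injective_0[OF bounded_linear.linear[OF blG], THEN iffD2], intro allI impI)
    fix v assume v: "G' p v = 0"
    have "L (G' p v) = L v - L v + \<Phi>' p v"
      using LB by (simp add: G'_def linear_add[OF L] linear_diff[OF L])
    then have "\<Phi>' p v = 0" using v linear_0[OF L] by simp
    then have "L v = 0" using ker by blast
    then show "v = 0" using v \<open>\<Phi>' p v = 0\<close> linear_0[OF B] by (simp add: G'_def)
  qed
  then obtain h where h: "linear h" "h \<circ> G' p = id"
    using linear_injective_left_inverse[OF bounded_linear.linear[OF blG]] by blast
  define invf where "invf = Blinfun h"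
  have fd: "(G has_derivative blinfun_apply (f' x)) (at x)" if "x \<in> UNIV" for x
    using GD by (simp add: f')
  have inv: "invf o\<^sub>L f' p = id_blinfun"
    by (rule blinfun_eqI) (use h bl[OF h(1)] in \<open>simp add: invf_def f' bounded_linear_Blinfun_apply fun_eq_iff\<close>)
  obtain U V g g' where UV: "open U" "U \<subseteq> UNIV" "p \<in> U" "open V" "G p \<in> V" "homeomorphism U V G g"
    "\<And>y. y \<in> V \<Longrightarrow> (g has_derivative g' y) (at y)" "\<And>y. y \<in> V \<Longrightarrow> g' y = inv_into UNIV (blinfun_apply (f' (g y)))"
    "\<And>y. y \<in> V \<Longrightarrow> bij (blinfun_apply (f' (g y)))"
    by (rule inverse_function_theorem[OF open_UNIV fd contf UNIV_I inv]) (rule UNIV_I, rule that)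
  have "G p = 0" using \<open>\<Phi> p = 0\<close> linear_0[OF L] linear_0[OF B] by (simp add: G_def)
  then have "g 0 = p" using UV(3,6) by (metis homeomorphism_apply1)
  then have "g' 0 (G' p v) = v" for v
    using UV(5,8,9) \<open>G p = 0\<close> f' by (metis bij_is_inj inv_f_f)
  then show ?thesis
    using UV \<open>G p = 0\<close> unfolding G'_def by metis
qed

text \<open>With \<open>y = \<Phi> x\<close> this is \<open>L (G x) = \<Phi> x\<close> for the chart
  \<open>G\<close> above.\<close>

lemma chart_coordinate:
  assumes "linear L" "linear B" "\<And>y. L (B y) = y"
  shows "L (x - p - B (L (x - p)) + B y) = y"
  using assms by (simp add: linear_add linear_diff)

text \<open>For \<open>L = \<Phi>' p\<close> the chart has the identity as derivative at
  \<open>p\<close>, and its inverse bends the straight line of direction \<open>v\<close>, which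
  lies in the kernel of \<open>L\<close>, into the zero set.\<close>

lemma curve_in_zero_set:
  fixes \<Phi> :: "'a::euclidean_space \<Rightarrow> 'b::euclidean_space"
  assumes "C1_map \<Phi> \<Phi>'" "\<Phi> p = 0" "surj (\<Phi>' p)" "\<Phi>' p v = 0"
  shows "\<exists>\<gamma>. (\<gamma> has_derivative (\<lambda>s. s *\<^sub>R v)) (at (0::real)) \<and> \<gamma> 0 = p \<and> (\<forall>\<^sub>F s in nhds 0. \<Phi> (\<gamma> s) = 0)"
proof -
  define L where "L = \<Phi>' p"
  have L: "linear L" unfolding L_def using assms(1) has_derivative_linear by (auto simp: C1_map_def)
  obtain B where B: "linear B" "\<And>y. L (B y) = y"
    using linear_surjective_right_inverse[OF L] assms(3) unfolding L_def by (metis comp_apply id_apply)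
  define G where "G = (\<lambda>x. x - p - B (L (x - p)) + B (\<Phi> x))"
  obtain U V g g' where UV: "open U" "p \<in> U" "open V" "0 \<in> V" "homeomorphism U V G g"
    "(g has_derivative g') (at 0)" "\<And>v. g' (v - B (L v) + B (\<Phi>' p v)) = v"
    using implicit_function_chart[OF assms(1,2) L B, folded G_def] by (metis L_def)
  have "g' v = v" using UV(7)[of v] assms(4) linear_0[OF B(1)] by (simp add: L_def)
  have "G p = 0" using \<open>\<Phi> p = 0\<close> linear_0[OF L] linear_0[OF B(1)] by (simp add: G_def)
  define \<gamma> where "\<gamma> = (\<lambda>s::real. g (s *\<^sub>R v))"
  have "(\<gamma> has_derivative (\<lambda>s. g' (s *\<^sub>R v))) (at 0)"
    unfolding \<gamma>_def by (rule has_derivative_compose[of "\<lambda>s. s *\<^sub>R v" "\<lambda>s. s *\<^sub>R v"])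
      (use UV(6) in \<open>auto intro!: derivative_eq_intros\<close>)
  moreover have "g' (s *\<^sub>R v) = s *\<^sub>R v" for s
    using linear_cmul[OF has_derivative_linear[OF UV(6)]] \<open>g' v = v\<close> by metis
  moreover have "\<gamma> 0 = p" using UV(2,5) \<open>G p = 0\<close> by (metis \<gamma>_def homeomorphism_apply1 scaleR_zero_left)
  moreover have "\<forall>\<^sub>F s in nhds 0. \<Phi> (\<gamma> s) = 0"
  proof -
    have "open ((\<lambda>s::real. s *\<^sub>R v) -` V)"
      by (intro open_vimage UV(3) continuous_intros)
    then have "\<forall>\<^sub>F s in nhds (0::real). s *\<^sub>R v \<in> V"
      using UV(4) by (auto simp: eventually_nhds intro!: exI[of _ "(\<lambda>s::real. s *\<^sub>R v) -` V"])
    then show ?thesis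
    proof eventually_elim
      case (elim s)
      then have "G (\<gamma> s) = s *\<^sub>R v" using UV(5) by (metis \<gamma>_def homeomorphism_apply2)
      then have "\<Phi> (\<gamma> s) = L (s *\<^sub>R v)" using chart_coordinate[OF L B, of "\<gamma> s" p "\<Phi> (\<gamma> s)"] by (simp add: G_def)
      then show ?case using assms(4) linear_cmul[OF L] by (simp add: L_def)
    qed
  qed
  ultimately show ?thesis by auto
qed

text \<open>Differentiate \<open>f\<close> along a curve in the zero set with velocity
  \<open>v\<close>. Thus the kernel of \<open>\<Phi>' p\<close> serves as the tangent space for
  every function that vanishes on the zero set near \<open>p\<close>.\<close>

lemma derivative_vanishes_on_tangent:
  fixes \<Phi> :: "'a::euclidean_space \<Rightarrow> 'b::euclidean_space" and f :: "'a \<Rightarrow> 'c::real_normed_vector"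
  assumes "C1_map \<Phi> \<Phi>'" "\<Phi> p = 0" "surj (\<Phi>' p)" "\<Phi>' p v = 0"
    and f: "(f has_derivative f') (at p)" "\<forall>\<^sub>F x in nhds p. \<Phi> x = 0 \<longrightarrow> f x = 0"
  shows "f' v = 0"
proof -
  obtain \<gamma> where \<gamma>: "(\<gamma> has_derivative (\<lambda>s. s *\<^sub>R v)) (at (0::real))" "\<gamma> 0 = p" "\<forall>\<^sub>F s in nhds 0. \<Phi> (\<gamma> s) = 0"
    using curve_in_zero_set[OF assms(1-4)] by blast
  have "isCont \<gamma> 0" using \<gamma>(1) has_derivative_continuous by blast
  then have "filterlim \<gamma> (nhds p) (nhds 0)"
    using \<gamma>(2) by (simp add: isCont_def tendsto_nhds_iff)
  then have "\<forall>\<^sub>F s in nhds 0. \<Phi> (\<gamma> s) = 0 \<longrightarrow> f (\<gamma> s) = 0"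
    using f(2) by (rule eventually_compose_filterlim[rotated])
  then have ev: "\<forall>\<^sub>F s in nhds 0. f (\<gamma> s) = 0" using \<gamma>(3) by eventually_elim auto
  have "((\<lambda>s. f (\<gamma> s)) has_derivative (\<lambda>s. f' (s *\<^sub>R v))) (at 0)"
    using has_derivative_compose[OF \<gamma>(1)] f(1) \<gamma>(2) by metis
  moreover have "((\<lambda>s. f (\<gamma> s)) has_derivative (\<lambda>s. 0)) (at 0)"
  proof (rule has_derivative_transform_eventually[OF has_derivative_const[of 0]])
    show "\<forall>\<^sub>F s in at 0. 0 = f (\<gamma> s)"
      using ev unfolding eventually_nhds_conv_at by (auto elim: eventually_mono)
    show "0 = f (\<gamma> 0)" using eventually_nhds_x_imp_x[OF ev] by simp
  qed simp
  ultimately have "(\<lambda>s. f' (s *\<^sub>R v)) = (\<lambda>s::real. 0)" by (rule has_derivative_unique)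
  then show ?thesis by (metis scaleR_one)
qed

text \<open>Two manifold germs of equal dimension, one inside the other, coincide. The inclusion
  puts the kernel of \<open>\<Phi>' p\<close> into that of \<open>L = \<Psi>' p\<close>, so the same
  \<open>L\<close> and \<open>B\<close> give charts for both maps.\<close>

lemma zero_set_inclusion_imp_eq:
  fixes \<Phi> \<Psi> :: "'a::euclidean_space \<Rightarrow> 'b::euclidean_space"
  assumes \<Phi>: "C1_map \<Phi> \<Phi>'" "\<Phi> p = 0" "surj (\<Phi>' p)" and \<Psi>: "C1_map \<Psi> \<Psi>'" "\<Psi> p = 0" "surj (\<Psi>' p)"
    and sub: "\<forall>\<^sub>F x in nhds p. \<Phi> x = 0 \<longrightarrow> \<Psi> x = 0"
  shows "\<forall>\<^sub>F x in nhds p. \<Psi> x = 0 \<longrightarrow> \<Phi> x = 0"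
proof -
  define L where "L = \<Psi>' p"
  have L: "linear L" unfolding L_def using \<Psi>(1) has_derivative_linear by (auto simp: C1_map_def)
  obtain B where B: "linear B" "\<And>y. L (B y) = y"
    using linear_surjective_right_inverse[OF L] \<Psi>(3) unfolding L_def by (metis comp_apply id_apply)
  have ker: "L v = 0" if "\<Phi>' p v = 0" for v
    unfolding L_def using \<Psi>(1) sub by (intro derivative_vanishes_on_tangent[OF \<Phi> that]) (auto simp: C1_map_def)
  define G where "G = (\<lambda>\<Phi> x. x - p - B (L (x - p)) + B (\<Phi> x))"
  have ex\<Phi>: "\<exists>U V g g'. open U \<and> p \<in> U \<and> open V \<and> 0 \<in> V \<and> homeomorphism U V (G \<Phi>) g \<and>
    (g has_derivative g') (at 0) \<and> (\<forall>v. g' (v - B (L v) + B (\<Phi>' p v)) = v)"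
    unfolding G_def by (rule implicit_function_chart[OF \<Phi>(1,2) L B ker])
  have ex\<Psi>: "\<exists>U V g g'. open U \<and> p \<in> U \<and> open V \<and> 0 \<in> V \<and> homeomorphism U V (G \<Psi>) g \<and>
    (g has_derivative g') (at 0) \<and> (\<forall>v. g' (v - B (L v) + B (\<Psi>' p v)) = v)"
    unfolding G_def by (rule implicit_function_chart[OF \<Psi>(1,2) L B]) (simp add: L_def)
  obtain U V g g' where UV: "open U" "p \<in> U" "open V" "0 \<in> V" "homeomorphism U V (G \<Phi>) g" "(g has_derivative g') (at 0)"
    using ex\<Phi> by blast
  obtain U2 V2 g2 where UV2: "open U2" "p \<in> U2" "homeomorphism U2 V2 (G \<Psi>) g2"
    using ex\<Psi> by blast
  have G0: "G \<Phi> p = 0" "G \<Psi> p = 0" using \<Phi>(2) \<Psi>(2) linear_0[OF L] linear_0[OF B(1)] by (simp_all add: G_def)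
  have "isCont (\<lambda>x. G \<Psi> x) p"
    unfolding G_def
  proof (intro continuous_add continuous_diff continuous_ident continuous_const)
    have iB: "isCont B y" for y
      by (rule linear_continuous_at[OF linear_conv_bounded_linear[THEN iffD1, OF B(1)]])
    have iL: "isCont L y" for y
      by (rule linear_continuous_at[OF linear_conv_bounded_linear[THEN iffD1, OF L]])
    have i\<Psi>: "isCont \<Psi> p" using \<Psi>(1) has_derivative_continuous unfolding C1_map_def by blast
    show "isCont (\<lambda>x. B (\<Psi> x)) p" by (rule isCont_o2[OF i\<Psi> iB])
    have "isCont (\<lambda>x. L (x - p)) p" by (rule isCont_o2[OF _ iL]) (intro continuous_intros)
    then show "isCont (\<lambda>x. B (L (x - p))) p" by (rule isCont_o2[OF _ iB])
  qed
  then have lim: "filterlim (G \<Psi>) (nhds 0) (nhds p)" using G0 by (simp add: isCont_def tendsto_nhds_iff)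
  have g0: "g 0 = p" using UV(2,5) G0 by (metis homeomorphism_apply1)
  have "isCont g 0" using UV(6) has_derivative_continuous by blast
  then have limg: "filterlim g (nhds p) (nhds 0)" using g0 by (simp add: isCont_def tendsto_nhds_iff)
  have "\<forall>\<^sub>F x in nhds p. x \<in> U2" using UV2 by (meson eventually_nhds)
  with sub have "\<forall>\<^sub>F x in nhds p. (\<Phi> x = 0 \<longrightarrow> \<Psi> x = 0) \<and> x \<in> U2" by (rule eventually_conj)
  then have "\<forall>\<^sub>F w in nhds 0. (\<Phi> (g w) = 0 \<longrightarrow> \<Psi> (g w) = 0) \<and> g w \<in> U2"
    using limg by (rule eventually_compose_filterlim)
  moreover have "\<forall>\<^sub>F w in nhds 0. w \<in> V" using UV by (meson eventually_nhds)
  ultimately have "\<forall>\<^sub>F w in nhds 0. ((\<Phi> (g w) = 0 \<longrightarrow> \<Psi> (g w) = 0) \<and> g w \<in> U2) \<and> w \<in> V"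
    by (rule eventually_conj)
  then have "\<forall>\<^sub>F x in nhds p. ((\<Phi> (g (G \<Psi> x)) = 0 \<longrightarrow> \<Psi> (g (G \<Psi> x)) = 0) \<and> g (G \<Psi> x) \<in> U2) \<and> G \<Psi> x \<in> V"
    using lim by (rule eventually_compose_filterlim)
  with \<open>\<forall>\<^sub>F x in nhds p. x \<in> U2\<close> show ?thesis
  proof eventually_elim
    case (elim x)
    show ?case
    proof
      assume "\<Psi> x = 0"
      \<comment> \<open>\<open>y\<close> has the same coordinate \<open>w\<close> in the chart of
        \<open>\<Phi>\<close> as \<open>x\<close> in the chart of \<open>\<Psi>\<close>. Since
        \<open>L w = 0\<close>, it is a zero of \<open>\<Phi>\<close>, hence of
        \<open>\<Psi>\<close>; there the charts agree, and injectivity of the second one gives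
        \<open>y = x\<close>.\<close>
      define w where "w = G \<Psi> x"
      define y where "y = g w"
      have "L w = 0" using chart_coordinate[OF L B, of x p "\<Psi> x"] \<open>\<Psi> x = 0\<close> by (simp add: w_def G_def)
      have Gy: "G \<Phi> y = w" using elim UV(5) by (metis homeomorphism_apply2 w_def y_def)
      then have "\<Phi> y = 0" using chart_coordinate[OF L B, of y p "\<Phi> y"] \<open>L w = 0\<close> by (simp add: G_def)
      then have "\<Psi> y = 0" using elim by (simp add: y_def w_def)
      then have "G \<Psi> y = w" using Gy \<open>\<Phi> y = 0\<close> by (simp add: G_def)
      moreover have "x \<in> U2" "y \<in> U2" using elim by (auto simp: y_def w_def)
      ultimately have "x = y" using UV2(3) by (metis homeomorphism_apply1 w_def)
      then show "\<Phi> x = 0" using \<open>\<Phi> y = 0\<close> by simp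
    qed
  qed
qed

text \<open>Elimination in two unknowns, over any field because it serves both the complex and the
  real differentials.\<close>

lemma functional_pair_surj:
  fixes \<phi> \<psi> :: "'a::field ^ 'n \<Rightarrow> 'a"
  assumes \<phi>: "\<And>u v. \<phi> (u + v) = \<phi> u + \<phi> v" "\<And>c v. \<phi> (c *s v) = c * \<phi> v"
    and \<psi>: "\<And>u v. \<psi> (u + v) = \<psi> u + \<psi> v" "\<And>c v. \<psi> (c *s v) = c * \<psi> v"
    and indep: "\<And>a b. \<forall>v. a * \<phi> v + b * \<psi> v = 0 \<Longrightarrow> a = 0 \<and> b = 0"
  shows "\<exists>v. \<phi> v = \<alpha> \<and> \<psi> v = \<beta>"
proof -
  obtain v where v: "\<phi> v \<noteq> 0" using indep[of 1 0] by auto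
  have "\<not> (\<forall>w. - (\<psi> v / \<phi> v) * \<phi> w + 1 * \<psi> w = 0)"
  proof
    assume "\<forall>w. - (\<psi> v / \<phi> v) * \<phi> w + 1 * \<psi> w = 0"
    from indep[OF this] show False by simp
  qed
  then obtain w where w: "- (\<psi> v / \<phi> v) * \<phi> w + 1 * \<psi> w \<noteq> 0" unfolding not_all ..
  \<comment> \<open>\<open>w\<close> is corrected along \<open>v\<close> into the kernel of
    \<open>\<phi>\<close>; that \<open>\<psi>\<close> survives there is the failure of
    proportionality.\<close>
  define u where "u = w + (- (\<phi> w / \<phi> v)) *s v"
  have u: "\<phi> u = 0" "\<psi> u \<noteq> 0"
  proof -
    have "\<phi> u = \<phi> w + - (\<phi> w / \<phi> v) * \<phi> v" unfolding u_def \<phi> ..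
    then show "\<phi> u = 0" using v by simp
    have "\<psi> u = \<psi> w + - (\<phi> w / \<phi> v) * \<psi> v" unfolding u_def \<psi> ..
    then show "\<psi> u \<noteq> 0" using w by (simp add: mult.commute)
  qed
  define z where "z = (\<alpha> / \<phi> v) *s v + ((\<beta> - \<alpha> / \<phi> v * \<psi> v) / \<psi> u) *s u"
  have "\<phi> z = (\<alpha> / \<phi> v) * \<phi> v + ((\<beta> - \<alpha> / \<phi> v * \<psi> v) / \<psi> u) * \<phi> u"
    unfolding z_def \<phi> ..
  moreover have "\<psi> z = (\<alpha> / \<phi> v) * \<psi> v + ((\<beta> - \<alpha> / \<phi> v * \<psi> v) / \<psi> u) * \<psi> u"
    unfolding z_def \<psi> ..
  ultimately have "\<phi> z = \<alpha>" "\<psi> z = \<beta>" using u v by simp_all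
  then show ?thesis by blast
qed

subsection \<open>Division of forms\<close>

lemma form_add: "form d f \<Longrightarrow> form d g \<Longrightarrow> form d (\<lambda>x. f x + g x)"
  unfolding form_def by (rule gform.add)

lemma form_diff: "form d f \<Longrightarrow> form d g \<Longrightarrow> form d (\<lambda>x. f x - g x)"
  unfolding form_def by (rule gform_diff)

lemma form_mult: "form d f \<Longrightarrow> form e g \<Longrightarrow> form (d + e) (\<lambda>x. f x * g x)"
  unfolding form_def by (rule gform.mult)

lemma form_cmult: "form d f \<Longrightarrow> form d (\<lambda>x. a * f x)"
  unfolding form_def by (rule gform_cmult)

lemma form_power: "form d f \<Longrightarrow> form (int k * d) (\<lambda>x. f x ^ k)"
  unfolding form_def by (rule gform_power)

lemma form_zero: "form d (\<lambda>x. 0)"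
  unfolding form_def by (rule gform.zero)

lemma form_coord: "form 1 (\<lambda>x. x $ i)"
  unfolding form_def by (rule gform.coord)

lemma form_neg: "form d f \<Longrightarrow> d < 0 \<Longrightarrow> f x = 0"
  unfolding form_def by (rule gform_neg)

lemma form_scale: "form d f \<Longrightarrow> c \<noteq> 0 \<Longrightarrow> f (c *s x) = c powi d * f x"
  unfolding form_def by (rule gform_scale)

lemma form_has_derivative:
  assumes "form d f"
  shows "\<exists>g. (\<forall>i. form (d - 1) (g i)) \<and>
    (\<forall>x. (f has_derivative (\<lambda>v. \<Sum>i\<in>UNIV. g i x * v $ i)) (at x))"
proof -
  obtain g where g: "\<forall>i. gform (d - 1) (g i)"
      "\<forall>t x. (f has_derivative (\<lambda>v. \<Sum>i\<in>UNIV. g i t x * v $ i)) (at x)"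
    using gform_has_derivative[OF assms[unfolded form_def]] by blast
  have "form (d - 1) (g i 0)" for i using form_gform[of "d - 1" "g i" 0] g(1) by blast
  then show ?thesis using g(2) by (intro exI[of _ "\<lambda>i. g i 0"]) auto
qed

lemma form_isCont: "form d f \<Longrightarrow> isCont f x"
  using form_has_derivative has_derivative_continuous by blast

lemma form_continuous_on: "form d f \<Longrightarrow> continuous_on S f"
  by (intro continuous_at_imp_continuous_on ballI form_isCont)

section \<open>Restriction of forms to lines and pseudo-division\<close>

lemma norm_smult_vec: "norm (c *s (x :: complex ^ 'n::finite)) = norm c * norm x"
  by (simp add: norm_vec_def norm_mult L2_set_right_distrib)

lemma bounded_linear_smult_vec: "bounded_linear (\<lambda>u. u *s (w :: complex ^ 'n::finite))"
  by (rule bounded_linear_intro[of _ "norm w"])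
    (simp_all add: vector_sadd_rdistrib norm_smult_vec Finite_Cartesian_Product.vec_eq_iff)

text \<open>The description has a meaning for forms, where \<open>poly_along_form\<close> supplies a
  polynomial and its values determine it.\<close>

definition poly_along :: "complex ^ 'n::finite \<Rightarrow> (complex ^ 'n \<Rightarrow> complex) \<Rightarrow> complex ^ 'n \<Rightarrow> complex poly" where
  "poly_along e f y = (THE p. \<forall>s. f (y + s *s e) = poly p s)"

lemma poly_along_eqI: "(\<And>s. f (y + s *s e) = poly p s) \<Longrightarrow> poly_along e f y = p"
  unfolding poly_along_def by (rule the_equality) (auto simp: poly_eq_poly_eq_iff[symmetric] fun_eq_iff)

lemma poly_along_form:
  assumes "form d f"
  shows poly_poly_along: "poly (poly_along e f y) s = f (y + s *s e)"
    and form_coeff_poly_along: "form (d - int i) (\<lambda>y. coeff (poly_along e f y) i)"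
proof -
  obtain p where p: "\<And>y s. f (y + s *s e) = poly (p 0 y) s" "\<And>i. gform (d - int i) (\<lambda>t y. coeff (p t y) i)"
    using gform_shift[OF assms[unfolded form_def], of e] by blast
  have eq: "poly_along e f y = p 0 y" for y using p(1) by (rule poly_along_eqI)
  show "poly (poly_along e f y) s = f (y + s *s e)" using p(1) eq by simp
  have "form (d - int i) ((\<lambda>t y. coeff (p t y) i) 0)" using p(2) by (rule form_gform)
  then show "form (d - int i) (\<lambda>y. coeff (poly_along e f y) i)" by (simp add: eq)
qed

lemma coeff_poly_along_top:
  assumes "form (int d) f"
  shows "degree (poly_along e f y) \<le> d" "coeff (poly_along e f y) d = f e"
proof -
  have g: "gform (int d - int i) (\<lambda>t y. coeff (poly_along e f y) i)" for i
    using form_coeff_poly_along[OF assms] unfolding form_def .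
  show "degree (poly_along e f y) \<le> d" "coeff (poly_along e f y) d = f e"
    using gform_shift_coeff_top[of d "\<lambda>t y. poly_along e f y" "\<lambda>t. f" e] g poly_poly_along[OF assms] by metis+
qed

text \<open>The bound is strict, so that remainders of division are treated alike, down to
  \<open>m = 0\<close>, which singles out the zero form.\<close>

definition low_degree_along :: "complex ^ 'n::finite \<Rightarrow> nat \<Rightarrow> (complex ^ 'n \<Rightarrow> complex) \<Rightarrow> bool" where
  "low_degree_along e m f \<longleftrightarrow> (\<forall>y i. m \<le> i \<longrightarrow> coeff (poly_along e f y) i = 0)"

lemma low_degree_along_0: "form d f \<Longrightarrow> low_degree_along e 0 f \<Longrightarrow> f y = 0"
  using poly_poly_along[of d f e y 0] by (simp add: low_degree_along_def poly_eq_iff poly_altdef)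

lemma low_degree_along_ex: "form d f \<Longrightarrow> low_degree_along e (Suc (nat d)) f"
  unfolding low_degree_along_def
proof (intro allI impI)
  fix y i assume f: "form d f" and "Suc (nat d) \<le> i"
  then have "d - int i < 0" by linarith
  then show "coeff (poly_along e f y) i = 0" using form_neg[OF form_coeff_poly_along[OF f, of i e], of y] by simp
qed

lemma coeff_pcompose_shift:
  fixes p :: "complex poly"
  assumes "degree p \<le> m" shows "coeff (pcompose p [:a, 1:]) m = coeff p m"
proof (cases "degree p = m")
  case True
  then show ?thesis using lead_coeff_comp[of "[:a, 1:]" p] by (simp add: degree_pcompose)
next
  case False
  then show ?thesis using assms by (simp add: coeff_eq_0 degree_pcompose)
qed

lemma coeff_mult_top:
  fixes p q :: "complex poly"
  assumes "degree p \<le> m" "degree q \<le> n" shows "coeff (p * q) (m + n) = coeff p m * coeff q n"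
proof (cases "degree p = m \<and> degree q = n")
  case True
  then show ?thesis by (metis coeff_mult_degree_sum)
next
  case False
  then have "degree p < m \<or> degree q < n" using assms by auto
  moreover have "degree (p * q) < m + n" using calculation assms degree_mult_le[of p q] by linarith
  ultimately show ?thesis by (auto simp: coeff_eq_0)
qed

text \<open>Moving the base point along \<open>e\<close> substitutes \<open>s + a\<close>, which
  leaves a leading coefficient alone. The coefficient is therefore a form constant along
  \<open>e\<close>, a scalar for division along \<open>e\<close>.\<close>

lemma coeff_poly_along_invariant:
  assumes f: "form d f" and "low_degree_along e (Suc m) f"
  shows "coeff (poly_along e f (y + a *s e)) m = coeff (poly_along e f y) m"
proof -
  have "poly_along e f (y + a *s e) = pcompose (poly_along e f y) [:a, 1:]"
    by (rule poly_along_eqI) (simp add: poly_pcompose poly_poly_along[OF f] vector_sadd_rdistrib add.assoc)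
  moreover have "degree (poly_along e f y) \<le> m"
    using assms(2) by (intro degree_le) (auto simp: low_degree_along_def)
  ultimately show ?thesis by (metis coeff_pcompose_shift)
qed

text \<open>Each division step multiplies by \<open>b\<close>, the leading coefficient of
  \<open>h\<close> along \<open>e\<close>, instead of dividing by it. Integer degrees let the
  quotient have formally negative degree, and then it is 0.\<close>

lemma pseudo_division:
  assumes h: "form dh h" "low_degree_along e (Suc k) h" and e: "e \<noteq> 0" and f: "form d f"
  defines "b \<equiv> \<lambda>y. coeff (poly_along e h y) k"
  shows "\<exists>s q r. form (d + int s * (dh - int k) - dh) q \<and> form (d + int s * (dh - int k)) r \<and>
    low_degree_along e k r \<and> (\<forall>y. b y ^ s * f y = q y * h y + r y)"
proof -
  obtain i where "e $ i \<noteq> 0" using e by (auto simp: Finite_Cartesian_Product.vec_eq_iff)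
  \<comment> \<open>The linear form \<open>l\<close> with value 1 at \<open>e\<close> is the
    variable of the division: on a line of direction \<open>e\<close> it is \<open>s\<close> up to a
    shift.\<close>
  define l where "l = (\<lambda>y. inverse (e $ i) * y $ i)"
  have l: "form 1 l" "\<And>y s. l (y + s *s e) = l y + s"
  proof -
    show "form 1 l" unfolding l_def by (intro form_cmult form_coord)
    show "l (y + s *s e) = l y + s" for y s
      using \<open>e $ i \<noteq> 0\<close> by (simp add: l_def distrib_left)
  qed
  have b: "form (dh - int k) b" "\<And>y s. b (y + s *s e) = b y"
    unfolding b_def using form_coeff_poly_along[OF h(1)] coeff_poly_along_invariant[OF h] by auto
  have "low_degree_along e M f \<Longrightarrow> form d f \<Longrightarrow> ?thesis" for M
  proof (induction M arbitrary: f d)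
    case (0)
    then show ?case
      by (intro exI[of _ 0] exI[of _ "\<lambda>x. 0"] exI[of _ f]) (auto simp: form_zero low_degree_along_def)
  next
    case (Suc N)
    show ?case
    proof (cases "Suc N \<le> k")
      case True
      then show ?thesis using Suc.prems
        by (intro exI[of _ 0] exI[of _ "\<lambda>x. 0"] exI[of _ f]) (auto simp: form_zero low_degree_along_def)
    next
      case False
      then have "k \<le> N" by simp
      define c where "c = (\<lambda>y. coeff (poly_along e f y) N)"
      have c: "form (d - int N) c" "\<And>y s. c (y + s *s e) = c y"
        unfolding c_def using form_coeff_poly_along[OF Suc.prems(2)] coeff_poly_along_invariant[OF Suc.prems(2,1)] by auto
      \<comment> \<open>\<open>m * h\<close> has along \<open>e\<close> the same term of degree
        \<open>N\<close> as \<open>b * f\<close>, so \<open>f'\<close> drops below degree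
        \<open>N\<close>.\<close>
      define m where "m = (\<lambda>y. c y * l y ^ (N - k))"
      have m: "form (d - int k) m"
        using form_mult[OF c(1) form_power[OF l(1), of "N - k"]] \<open>k \<le> N\<close> by (simp add: m_def of_nat_diff)
      define f' where "f' = (\<lambda>y. b y * f y - m y * h y)"
      have f': "form (d + (dh - int k)) f'"
      proof -
        have "form (dh - int k + d) (\<lambda>y. b y * f y)" by (rule form_mult[OF b(1) Suc.prems(2)])
        moreover have "form (d - int k + dh) (\<lambda>y. m y * h y)" by (rule form_mult[OF m h(1)])
        ultimately show ?thesis unfolding f'_def
          by (intro form_diff) (simp_all add: algebra_simps)
      qed
      have "low_degree_along e N f'"
        unfolding low_degree_along_def
      proof (intro allI impI)
        fix y i assume "N \<le> i"
        have eq: "poly_along e f' y = Polynomial.smult (b y) (poly_along e f y) - Polynomial.smult (c y) ([:l y, 1:] ^ (N - k) * poly_along e h y)"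
          by (rule poly_along_eqI)
            (simp add: f'_def m_def b(2) c(2) l(2) poly_poly_along[OF Suc.prems(2)] poly_poly_along[OF h(1)])
        have d1: "degree ([:l y, 1:] ^ (N - k)) \<le> N - k" "coeff ([:l y, 1:] ^ (N - k)) (N - k) = 1"
          using degree_linear_power[of "l y" "N - k"] coeff_linear_power[of "l y" "N - k"] by auto
        have d2: "degree (poly_along e h y) \<le> k" using h(2) by (intro degree_le) (auto simp: low_degree_along_def)
        have top: "coeff ([:l y, 1:] ^ (N - k) * poly_along e h y) N = b y"
          using coeff_mult_top[OF d1(1) d2] d1(2) \<open>k \<le> N\<close> by (simp add: b_def)
        have "degree ([:l y, 1:] ^ (N - k) * poly_along e h y) \<le> N"
          using degree_mult_le[of "[:l y, 1:] ^ (N - k)" "poly_along e h y"] d1(1) d2 \<open>k \<le> N\<close> by linarith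
        then show "coeff (poly_along e f' y) i = 0"
          using \<open>N \<le> i\<close> top Suc.prems(1)
          by (cases "i = N") (auto simp: eq c_def low_degree_along_def coeff_eq_0)
      qed
      then obtain s q r where sqr: "form (d + (dh - int k) + int s * (dh - int k) - dh) q"
          "form (d + (dh - int k) + int s * (dh - int k)) r" "low_degree_along e k r" "\<forall>y. b y ^ s * f' y = q y * h y + r y"
        using Suc.IH[OF _ f'] by blast
      have "form (int s * (dh - int k) + (d - int k)) (\<lambda>y. b y ^ s * m y)"
        by (intro form_mult form_power b(1) m)
      then have "form (d + int (Suc s) * (dh - int k) - dh) (\<lambda>y. q y + b y ^ s * m y)"
        using sqr(1) by (intro form_add) (simp_all add: algebra_simps)
      moreover have "form (d + int (Suc s) * (dh - int k)) r"
        using sqr(2) by (simp add: algebra_simps)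
      moreover have "b y ^ Suc s * f y = (q y + b y ^ s * m y) * h y + r y" for y
        using sqr(4)[rule_format, of y] by (simp add: f'_def algebra_simps)
      ultimately show ?thesis using sqr(3) by blast
    qed
  qed
  then show ?thesis using low_degree_along_ex[OF f] f by blast
qed

section \<open>Divisibility from local bounds\<close>

text \<open>A root \<open>a\<close> of \<open>q\<close> is a root of \<open>p\<close> by continuity,
  and cancelling the factor keeps the bound away from \<open>a\<close>. The exceptional set
  \<open>E\<close> absorbs these cancelled roots.\<close>

lemma poly_dvd_of_bounded_quotient:
  fixes p q :: "complex poly"
  assumes "q \<noteq> 0" "finite E" "\<And>R. \<exists>K. \<forall>s. norm s \<le> R \<longrightarrow> s \<notin> E \<longrightarrow> norm (poly p s) \<le> K * norm (poly q s)"
  shows "q dvd p"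
  using assms
proof (induction "degree q" arbitrary: p q E)
  case 0
  then show ?case by (metis is_unit_iff_degree unit_imp_dvd)
next
  case (Suc n)
  then have "\<not> constant (poly q)" by (simp add: constant_degree)
  then obtain a where "poly q a = 0" using fundamental_theorem_of_algebra by blast
  then obtain q' where q': "q = [:- a, 1:] * q'" by (auto simp: poly_eq_0_iff_dvd elim: dvdE)
  have "q' \<noteq> 0" using q' Suc.prems(1) by auto
  have "degree q = Suc (degree q')" using q' \<open>q' \<noteq> 0\<close> by (simp add: degree_mult_eq del: mult_pCons_left)
  obtain K where K: "\<And>s. norm s \<le> norm a + 1 \<Longrightarrow> s \<notin> E \<Longrightarrow> norm (poly p s) \<le> K * norm (poly q s)"
    using Suc.prems(3)[of "norm a + 1"] by blast
  have "\<forall>\<^sub>F s in at a. s \<in> ball a 1" by (rule eventually_at_in_open') auto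
  moreover have "\<forall>\<^sub>F s in at a. s \<in> - (E - {a}) - {a}"
    using Suc.prems(2) by (intro eventually_at_in_open open_Compl finite_imp_closed finite_Diff) auto
  ultimately have ev: "\<forall>\<^sub>F s in at a. norm (poly p s) \<le> K * norm (poly q s)"
  proof eventually_elim
    case (elim s)
    have "norm s \<le> norm a + norm (s - a)" by norm
    then show ?case using elim by (intro K) (auto simp: dist_norm norm_minus_commute)
  qed
  have "((\<lambda>s. norm (poly p s)) \<longlongrightarrow> norm (poly p a)) (at a)"
    "((\<lambda>s. K * norm (poly q s)) \<longlongrightarrow> K * norm (poly q a)) (at a)"
    by (intro tendsto_intros; simp add: isCont_def[symmetric])+
  then have "norm (poly p a) \<le> K * norm (poly q a)"
    using ev by (intro tendsto_le[OF trivial_limit_at])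
  then obtain p' where p': "p = [:- a, 1:] * p'"
    using \<open>poly q a = 0\<close> by (auto simp: poly_eq_0_iff_dvd elim: dvdE)
  have "q' dvd p'"
  proof (rule Suc.hyps(1))
    show "n = degree q'" using Suc.hyps(2) \<open>degree q = Suc (degree q')\<close> by simp
    show "finite (insert a E)" using Suc.prems(2) by simp
    fix R
    obtain K where K: "\<And>s. norm s \<le> R \<Longrightarrow> s \<notin> E \<Longrightarrow> norm (poly p s) \<le> K * norm (poly q s)"
      using Suc.prems(3)[of R] by blast
    have "norm (poly p' s) \<le> K * norm (poly q' s)" if "norm s \<le> R" "s \<notin> insert a E" for s
    proof -
      have "norm (s - a) * norm (poly p' s) \<le> norm (s - a) * (K * norm (poly q' s))"
        using K[of s] that by (simp add: p' q' norm_mult[symmetric] algebra_simps del: mult_pCons_left)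
      then show ?thesis using that by simp
    qed
    then show "\<exists>K. \<forall>s. norm s \<le> R \<longrightarrow> s \<notin> insert a E \<longrightarrow> norm (poly p' s) \<le> K * norm (poly q' s)"
      by blast
  qed (fact \<open>q' \<noteq> 0\<close>)
  then show ?case unfolding p' q' by (rule mult_dvd_mono[OF dvd_refl])
qed

text \<open>Both come from the factorization into linear factors; a root farther from 0 than
  \<open>a\<close> satisfies |a - root| \<le> 2 |root|. Read backwards, the second bound yields a
  root near 0 whenever \<open>p\<close> is much smaller at 0 than at \<open>a\<close>: continuity of
  roots in a quantitative form.\<close>

lemma poly_norm_bounds:
  fixes p :: "complex poly"
  shows "(\<And>s. poly p s = 0 \<Longrightarrow> norm s \<le> R) \<Longrightarrow> norm (poly p 0) \<le> norm (lead_coeff p) * R ^ degree p"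
    and "(\<And>s. poly p s = 0 \<Longrightarrow> norm a < norm s) \<Longrightarrow> norm (poly p a) \<le> 2 ^ degree p * norm (poly p 0)"
proof -
  obtain root where root: "Polynomial.smult (lead_coeff p) (\<Prod>i<degree p. [:- root i, 1:]) = p"
    using complex_poly_decompose' by blast
  then have ev: "poly p s = lead_coeff p * (\<Prod>i<degree p. s - root i)" for s
    by (metis (no_types, lifting) poly_prod poly_smult prod.cong add_uminus_conv_diff mult.right_neutral poly_0 poly_pCons add_0_right mult_zero_right add.commute)
  have rt: "poly p (root i) = 0" if "i < degree p" for i
    unfolding ev using that by (auto intro!: bexI[of _ i])
  show "norm (poly p 0) \<le> norm (lead_coeff p) * R ^ degree p" if R: "\<And>s. poly p s = 0 \<Longrightarrow> norm s \<le> R"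
  proof -
    have "(\<Prod>i<degree p. norm (0 - root i)) \<le> (\<Prod>i<degree p. R)"
      using R rt by (intro prod_mono) auto
    then show ?thesis unfolding ev norm_mult prod_norm[symmetric] by (simp add: mult_left_mono)
  qed
  show "norm (poly p a) \<le> 2 ^ degree p * norm (poly p 0)" if a: "\<And>s. poly p s = 0 \<Longrightarrow> norm a < norm s"
  proof -
    have "(\<Prod>i<degree p. norm (a - root i)) \<le> (\<Prod>i<degree p. 2 * norm (0 - root i))"
    proof (intro prod_mono conjI)
      fix i assume "i \<in> {..<degree p}"
      then have "norm a < norm (root i)" using a rt by simp
      moreover have "norm (a - root i) \<le> norm a + norm (root i)" by (rule norm_triangle_ineq4)
      ultimately show "norm (a - root i) \<le> 2 * norm (0 - root i)" by simp
    qed simp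
    then have "norm (lead_coeff p) * (\<Prod>i<degree p. norm (a - root i))
        \<le> norm (lead_coeff p) * (\<Prod>i<degree p. 2 * norm (0 - root i))"
      by (intro mult_left_mono) auto
    then show ?thesis unfolding ev norm_mult prod_norm[symmetric] prod.distrib by (simp add: mult_ac)
  qed
qed

text \<open>In a direction \<open>v\<close> with \<open>b v \<noteq> 0\<close> the form
  \<open>b\<close> is monic up to a constant, so the remainder of \<open>h\<close> is bounded by
  \<open>b\<close> as \<open>h\<close> is. On each line \<open>b\<close> then divides a remainder of
  smaller degree, which must be 0.\<close>

lemma form_dvd_of_bounded_quotient:
  assumes b: "form db b" and h: "form dh h" and "b v0 \<noteq> 0"
    and bound: "\<And>R. \<exists>K. \<forall>y. norm y \<le> R \<longrightarrow> b y \<noteq> 0 \<longrightarrow> norm (h y) \<le> K * norm (b y)"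
  shows "\<exists>q. form (dh - db) q \<and> (\<forall>y. h y = b y * q y)"
proof -
  have "db \<ge> 0" using form_neg[OF b] assms(3) by (meson not_less)
  then obtain k where k: "db = int k" using nonneg_int_cases by blast
  \<comment> \<open>A direction must be nonzero. If \<open>v0 = 0\<close>, then \<open>b\<close> has
    degree 0 and is constant, and any coordinate vector will do.\<close>
  obtain v where v: "v \<noteq> 0" "b v \<noteq> 0"
  proof (cases "v0 = 0")
    case True
    then have "db = 0" using gform_at_zero[OF b[unfolded form_def]] assms(3) by auto
    then have "b (axis undefined 1) = b 0"
      using gform_degree_0[of "\<lambda>t. b"] b by (simp add: form_def)
    then show ?thesis using that[of "axis undefined 1"] True assms(3) by (simp add: axis_eq_0_iff)
  qed (use that assms(3) in blast)
  note top = coeff_poly_along_top[OF b[unfolded k]]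
  have low: "low_degree_along v (Suc k) b" using low_degree_along_ex[OF b] by (simp add: k)
  obtain s q r where sqr: "form (dh + int s * (db - int k) - db) q" "form (dh + int s * (db - int k)) r"
      "low_degree_along v k r" "\<And>y. b v ^ s * h y = q y * b y + r y"
    using pseudo_division[OF b low v(1) h] unfolding top(2) by blast
  have "r y = 0" for y
  proof -
    let ?B = "poly_along v b y" and ?R = "poly_along v r y"
    have deg: "degree ?B = k" "?B \<noteq> 0"
      using top[of v y] v(2) le_degree[of ?B k] by auto
    have "?B dvd ?R"
    proof (rule poly_dvd_of_bounded_quotient[OF deg(2) poly_roots_finite[OF deg(2)]])
      fix R :: real
      obtain K where K: "\<And>z. norm z \<le> norm y + \<bar>R\<bar> * norm v \<Longrightarrow> b z \<noteq> 0 \<Longrightarrow> norm (h z) \<le> K * norm (b z)"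
        using bound by blast
      have "compact ((\<lambda>s. q (y + s *s v)) ` cball 0 R)"
        unfolding poly_poly_along[OF sqr(1), symmetric]
        by (intro compact_continuous_image continuous_intros compact_cball)
      then obtain Q where Q: "\<And>s. norm s \<le> R \<Longrightarrow> norm (q (y + s *s v)) \<le> Q"
        using compact_imp_bounded[THEN bounded_iff[THEN iffD1]] by force
      have "norm (poly ?R u) \<le> (norm (b v) ^ s * K + Q) * norm (poly ?B u)"
        if u: "norm u \<le> R" "u \<notin> {u. poly ?B u = 0}" for u
      proof -
        let ?z = "y + u *s v"
        have bz: "b ?z \<noteq> 0" using u(2) by (simp add: poly_poly_along[OF b])
        have "norm ?z \<le> norm y + norm (u *s v)" by (rule norm_triangle_ineq)
        also have "\<dots> \<le> norm y + \<bar>R\<bar> * norm v" using u(1) by (simp add: norm_smult_vec mult_right_mono)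
        finally have hz: "norm (h ?z) \<le> K * norm (b ?z)" using K bz by blast
        have "r ?z = b v ^ s * h ?z - q ?z * b ?z" using sqr(4)[of ?z] by simp
        then have "norm (r ?z) \<le> norm (b v ^ s * h ?z) + norm (q ?z * b ?z)"
          by (metis norm_triangle_ineq4)
        also have "\<dots> \<le> norm (b v) ^ s * (K * norm (b ?z)) + Q * norm (b ?z)"
          using hz Q[OF u(1)] by (intro add_mono) (auto simp: norm_mult norm_power intro: mult_left_mono mult_right_mono)
        finally show ?thesis by (simp add: poly_poly_along[OF sqr(2)] poly_poly_along[OF b] algebra_simps)
      qed
      then show "\<exists>K. \<forall>u. norm u \<le> R \<longrightarrow> u \<notin> {u. poly ?B u = 0} \<longrightarrow> norm (poly ?R u) \<le> K * norm (poly ?B u)"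
        by blast
    qed
    moreover have "?R = 0 \<or> degree ?R < degree ?B"
    proof (cases "?R = 0")
      case False
      then have "coeff ?R (degree ?R) \<noteq> 0" by simp
      then show ?thesis using sqr(3) deg(1) by (meson low_degree_along_def not_less)
    qed auto
    ultimately have "?R = 0" using dvd_imp_degree_le leD by blast
    then show "r y = 0" using poly_poly_along[OF sqr(2), of v y 0] by simp
  qed
  then have "h y = b y * (inverse (b v ^ s) * q y)" for y
    using sqr(4)[of y] v(2) by (simp add: field_simps)
  moreover have "form (dh - db) (\<lambda>y. inverse (b v ^ s) * q y)"
    using form_cmult[OF sqr(1)] by (simp add: k)
  ultimately show ?thesis by blast
qed

text \<open>By homogeneity a root \<open>s \<noteq> 0\<close> gives the zero
  \<open>e + y / s\<close> of \<open>h\<close>; as \<open>h\<close> has no zeros within some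
  distance \<delta> of \<open>e\<close>, the quotient |y| / |s| is at least \<delta>.\<close>

lemma form_root_radius:
  assumes h: "form d h" and "h e \<noteq> 0"
  shows "\<exists>C\<ge>0. \<forall>y s. h (y + s *s e) = 0 \<longrightarrow> norm s \<le> C * norm y"
proof -
  obtain \<delta> where \<delta>: "\<delta> > 0" "\<And>z. dist e z < \<delta> \<Longrightarrow> h z \<noteq> 0"
    using continuous_at_avoid[OF form_isCont[OF h] assms(2)] by blast
  have "norm s \<le> 1 / \<delta> * norm y" if 0: "h (y + s *s e) = 0" for y s
  proof (cases "s = 0")
    case False
    have eq: "inverse s *s (y + s *s e) = e + inverse s *s y"
      using False by (simp add: vector_add_ldistrib add.commute)
    have "h (e + inverse s *s y) = 0"
      using form_scale[OF h, of "inverse s" "y + s *s e"] 0 False unfolding eq by simp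
    then have "\<not> dist e (e + inverse s *s y) < \<delta>" using \<delta>(2) by blast
    then have "\<delta> \<le> norm y / norm s"
      by (simp add: dist_norm norm_smult_vec norm_inverse divide_inverse mult.commute)
    then show ?thesis using \<delta>(1) False by (simp add: field_simps)
  qed (use \<delta>(1) in auto)
  then show ?thesis using \<delta>(1) by (intro exI[of _ "1 / \<delta>"]) auto
qed

text \<open>The condition \<open>sat\<close> stands for the geometric fact that no component of the
  zero set of \<open>M\<close> lies in a cylinder \<open>b = 0\<close> along \<open>e\<close>; it is
  what permits cancelling the leading coefficient. Arbitrary multipliers \<open>q\<close> do no
  harm, since only the forms in \<open>M\<close> are described.\<close>

lemma principal_ideal_of_forms:
  fixes M :: "(complex ^ 'n::finite \<Rightarrow> complex) set"
  assumes diff: "\<And>f g. f \<in> M \<Longrightarrow> g \<in> M \<Longrightarrow> (\<lambda>x. f x - g x) \<in> M"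
    and mult: "\<And>q f. f \<in> M \<Longrightarrow> (\<lambda>x. q x * f x) \<in> M"
    and h0: "h0 \<in> M" "form d0 h0" "h0 e \<noteq> 0" and "e \<noteq> 0"
    and sat: "\<And>b f db df. form db b \<Longrightarrow> \<exists>y. b y \<noteq> 0 \<Longrightarrow> (\<And>y s. b (y + s *s e) = b y) \<Longrightarrow> form df f \<Longrightarrow>
      (\<lambda>x. b x * f x) \<in> M \<Longrightarrow> f \<in> M"
  shows "\<exists>k G. form (int k) G \<and> G \<in> M \<and> (\<forall>f d. form d f \<longrightarrow> f \<in> M \<longrightarrow> (\<exists>q d'. form d' q \<and> (\<forall>x. f x = q x * G x)))"
proof -
  define P where "P = (\<lambda>k. \<exists>d h. form d h \<and> h \<in> M \<and> (\<exists>y. h y \<noteq> 0) \<and> low_degree_along e (Suc k) h)"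
  define k where "k = (LEAST k. P k)"
  have "P (nat d0)" unfolding P_def using h0 low_degree_along_ex by blast
  then have "P k" unfolding k_def by (rule LeastI)
  then obtain dh h where h: "form dh h" "h \<in> M" "\<exists>y. h y \<noteq> 0" "low_degree_along e (Suc k) h" unfolding P_def by blast
  have min: "r y = 0" if r: "form d r" "r \<in> M" "low_degree_along e k r" for d r y
  proof (cases k)
    case 0
    then show ?thesis using low_degree_along_0 r by metis
  next
    case (Suc j)
    then have "\<not> P j" unfolding k_def using not_less_Least[of j P] by auto
    then show ?thesis using r Suc unfolding P_def by blast
  qed
  define b where "b = (\<lambda>y. coeff (poly_along e h y) k)"
  have b: "form (dh - int k) b" "\<And>y s. b (y + s *s e) = b y"
    unfolding b_def using form_coeff_poly_along[OF h(1)] coeff_poly_along_invariant[OF h(1,4)] by auto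
  obtain v where v: "b v \<noteq> 0"
  proof (rule ccontr)
    assume "\<not> thesis"
    then have "b y = 0" for y using that by blast
    then have "low_degree_along e k h" using h(4) unfolding low_degree_along_def b_def by (metis Suc_leI le_neq_implies_less)
    then show False using min[OF h(1,2)] h(3) by blast
  qed
  \<comment> \<open>By minimality of \<open>k\<close> the remainder of \<open>h0\<close> by
    \<open>h\<close> is 0. Hence, where \<open>b \<noteq> 0\<close>, the roots of \<open>h\<close>
    along \<open>e\<close> are roots of \<open>h0\<close>, and these are bounded because
    \<open>h0\<close> is monic along \<open>e\<close> up to a constant.\<close>
  obtain s q r where sqr: "form (d0 + int s * (dh - int k)) r" "low_degree_along e k r" "\<And>y. b y ^ s * h0 y = q y * h y + r y"
    using pseudo_division[OF h(1,4) \<open>e \<noteq> 0\<close> h0(2)] unfolding b_def by blast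
  have "r = (\<lambda>y. b y ^ s * h0 y - q y * h y)" using sqr(3) by auto
  then have "r \<in> M" using diff[OF mult[OF h0(1), of "\<lambda>y. b y ^ s"] mult[OF h(2), of q]] by simp
  then have eq: "b y ^ s * h0 y = q y * h y" for y using min[OF sqr(1) _ sqr(2)] sqr(3) by simp
  obtain C where C: "C \<ge> 0" "\<And>y u. h0 (y + u *s e) = 0 \<Longrightarrow> norm u \<le> C * norm y"
    using form_root_radius[OF h0(2,3)] by blast
  \<comment> \<open>Up to sign, \<open>h y\<close> is the leading coefficient \<open>b y\<close>
    times the product of the \<open>k\<close> roots on the line: the local bound on
    \<open>h / b\<close>.\<close>
  have "norm (h y) \<le> (C * \<bar>R\<bar>) ^ k * norm (b y)" if "norm y \<le> R" "b y \<noteq> 0" for y R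
  proof -
    let ?p = "poly_along e h y"
    have "degree ?p \<le> k" using h(4) by (intro degree_le) (auto simp: low_degree_along_def)
    then have "degree ?p = k" using that(2) le_degree unfolding b_def by (meson le_antisym)
    then have lc: "lead_coeff ?p = b y" by (simp add: b_def)
    have "norm u \<le> C * \<bar>R\<bar>" if "poly ?p u = 0" for u
    proof -
      have "h (y + u *s e) = 0" using that by (simp add: poly_poly_along[OF h(1)])
      then have "h0 (y + u *s e) = 0" using eq[of "y + u *s e"] b(2) \<open>b y \<noteq> 0\<close> by simp
      then have "norm u \<le> C * norm y" by (rule C(2))
      also have "\<dots> \<le> C * \<bar>R\<bar>" using C(1) \<open>norm y \<le> R\<close> by (intro mult_left_mono) auto
      finally show ?thesis .
    qed
    then have "norm (poly ?p 0) \<le> norm (b y) * (C * \<bar>R\<bar>) ^ k"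
      using poly_norm_bounds(1)[of ?p "C * \<bar>R\<bar>"] lc \<open>degree ?p = k\<close> by metis
    then show ?thesis using poly_poly_along[OF h(1), of e y 0] by (simp add: mult.commute)
  qed
  then have "\<exists>K. \<forall>y. norm y \<le> R \<longrightarrow> b y \<noteq> 0 \<longrightarrow> norm (h y) \<le> K * norm (b y)" for R by blast
  then obtain G where G: "form (dh - (dh - int k)) G" "\<And>y. h y = b y * G y"
    using form_dvd_of_bounded_quotient[OF b(1) h(1) v] by blast
  then have Gk: "form (int k) G" by simp
  have "(\<lambda>y. b y * G y) = h" using G(2) by auto
  then have GM: "G \<in> M" using sat[OF b(1) _ b(2) Gk] v h(2) by auto
  note top = coeff_poly_along_top[OF Gk]
  \<comment> \<open>Comparing leading coefficients in \<open>h = b * G\<close> gives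
    \<open>G e = 1\<close>: division by \<open>G\<close> along \<open>e\<close> needs no
    denominators, and remainders of elements of \<open>M\<close> vanish by minimality.\<close>
  have "poly_along e h v = Polynomial.smult (b v) (poly_along e G v)"
    by (rule poly_along_eqI) (simp add: G(2) b(2) poly_poly_along[OF Gk])
  then have "coeff (poly_along e h v) k = b v * G e" by (simp add: top(2))
  then have "b v = b v * G e" by (simp add: b_def)
  then have Ge: "G e = 1" using v by simp
  have low: "low_degree_along e (Suc k) G" using low_degree_along_ex[OF Gk] by simp
  have "\<exists>q d'. form d' q \<and> (\<forall>x. f x = q x * G x)" if f: "form d f" "f \<in> M" for f d
  proof -
    obtain s q r dq dr where sqr: "form dq q" "form dr r" "low_degree_along e k r" "\<And>y. G e ^ s * f y = q y * G y + r y"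
      using pseudo_division[OF Gk low \<open>e \<noteq> 0\<close> f(1)] unfolding top(2) by blast
    have "r = (\<lambda>y. f y - q y * G y)" using sqr(4) Ge by auto
    then have "r \<in> M" using diff[OF f(2) mult[OF GM, of q]] by simp
    then have "f y = q y * G y" for y using min[OF sqr(2) _ sqr(3)] sqr(4)[of y] Ge by simp
    then show ?thesis using sqr(1) by blast
  qed
  then show ?thesis using Gk GM by blast
qed

text \<open>The base point is moved off \<open>b = 0\<close>, and a root of \<open>f\<close> along
  \<open>e\<close> follows it continuously; moving along \<open>e\<close> does not lead back into
  \<open>b = 0\<close>. The value at \<open>s1\<close> keeps \<open>f\<close> from vanishing on the
  whole line, where its roots on nearby lines would be out of control.\<close>

lemma zero_set_dense:
  assumes f: "form d f" and b: "form db b" and "b y0 \<noteq> 0" and inv: "\<And>y s. b (y + s *s e) = b y"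
    and "f z = 0" and nz: "f (z + s1 *s e) \<noteq> 0" and "\<epsilon> > 0"
  shows "\<exists>z'. dist z' z < \<epsilon> \<and> f z' = 0 \<and> b z' \<noteq> 0"
proof -
  define w where "w = y0 - z"
  have "poly (poly_along w b z) 1 \<noteq> 0" using assms(3) by (simp add: poly_poly_along[OF b] w_def)
  then have "poly_along w b z \<noteq> 0" by auto
  then have finb: "finite {u. b (z + u *s w) = 0}"
    using poly_roots_finite[of "poly_along w b z"] by (auto simp: poly_poly_along[OF b])
  have "poly_along e f z \<noteq> 0" using nz by (metis poly_0 poly_poly_along[OF f])
  then have "finite {u. f (z + u *s e) = 0}"
    using poly_roots_finite[of "poly_along e f z"] by (simp add: poly_poly_along[OF f])
  moreover define \<eta> where "\<eta> = \<epsilon> / (2 * (norm e + 1))"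
  have "\<eta> > 0" using \<open>\<epsilon> > 0\<close> by (simp add: \<eta>_def add_nonneg_pos)
  then have "infinite (ball (0::complex) \<eta>)" using uncountable_ball countable_finite by blast
  ultimately have "\<not> ball 0 \<eta> \<subseteq> {u. f (z + u *s e) = 0}" using finite_subset by blast
  \<comment> \<open>As \<open>u\<close> tends to 0, \<open>f\<close> becomes small at
    \<open>z + u *s w\<close> but not at \<open>z + u *s w + s0 *s e\<close>, and
    \<open>poly_norm_bounds\<close> yields a root no larger than \<open>s0\<close>.\<close>
  then obtain s0 where s0: "s0 \<in> ball 0 \<eta>" "f (z + s0 *s e) \<noteq> 0" by blast
  have cont: "isCont (\<lambda>u. f (z + u *s w + c)) 0" for c
  proof -
    have "isCont (\<lambda>u. z + u *s w + c) 0"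
      by (intro continuous_add continuous_const linear_continuous_at bounded_linear_smult_vec)
    then show ?thesis by (rule isCont_o2) (rule form_isCont[OF f])
  qed
  have "((\<lambda>u. norm (f (z + u *s w + s0 *s e)) - 2 ^ nat d * norm (f (z + u *s w + 0)))
     \<longlongrightarrow> norm (f (z + 0 *s w + s0 *s e)) - 2 ^ nat d * norm (f (z + 0 *s w + 0))) (at 0)"
    by (intro tendsto_intros cont[unfolded isCont_def])
  then have ev1: "\<forall>\<^sub>F u in at 0. 0 < norm (f (z + u *s w + s0 *s e)) - 2 ^ nat d * norm (f (z + u *s w + 0))"
    using s0(2) \<open>f z = 0\<close> by (intro order_tendstoD) auto
  have ev2: "\<forall>\<^sub>F u in at 0. b (z + u *s w) \<noteq> 0"
  proof -
    have "\<forall>\<^sub>F u in at 0. u \<in> - ({u. b (z + u *s w) = 0} - {0}) - {0}"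
      using finb by (intro eventually_at_in_open open_Compl finite_imp_closed finite_Diff) auto
    then show ?thesis by eventually_elim auto
  qed
  define \<rho> where "\<rho> = \<epsilon> / (2 * (norm w + 1))"
  have "\<rho> > 0" using \<open>\<epsilon> > 0\<close> by (simp add: \<rho>_def add_nonneg_pos)
  then have "\<forall>\<^sub>F u in at (0::complex). u \<in> ball 0 \<rho>" by (intro eventually_at_in_open') auto
  with ev1 ev2 have "\<forall>\<^sub>F u in at 0. 0 < norm (f (z + u *s w + s0 *s e)) - 2 ^ nat d * norm (f (z + u *s w + 0)) \<and>
      b (z + u *s w) \<noteq> 0 \<and> u \<in> ball 0 \<rho>"
    by (intro eventually_conj)
  then obtain u where u: "2 ^ nat d * norm (f (z + u *s w)) < norm (f (z + u *s w + s0 *s e))"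
      "b (z + u *s w) \<noteq> 0" "norm u < \<rho>"
    using eventually_happens[of _ "at (0::complex)"] by force
  let ?p = "poly_along e f (z + u *s w)"
  have "\<exists>s. poly ?p s = 0 \<and> norm s \<le> norm s0"
  proof (rule ccontr)
    assume "\<not> ?thesis"
    then have "norm (poly ?p s0) \<le> 2 ^ degree ?p * norm (poly ?p 0)"
      by (intro poly_norm_bounds(2)) (auto simp: not_le)
    also have "degree ?p \<le> nat d"
      using low_degree_along_ex[OF f, of e] by (intro degree_le) (auto simp: low_degree_along_def)
    then have "2 ^ degree ?p * norm (poly ?p 0) \<le> 2 ^ nat d * norm (poly ?p 0)"
      by (intro mult_right_mono power_increasing) auto
    finally show False using u(1) by (simp add: poly_poly_along[OF f])
  qed
  then obtain s where s: "f (z + u *s w + s *s e) = 0" "norm s < \<eta>"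
    using s0(1) by (auto simp: poly_poly_along[OF f])
  have "norm (u *s w) < \<epsilon> / 2"
  proof -
    have "norm u * norm w \<le> norm u * (norm w + 1)" by (intro mult_left_mono) auto
    also have "\<dots> < \<rho> * (norm w + 1)" using u(3) by (intro mult_strict_right_mono) (auto simp: add_nonneg_pos)
    also have "\<dots> = \<epsilon> / 2" by (simp add: \<rho>_def field_simps add_nonneg_eq_0_iff)
    finally show ?thesis by (simp add: norm_smult_vec)
  qed
  moreover have "norm (s *s e) < \<epsilon> / 2"
  proof -
    have "norm s * norm e \<le> norm s * (norm e + 1)" by (intro mult_left_mono) auto
    also have "\<dots> < \<eta> * (norm e + 1)" using s(2) by (intro mult_strict_right_mono) (auto simp: add_nonneg_pos)
    also have "\<dots> = \<epsilon> / 2" by (simp add: \<eta>_def field_simps add_nonneg_eq_0_iff)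
    finally show ?thesis by (simp add: norm_smult_vec)
  qed
  moreover have "norm (u *s w + s *s e) \<le> norm (u *s w) + norm (s *s e)" by (rule norm_triangle_ineq)
  ultimately have "dist (z + u *s w + s *s e) z < \<epsilon>" by (simp add: dist_norm add.assoc)
  moreover have "b (z + u *s w + s *s e) \<noteq> 0" using u(2) inv by simp
  ultimately show ?thesis using s(1) by blast
qed

subsection \<open>Differentials and real structure\<close>

lemma differential_eqI: "(peval p has_derivative D) (at x) \<Longrightarrow> differential p x = D"
  by (rule frechet_derivative_at[symmetric])

lemma differential_has_derivative:
  "homogeneous d (p :: ('n::finite, complex) mpoly) \<Longrightarrow> (peval p has_derivative differential p x) (at x)"
  using homogeneous_derivative by blast

lemma differential_linear:
  fixes p :: "('n::finite, complex) mpoly"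
  assumes "homogeneous d p"
  shows differential_add: "differential p x (u + v) = differential p x u + differential p x v"
    and differential_smult: "differential p x (c *s v) = c * differential p x v"
  using homogeneous_derivative[OF assms]
  by (auto simp: sum.distrib distrib_left sum_distrib_left mult_ac)

lemma differential_continuous:
  fixes p :: "('n::finite, complex) mpoly"
  assumes "homogeneous d p"
  shows "continuous_on UNIV (\<lambda>x. differential p x v)"
proof -
  obtain g where g: "\<And>i. form (int d - 1) (g i)" "\<And>x. differential p x = (\<lambda>v. \<Sum>i\<in>UNIV. g i x * v $ i)"
    using homogeneous_derivative[OF assms] by blast
  show ?thesis unfolding g(2)
    by (intro continuous_on_sum continuous_on_mult continuous_on_const form_continuous_on[OF g(1)])
qed

lemma differential_plus:
  fixes p q :: "('n::finite, complex) mpoly"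
  assumes "homogeneous d p" "homogeneous e q"
  shows "differential (p + q) x v = differential p x v + differential q x v"
proof -
  have "peval (p + q) = (\<lambda>y. peval p y + peval q y)" by (simp add: fun_eq_iff peval_add)
  then have "(peval (p + q) has_derivative (\<lambda>v. differential p x v + differential q x v)) (at x)"
    using differential_has_derivative assms by (auto intro!: has_derivative_add)
  then show ?thesis by (simp add: differential_eqI)
qed

lemma differential_scale:
  fixes p :: "('n::finite, complex) mpoly"
  assumes "homogeneous d p"
  shows "differential (scale c p) x v = c * differential p x v"
proof -
  have "peval (scale c p) = (\<lambda>y. c * peval p y)" by (simp add: fun_eq_iff peval_scale)
  then have "(peval (scale c p) has_derivative (\<lambda>v. c * differential p x v)) (at x)"
    using differential_has_derivative assms by (auto intro!: has_derivative_mult_right)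
  then show ?thesis by (simp add: differential_eqI)
qed

lemma differential_mult:
  fixes p q :: "('n::finite, complex) mpoly"
  assumes "homogeneous d p" "homogeneous e q"
  shows "differential (p * q) x v = peval p x * differential q x v + differential p x v * peval q x"
proof -
  have "peval (p * q) = (\<lambda>y. peval p y * peval q y)" by (simp add: fun_eq_iff peval_mult)
  then have "(peval (p * q) has_derivative (\<lambda>v. peval p x * differential q x v + differential p x v * peval q x)) (at x)"
    using differential_has_derivative assms by (auto intro!: has_derivative_mult)
  then show ?thesis by (simp add: differential_eqI)
qed

text \<open>Euler's relation at a zero, since the form is constantly 0 along the ray through
  \<open>x\<close>. It makes the summand \<open>c *s cvec x\<close> of
  \<open>tangent_space_RP\<close> invisible to forms that vanish at the point.\<close>

lemma differential_at_zero_along: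
  fixes p :: "('n::finite, complex) mpoly"
  assumes p: "homogeneous d p" and "peval p x = 0"
  shows "differential p x x = 0"
proof -
  have 0: "peval p (x + s *\<^sub>R x) = 0" if "\<bar>s\<bar> < 1" for s :: real
  proof -
    have "x + s *\<^sub>R x = complex_of_real (1 + s) *s x"
      by (simp add: Finite_Cartesian_Product.vec_eq_iff scaleR_conv_of_real[where 'a = complex] distrib_right)
    moreover have "complex_of_real (1 + s) \<noteq> 0" using that unfolding of_real_eq_0_iff by linarith
    ultimately show ?thesis
      using form_scale[OF homogeneous_imp_form[OF p], of "complex_of_real (1 + s)" x] assms(2) by simp
  qed
  have "((\<lambda>s::real. x + s *\<^sub>R x) has_derivative (\<lambda>s. s *\<^sub>R x)) (at 0)"
    by (auto intro!: derivative_eq_intros)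
  from has_derivative_compose[OF this, of "peval p" "differential p x"]
  have "((\<lambda>s::real. peval p (x + s *\<^sub>R x)) has_derivative (\<lambda>s. differential p x (s *\<^sub>R x))) (at 0)"
    using differential_has_derivative[OF p] by simp
  moreover have "((\<lambda>s::real. peval p (x + s *\<^sub>R x)) has_derivative (\<lambda>s. 0)) (at 0)"
    by (rule has_derivative_transform_within_open[OF has_derivative_const[of 0], of "ball 0 1"])
      (use 0 in \<open>auto simp: dist_norm\<close>)
  ultimately have "(\<lambda>s::real. differential p x (s *\<^sub>R x)) = (\<lambda>s. 0)" by (rule has_derivative_unique)
  then show ?thesis by (metis scaleR_one)
qed

section \<open>Real vectors, real and imaginary parts of forms\<close>

lemma cvec_add: "cvec (u + v) = cvec u + cvec v"
  by (simp add: cvec_def Finite_Cartesian_Product.vec_eq_iff)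

lemma cvec_scaleR: "cvec (a *\<^sub>R v) = complex_of_real a *s cvec v"
  by (simp add: cvec_def Finite_Cartesian_Product.vec_eq_iff)

lemma cvec_0 [simp]: "cvec 0 = 0"
  by (simp add: cvec_def Finite_Cartesian_Product.vec_eq_iff)

lemma cvec_eq_0_iff [simp]: "cvec v = 0 \<longleftrightarrow> v = 0"
  by (simp add: cvec_def Finite_Cartesian_Product.vec_eq_iff)

lemma norm_cvec: "norm (cvec v) = norm v"
  by (simp add: cvec_def norm_vec_def)

lemma bounded_linear_cvec: "bounded_linear (cvec :: real ^ 'n::finite \<Rightarrow> complex ^ 'n)"
proof (rule bounded_linear_intro[of _ 1])
  fix r and x :: "real ^ 'n"
  show "cvec (r *\<^sub>R x) = r *\<^sub>R cvec x"
    by (simp add: cvec_def Finite_Cartesian_Product.vec_eq_iff scaleR_conv_of_real[where 'a = complex])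
qed (simp_all add: cvec_add norm_cvec)

lemma isCont_cvec: "isCont cvec x"
  by (rule linear_continuous_at[OF bounded_linear_cvec])

lemma cvec_decompose: "\<exists>u w. z = cvec u + \<i> *s cvec w"
  by (rule exI[of _ "\<chi> i. Re (z $ i)"], rule exI[of _ "\<chi> i. Im (z $ i)"])
     (simp add: cvec_def Finite_Cartesian_Product.vec_eq_iff complex_eq[symmetric])

lemma eventually_cvec:
  "\<forall>\<^sub>F y in nhds (cvec x). P y \<Longrightarrow> \<forall>\<^sub>F y in nhds x. P (cvec y)"
  using isCont_cvec[of x] by (auto simp: isCont_def tendsto_nhds_iff intro: eventually_compose_filterlim)

lemma peval_complexify_cvec: "peval (complexify p) (cvec x) = complex_of_real (peval p x)"
  by (simp add: complexify_def peval_map) (simp add: peval_def cvec_def)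

text \<open>The calculus of forms is complex; a real form inherits it as the real part of its
  complexification along \<open>cvec\<close>.\<close>

lemma real_differential:
  fixes p :: "('n::finite, real) mpoly"
  assumes p: "homogeneous d p"
  shows "(peval p has_derivative differential p x) (at x)"
    and "complex_of_real (differential p x v) = differential (complexify p) (cvec x) (cvec v)"
    and "continuous_on UNIV (\<lambda>x. differential p x v)"
proof -
  note cp = homogeneous_complexify[OF p]
  have 1: "((\<lambda>y. peval (complexify p) (cvec y)) has_derivative (\<lambda>v. differential (complexify p) (cvec x) (cvec v))) (at x)" for x
    by (rule has_derivative_compose[OF bounded_linear_imp_has_derivative[OF bounded_linear_cvec] differential_has_derivative[OF cp]])
  have "(\<lambda>y. Re (peval (complexify p) (cvec y))) = peval p" by (simp add: peval_complexify_cvec)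
  moreover have "((\<lambda>y. Re (peval (complexify p) (cvec y))) has_derivative (\<lambda>v. Re (differential (complexify p) (cvec x) (cvec v)))) (at x)" for x
    by (rule bounded_linear.has_derivative[OF bounded_linear_Re 1])
  ultimately have 2: "(peval p has_derivative (\<lambda>v. Re (differential (complexify p) (cvec x) (cvec v)))) (at x)" for x
    by simp
  then have eq: "differential p x = (\<lambda>v. Re (differential (complexify p) (cvec x) (cvec v)))" for x by (rule differential_eqI)
  then show D: "(peval p has_derivative differential p x) (at x)" using 2 by simp
  have "((\<lambda>y. complex_of_real (peval p y)) has_derivative (\<lambda>v. complex_of_real (differential p x v))) (at x)"
    by (rule bounded_linear.has_derivative[OF bounded_linear_of_real D])
  then have "((\<lambda>y. peval (complexify p) (cvec y)) has_derivative (\<lambda>v. complex_of_real (differential p x v))) (at x)"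
    by (simp add: peval_complexify_cvec)
  then have "(\<lambda>v. complex_of_real (differential p x v)) = (\<lambda>v. differential (complexify p) (cvec x) (cvec v))"
    using 1 by (rule has_derivative_unique)
  then show "complex_of_real (differential p x v) = differential (complexify p) (cvec x) (cvec v)" by metis
  show "continuous_on UNIV (\<lambda>x. differential p x v)"
    unfolding eq
    by (intro continuous_on_Re continuous_on_compose2[OF differential_continuous[OF cp]]
        continuous_at_imp_continuous_on ballI isCont_cvec) auto
qed

lemma differential_cvec_eq_0:
  fixes p :: "('n::finite, complex) mpoly"
  assumes "homogeneous d p" "\<And>u. differential p x (cvec u) = 0"
  shows "differential p x v = 0"
proof -
  obtain u w where "v = cvec u + \<i> *s cvec w" using cvec_decompose by blast
  then show ?thesis using assms by (simp add: differential_linear[OF assms(1)])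
qed

definition re_part :: "('n, complex) mpoly \<Rightarrow> ('n, real) mpoly" where
  "re_part p = Poly_Mapping.map Re p"

definition im_part :: "('n, complex) mpoly \<Rightarrow> ('n, real) mpoly" where
  "im_part p = Poly_Mapping.map Im p"

lemma re_im_decompose: "p = complexify (re_part p) + scale \<i> (complexify (im_part p))"
  by (rule poly_mapping_eqI)
     (simp add: complexify_def re_part_def im_part_def scale_def lookup_add lookup_map complex_eq[symmetric])

lemma homogeneous_parts: "homogeneous d p \<Longrightarrow> homogeneous d (re_part p)" "homogeneous d p \<Longrightarrow> homogeneous d (im_part p)"
  by (simp_all add: re_part_def im_part_def homogeneous_map)

lemma complexify_add: "complexify (p + q) = complexify p + complexify q"
  by (rule poly_mapping_eqI) (simp add: complexify_def lookup_add lookup_map)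

lemma complexify_scale: "complexify (scale c p) = scale (complex_of_real c) (complexify p)"
  by (rule poly_mapping_eqI) (simp add: complexify_def scale_def lookup_map)

lemma peval_parts: "peval p z = peval (complexify (re_part p)) z + \<i> * peval (complexify (im_part p)) z"
  by (subst re_im_decompose) (simp only: peval_add peval_scale)

lemma homogeneous_complexify_parts:
  "homogeneous d p \<Longrightarrow> homogeneous d (complexify (re_part p))"
  "homogeneous d p \<Longrightarrow> homogeneous d (complexify (im_part p))"
  by (simp_all add: homogeneous_complexify homogeneous_parts)

lemma differential_parts:
  assumes "homogeneous d p"
  shows "differential p z v = differential (complexify (re_part p)) z v + \<i> * differential (complexify (im_part p)) z v"
proof -
  note h = homogeneous_complexify_parts[OF assms]
  have "differential (complexify (re_part p) + scale \<i> (complexify (im_part p))) z v =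
    differential (complexify (re_part p)) z v + \<i> * differential (complexify (im_part p)) z v"
    by (simp add: differential_plus[OF h(1) homogeneous_scale[OF h(2)]] differential_scale[OF h(2)])
  then show ?thesis by (simp add: re_im_decompose[symmetric])
qed

definition vcnj :: "complex ^ 'n \<Rightarrow> complex ^ 'n" where "vcnj z = (\<chi> i. cnj (z $ i))"

lemma peval_complexify_vcnj: "peval (complexify p) (vcnj z) = cnj (peval (complexify p) z)"
  by (simp add: complexify_def peval_map vcnj_def)

text \<open>\<open>X\<close> is invariant under complex conjugation, so the form with conjugate
  coefficients vanishes on \<open>X\<close> together with \<open>p\<close>; the parts are
  combinations of the two.\<close>

lemma parts_vanish_on_real_variety:
  assumes "real_variety X" and "\<forall>y\<in>X. peval p y = 0" and "y \<in> X"
  shows "peval (complexify (re_part p)) y = 0" "peval (complexify (im_part p)) y = 0"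
proof -
  obtain F where F: "X = zero_locus (complexify ` F)" using assms(1) unfolding real_variety_def by blast
  then have "y \<noteq> 0" and 0: "\<And>f. f \<in> F \<Longrightarrow> peval (complexify f) y = 0" using assms(3) by (auto simp: zero_locus_def)
  then have "vcnj y \<noteq> 0" by (auto simp: vcnj_def Finite_Cartesian_Product.vec_eq_iff)
  then have "vcnj y \<in> X" using 0 by (auto simp: F zero_locus_def peval_complexify_vcnj)
  then have "peval p y = 0" "peval p (vcnj y) = 0" using assms by auto
  then have a: "peval (complexify (re_part p)) y + \<i> * peval (complexify (im_part p)) y = 0"
    "cnj (peval (complexify (re_part p)) y) + \<i> * cnj (peval (complexify (im_part p)) y) = 0"
    using peval_parts[of p] by (simp_all add: peval_complexify_vcnj)
  from arg_cong[OF a(2), of cnj] have b: "peval (complexify (re_part p)) y - \<i> * peval (complexify (im_part p)) y = 0" by simp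
  have "2 * peval (complexify (re_part p)) y = 0" using arg_cong2[OF a(1) b, of "(+)"] by simp
  then show "peval (complexify (re_part p)) y = 0" by simp
  then show "peval (complexify (im_part p)) y = 0" using a(1) by simp
qed

section \<open>Local equations at real points and the codimension of \<open>V\<close>\<close>

text \<open>The local equations times \<open>g\<close> vanish on all of \<open>V\<close>, as
  \<open>tangent_space\<close> demands, and at \<open>x\<close> the product rule changes their
  differentials only by the nonzero factor \<open>peval g x\<close>.\<close>

lemma nonsingular_at_forms:
  fixes V :: "(complex ^ 'n::finite) set"
  assumes "nonsingular_at c V x" and "x \<in> V" and "0 \<notin> V"
  shows "\<exists>h. (\<forall>i<c. \<exists>d. homogeneous d (h i)) \<and> (\<forall>i<c. \<forall>y\<in>V. peval (h i) y = 0) \<and>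
    (\<forall>a. (\<forall>v. (\<Sum>i<c. a i * differential (h i) x v) = 0) \<longrightarrow> (\<forall>i<c. a i = 0)) \<and>
    (\<forall>\<^sub>F y in nhds x. (\<forall>i<c. peval (h i) y = 0) \<longrightarrow> y \<in> V)"
proof -
  obtain f g where f: "\<forall>i<c. \<exists>d. homogeneous d (f i)" and g: "\<exists>d. homogeneous d g" "peval g x \<noteq> 0"
    and V: "V \<inter> {y. peval g y \<noteq> 0} = zero_locus (f ` {..<c}) \<inter> {y. peval g y \<noteq> 0}"
    and ind: "\<And>a. (\<forall>v. (\<Sum>i<c. a i * differential (f i) x v) = 0) \<Longrightarrow> (\<forall>i<c. a i = 0)"
    using assms(1) unfolding nonsingular_at_def by blast
  obtain e where ge: "homogeneous e g" using g(1) by blast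
  define h where "h = (\<lambda>i. g * f i)"
  have "\<forall>i<c. \<exists>d. homogeneous d (h i)" unfolding h_def using f homogeneous_mult[OF ge] by blast
  moreover have van: "peval (f i) y = 0 \<or> peval g y = 0" if "i < c" "y \<in> V" for i y
    using V that by (auto simp: zero_locus_def)
  then have "\<forall>i<c. \<forall>y\<in>V. peval (h i) y = 0" by (auto simp: h_def peval_mult)
  moreover have "\<forall>i<c. a i = 0" if a: "\<forall>v. (\<Sum>i<c. a i * differential (h i) x v) = 0" for a
  proof (rule ind, intro allI)
    fix v
    have "differential (h i) x v = peval g x * differential (f i) x v" if "i < c" for i
    proof -
      obtain d where "homogeneous d (f i)" using f \<open>i < c\<close> by blast
      then show ?thesis using van[OF \<open>i < c\<close> assms(2)] g(2) by (simp add: h_def differential_mult[OF ge])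
    qed
    then have "(\<Sum>i<c. a i * differential (h i) x v) = peval g x * (\<Sum>i<c. a i * differential (f i) x v)"
      by (simp add: sum_distrib_left mult_ac)
    then show "(\<Sum>i<c. a i * differential (f i) x v) = 0" using a g(2) by simp
  qed
  moreover have "\<forall>\<^sub>F y in nhds x. (\<forall>i<c. peval (h i) y = 0) \<longrightarrow> y \<in> V"
  proof -
    have "open {y. peval g y \<noteq> 0}"
      using form_continuous_on[OF homogeneous_imp_form[OF ge], of UNIV] by (intro open_Collect_neq) auto
    then have "open ({y. peval g y \<noteq> 0} \<inter> - {0})" by (intro open_Int open_Compl) auto
    moreover have "x \<in> {y. peval g y \<noteq> 0} \<inter> - {0}" using g(2) assms by auto
    ultimately have "\<forall>\<^sub>F y in nhds x. y \<in> {y. peval g y \<noteq> 0} \<inter> - {0}" by (rule eventually_nhds_in_open)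
    then show ?thesis
    proof eventually_elim
      case (elim y)
      show ?case
      proof
        assume h0: "\<forall>i<c. peval (h i) y = 0"
        have "peval (f i) y = 0" if "i < c" for i
          using h0 that elim by (simp add: h_def peval_mult)
        then have "y \<in> zero_locus (f ` {..<c})" using elim by (simp add: zero_locus_def)
        then show "y \<in> V" using V elim by blast
      qed
    qed
  qed
  ultimately show ?thesis by blast
qed

lemma C1_pair:
  assumes "C1_map f f'" "C1_map g g'"
  shows "C1_map (\<lambda>x. (f x, g x)) (\<lambda>x v. (f' x v, g' x v))"
  using assms by (auto simp: C1_map_def intro: has_derivative_Pair continuous_intros)

lemma C1_peval: "homogeneous d p \<Longrightarrow> C1_map (peval (p :: ('n::finite, complex) mpoly)) (differential p)"
  by (auto simp: C1_map_def differential_has_derivative differential_continuous)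

lemma C1_peval_real: "homogeneous d p \<Longrightarrow> C1_map (peval (p :: ('n::finite, real) mpoly)) (differential p)"
  by (auto simp: C1_map_def real_differential)

lemma differential_pair_surj:
  fixes p q :: "('n::finite, complex) mpoly"
  assumes "homogeneous d p" "homogeneous e q"
    and "\<And>a b. \<forall>v. a * differential p x v + b * differential q x v = 0 \<Longrightarrow> a = 0 \<and> b = 0"
  shows "surj (\<lambda>v. (differential p x v, differential q x v))"
proof -
  have "\<exists>v. differential p x v = a \<and> differential q x v = b" for a b
    by (rule functional_pair_surj[OF differential_linear[OF assms(1)] differential_linear[OF assms(2)] assms(3)])
  then show ?thesis unfolding surj_def by (metis surj_pair)
qed

text \<open>Were any two of the four parts dependent, all would be multiples of one function
  \<open>q\<close>, and so would the two complex combinations, against their independence. This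
  picks two real equations with independent differentials.\<close>

lemma independent_pair_in_set:
  fixes q0 q1 q2 q3 :: "'a \<Rightarrow> complex"
  assumes ind: "\<And>a b. \<forall>v. a * (q0 v + \<i> * q1 v) + b * (q2 v + \<i> * q3 v) = 0 \<Longrightarrow> a = 0 \<and> b = 0"
  shows "\<exists>f\<in>{q0, q1, q2, q3}. \<exists>g\<in>{q0, q1, q2, q3}. \<forall>a b. (\<forall>v. a * f v + b * g v = 0) \<longrightarrow> a = 0 \<and> b = 0"
proof (rule ccontr)
  assume dep: "\<not> ?thesis"
  have "\<exists>q\<in>{q0, q1}. \<exists>v. q v \<noteq> 0"
  proof (rule ccontr)
    assume "\<not> ?thesis"
    then have "q0 v = 0" "q1 v = 0" for v by blast+
    then have "\<forall>v. 1 * (q0 v + \<i> * q1 v) + 0 * (q2 v + \<i> * q3 v) = 0" by simp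
    from ind[OF this] show False by simp
  qed
  then obtain q w where q: "q \<in> {q0, q1}" "q w \<noteq> 0" by blast
  have "\<exists>c. \<forall>v. f v = c * q v" if "f \<in> {q0, q1, q2, q3}" for f
  proof -
    have "q \<in> {q0, q1, q2, q3}" using q(1) by auto
    have "\<not> (\<forall>a b. (\<forall>v. a * f v + b * q v = 0) \<longrightarrow> a = 0 \<and> b = 0)"
    proof
      assume *: "\<forall>a b. (\<forall>v. a * f v + b * q v = 0) \<longrightarrow> a = 0 \<and> b = 0"
      show False by (rule dep[THEN notE], rule bexI[of _ f], rule bexI[of _ q], rule *) fact+
    qed
    then obtain a b where ab: "\<forall>v. a * f v + b * q v = 0" "\<not> (a = 0 \<and> b = 0)"
      unfolding not_all not_imp by (elim exE conjE)
    have "a \<noteq> 0"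
    proof
      assume "a = 0"
      then show False using ab(1)[rule_format, of w] ab(2) q(2) by simp
    qed
    then have "f v = (- b / a) * q v" for v
      using ab(1)[rule_format, of v] by (simp add: field_simps add_eq_0_iff)
    then show ?thesis by blast
  qed
  then obtain c0 c1 c2 c3 where c: "\<And>v. q0 v = c0 * q v" "\<And>v. q1 v = c1 * q v" "\<And>v. q2 v = c2 * q v" "\<And>v. q3 v = c3 * q v"
    by (metis insertCI)
  have "\<forall>v. (c2 + \<i> * c3) * (q0 v + \<i> * q1 v) + (- (c0 + \<i> * c1)) * (q2 v + \<i> * q3 v) = 0"
    by (simp add: c algebra_simps)
  from ind[OF this] have "c0 + \<i> * c1 = 0" by (simp add: neg_equal_0_iff_equal del: minus_add_distrib)
  moreover have "q0 v + \<i> * q1 v = (c0 + \<i> * c1) * q v" for v by (simp add: c algebra_simps)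
  ultimately have "\<forall>v. 1 * (q0 v + \<i> * q1 v) + 0 * (q2 v + \<i> * q3 v) = 0" by simp
  from ind[OF this] show False by simp
qed

text \<open>Near \<open>x\<close> the real points of \<open>X\<close> are the zeros of two real
  forms \<open>r\<close>, \<open>s\<close> with independent differentials. The vectors
  \<open>v1\<close>, \<open>v2\<close> are dual to these differentials, and the rest of
  \<open>v\<close> is tangent to the real points, hence killed by the differential of
  \<open>f\<close>.\<close>

lemma vanishing_differentials_span:
  fixes X :: "(complex ^ 'n::finite) set"
  assumes X: "real_variety X" "nonsingular_at 2 X (cvec x)" and x: "x \<in> real_points X"
  shows "\<exists>v1 v2. \<forall>v. \<exists>\<alpha> \<beta>. \<forall>f d. homogeneous d f \<longrightarrow> (\<forall>y\<in>real_points X. peval f (cvec y) = 0) \<longrightarrow>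
    differential f (cvec x) (cvec v) = complex_of_real \<alpha> * differential f (cvec x) (cvec v1) + complex_of_real \<beta> * differential f (cvec x) (cvec v2)"
proof -
  let ?p = "cvec x"
  have xX: "?p \<in> X" "x \<noteq> 0" using x by (auto simp: real_points_def)
  have "0 \<notin> X" using X(1) by (auto simp: real_variety_def zero_locus_def)
  then obtain h where h: "\<forall>i<2::nat. \<exists>d. homogeneous d (h i)" "\<forall>i<2::nat. \<forall>y\<in>X. peval (h i) y = 0"
      "\<And>a. \<forall>v. (\<Sum>i<2. a i * differential (h i) ?p v) = 0 \<Longrightarrow> \<forall>i<2::nat. a i = 0"
      "\<forall>\<^sub>F y in nhds ?p. (\<forall>i<2::nat. peval (h i) y = 0) \<longrightarrow> y \<in> X"
    using nonsingular_at_forms[OF X(2) xX(1)] by blast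
  obtain d0 d1 where hd: "homogeneous d0 (h 0)" "homogeneous d1 (h 1)" using h(1) by (metis one_less_numeral_iff pos2 semiring_norm(76))
  have ind: "a = 0 \<and> b = 0" if "\<forall>v. a * differential (h 0) ?p v + b * differential (h 1) ?p v = 0" for a b
  proof -
    define \<alpha> where "\<alpha> = (\<lambda>i::nat. if i = 0 then a else b)"
    have "\<forall>v. (\<Sum>i<2. \<alpha> i * differential (h i) ?p v) = 0"
      using that by (simp add: \<alpha>_def numeral_2_eq_2)
    from h(3)[OF this] have "\<alpha> 0 = 0" "\<alpha> 1 = 0" by auto
    then show ?thesis by (simp add: \<alpha>_def)
  qed
  define D where "D = (\<lambda>r :: ('n, real) mpoly. differential (complexify r) ?p)"
  define Q where "Q = {re_part (h 0), im_part (h 0), re_part (h 1), im_part (h 1)}"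
  have "\<exists>f\<in>{D (re_part (h 0)), D (im_part (h 0)), D (re_part (h 1)), D (im_part (h 1))}.
     \<exists>g\<in>{D (re_part (h 0)), D (im_part (h 0)), D (re_part (h 1)), D (im_part (h 1))}.
     \<forall>a b. (\<forall>v. a * f v + b * g v = 0) \<longrightarrow> a = 0 \<and> b = 0"
  proof (rule independent_pair_in_set[of "D (re_part (h 0))" "D (im_part (h 0))" "D (re_part (h 1))" "D (im_part (h 1))"])
    fix a b
    assume "\<forall>v. a * (D (re_part (h 0)) v + \<i> * D (im_part (h 0)) v) + b * (D (re_part (h 1)) v + \<i> * D (im_part (h 1)) v) = 0"
    then show "a = 0 \<and> b = 0"
      unfolding D_def differential_parts[OF hd(1), symmetric] differential_parts[OF hd(2), symmetric] by (rule ind)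
  qed
  then have "\<exists>f\<in>D ` Q. \<exists>g\<in>D ` Q. \<forall>a b. (\<forall>v. a * f v + b * g v = 0) \<longrightarrow> a = 0 \<and> b = 0"
    unfolding Q_def image_insert image_empty .
  then obtain r s where rs: "r \<in> Q" "s \<in> Q"
    and rs_ind': "\<forall>a b. (\<forall>v. a * D r v + b * D s v = 0) \<longrightarrow> a = 0 \<and> b = 0"
    unfolding bex_simps(7) by (elim bexE)
  have rs_ind: "a = 0 \<and> b = 0" if "\<forall>v. a * D r v + b * D s v = 0" for a b
    by (rule rs_ind'[THEN spec, THEN spec, THEN mp, OF that])
  have "\<exists>e. homogeneous e r" if "r \<in> Q" for r
    using that homogeneous_parts[OF hd(1)] homogeneous_parts[OF hd(2)] unfolding Q_def by blast
  then obtain dr ds where rsd: "homogeneous dr r" "homogeneous ds s" using rs by blast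
  have Qvan: "peval (complexify r) y = 0" if "r \<in> Q" "y \<in> X" for r y
  proof -
    have "\<forall>y\<in>X. peval (h 0) y = 0" "\<forall>y\<in>X. peval (h 1) y = 0" using h(2) by auto
    then show ?thesis using that parts_vanish_on_real_variety[OF X(1)] by (auto simp: Q_def)
  qed
  note crs = homogeneous_complexify[OF rsd(1)] homogeneous_complexify[OF rsd(2)]
  let ?\<Phi> = "\<lambda>z. (peval (h 0) z, peval (h 1) z)" and ?\<Phi>' = "\<lambda>z v. (differential (h 0) z v, differential (h 1) z v)"
  let ?\<Psi> = "\<lambda>z. (peval (complexify r) z, peval (complexify s) z)"
  let ?\<Psi>' = "\<lambda>z v. (differential (complexify r) z v, differential (complexify s) z v)"
  have near: "\<forall>\<^sub>F z in nhds ?p. ?\<Phi> z = 0 \<longrightarrow> z \<in> X"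
    using h(4) by eventually_elim (auto simp: less_2_cases_iff zero_prod_def)
  \<comment> \<open>The real forms vanish on \<open>X\<close> and have as many independent
    differentials as the equations of \<open>X\<close>, so they cut out \<open>X\<close> near
    \<open>?p\<close>; now its real points can be read off from real equations.\<close>
  have "\<forall>\<^sub>F z in nhds ?p. ?\<Psi> z = 0 \<longrightarrow> ?\<Phi> z = 0"
  proof (rule zero_set_inclusion_imp_eq[of ?\<Phi> ?\<Phi>' _ ?\<Psi> ?\<Psi>'])
    show "C1_map ?\<Phi> ?\<Phi>'" by (rule C1_pair[OF C1_peval[OF hd(1)] C1_peval[OF hd(2)]])
    show "C1_map ?\<Psi> ?\<Psi>'" by (rule C1_pair[OF C1_peval[OF crs(1)] C1_peval[OF crs(2)]])
    show "?\<Phi> ?p = 0" "?\<Psi> ?p = 0" using h(2) xX Qvan rs by (auto simp: zero_prod_def)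
    show "surj (?\<Phi>' ?p)" by (rule differential_pair_surj[OF hd ind])
    show "surj (?\<Psi>' ?p)" by (rule differential_pair_surj[OF crs rs_ind[unfolded D_def]])
    show "\<forall>\<^sub>F z in nhds ?p. ?\<Phi> z = 0 \<longrightarrow> ?\<Psi> z = 0"
      using near by eventually_elim (use Qvan rs in \<open>auto simp: zero_prod_def\<close>)
  qed
  with near have "\<forall>\<^sub>F z in nhds ?p. ?\<Psi> z = 0 \<longrightarrow> z \<in> X" by eventually_elim blast
  then have "\<forall>\<^sub>F y in nhds x. ?\<Psi> (cvec y) = 0 \<longrightarrow> cvec y \<in> X" by (rule eventually_cvec)
  let ?\<psi> = "\<lambda>y. (peval r y, peval s y)" and ?\<psi>' = "\<lambda>y v. (differential r y v, differential s y v)"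
  have near_real: "\<forall>\<^sub>F y in nhds x. ?\<psi> y = 0 \<longrightarrow> y \<in> real_points X"
  proof -
    have "\<forall>\<^sub>F y in nhds x. y \<in> - {0}" using xX(2) by (intro eventually_nhds_in_open open_Compl) auto
    with \<open>\<forall>\<^sub>F y in nhds x. ?\<Psi> (cvec y) = 0 \<longrightarrow> cvec y \<in> X\<close> show ?thesis
      by eventually_elim (auto simp: peval_complexify_cvec zero_prod_def real_points_def)
  qed
  have lin: "differential r x (u + v) = differential r x u + differential r x v"
    "differential r x (c *s v) = c * differential r x v" if "homogeneous e r" for r :: "('n, real) mpoly" and e u v c
    using linear_add[OF has_derivative_linear[OF real_differential(1)[OF that]]]
      linear_cmul[OF has_derivative_linear[OF real_differential(1)[OF that]]]
    by (simp_all add: scalar_mult_eq_scaleR)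
  have surj: "\<exists>v. differential r x v = a \<and> differential s x v = b" for a b
  proof (rule functional_pair_surj[OF lin[OF rsd(1)] lin[OF rsd(2)]])
    fix a b assume *: "\<forall>v. a * differential r x v + b * differential s x v = 0"
    have cv: "complex_of_real a * D r (cvec u) + complex_of_real b * D s (cvec u) = 0" for u
      using arg_cong[OF *[rule_format, of u], of complex_of_real]
      by (simp add: D_def real_differential(2)[OF rsd(1)] real_differential(2)[OF rsd(2)])
    have "complex_of_real a * D r z + complex_of_real b * D s z = 0" for z
    proof -
      obtain u w where z: "z = cvec u + \<i> *s cvec w" using cvec_decompose by blast
      have "complex_of_real a * D r z + complex_of_real b * D s z =
        (complex_of_real a * D r (cvec u) + complex_of_real b * D s (cvec u)) +
        \<i> * (complex_of_real a * D r (cvec w) + complex_of_real b * D s (cvec w))"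
        by (simp add: z D_def differential_linear[OF crs(1)] differential_linear[OF crs(2)] algebra_simps)
      then show ?thesis by (simp add: cv)
    qed
    then have "complex_of_real a = 0 \<and> complex_of_real b = 0" by (intro rs_ind allI)
    then show "a = 0 \<and> b = 0" by simp
  qed
  obtain v1 where v1: "differential r x v1 = 1" "differential s x v1 = 0" using surj by blast
  obtain v2 where v2: "differential r x v2 = 0" "differential s x v2 = 1" using surj by blast
  show ?thesis
  proof (rule exI[of _ v1], rule exI[of _ v2], intro allI)
    fix v
    define a b where "a = differential r x v" and "b = differential s x v"
    define k where "k = v - a *s v1 - b *s v2"
    have v: "v = k + (a *s v1 + b *s v2)" by (simp add: k_def)
    have "differential r x v = differential r x k + a" "differential s x v = differential s x k + b"
      by (subst v; simp add: lin[OF rsd(1)] lin[OF rsd(2)] v1 v2)+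
    then have k0: "?\<psi>' x k = 0" by (simp add: a_def b_def zero_prod_def)
    have "differential f ?p (cvec v) = complex_of_real a * differential f ?p (cvec v1) + complex_of_real b * differential f ?p (cvec v2)"
      if f: "homogeneous d f" "\<forall>y\<in>real_points X. peval f (cvec y) = 0" for f d
    proof -
      have "((\<lambda>y. peval f (cvec y)) has_derivative (\<lambda>v. differential f ?p (cvec v))) (at x)"
        by (rule has_derivative_compose[OF bounded_linear_imp_has_derivative[OF bounded_linear_cvec] differential_has_derivative[OF f(1)]])
      moreover have "\<forall>\<^sub>F y in nhds x. ?\<psi> y = 0 \<longrightarrow> peval f (cvec y) = 0"
        using near_real by eventually_elim (use f(2) in blast)
      moreover have "?\<psi> x = 0" using Qvan[OF rs(1) xX(1)] Qvan[OF rs(2) xX(1)] by (simp add: peval_complexify_cvec zero_prod_def)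
      moreover have "surj (?\<psi>' x)" unfolding surj_def using surj by (metis surj_pair)
      ultimately have "differential f ?p (cvec k) = 0"
        using derivative_vanishes_on_tangent[OF C1_pair[OF C1_peval_real[OF rsd(1)] C1_peval_real[OF rsd(2)]] _ _ k0] by blast
      then show ?thesis
        by (subst v) (simp add: cvec_add cvec_scaleR scalar_mult_eq_scaleR differential_linear[OF f(1)])
    qed
    then show "\<exists>\<alpha> \<beta>. \<forall>f d. homogeneous d f \<longrightarrow> (\<forall>y\<in>real_points X. peval f (cvec y) = 0) \<longrightarrow>
      differential f ?p (cvec v) = complex_of_real \<alpha> * differential f ?p (cvec v1) + complex_of_real \<beta> * differential f ?p (cvec v2)"
      by blast
  qed
qed

text \<open>Modulo the tangent space of \<open>V\<close> every vector is real: vectors of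
  \<open>tangent_space\<close> are killed by definition, the direction of \<open>x\<close> by
  Euler's relation.\<close>

lemma transverse_real_direction:
  assumes "transverse_to_RP V" "x \<in> real_points V"
  shows "\<exists>u. \<forall>f d. homogeneous d f \<longrightarrow> (\<forall>y\<in>V. peval f y = 0) \<longrightarrow>
    differential f (cvec x) z = differential f (cvec x) (cvec u)"
proof -
  have "z \<in> {v + w | v w. v \<in> tangent_space V (cvec x) \<and> w \<in> tangent_space_RP x}"
    using assms unfolding transverse_to_RP_def by blast
  then obtain v u c where z: "z = v + (cvec u + c *s cvec x)" "v \<in> tangent_space V (cvec x)"
    unfolding tangent_space_RP_def by blast
  have "differential f (cvec x) z = differential f (cvec x) (cvec u)"
    if "homogeneous d f" "\<forall>y\<in>V. peval f y = 0" for f d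
  proof -
    have "differential f (cvec x) v = 0" using z(2) that unfolding tangent_space_def by blast
    moreover have "peval f (cvec x) = 0" using assms(2) that(2) by (simp add: real_points_def)
    ultimately show ?thesis
      using differential_at_zero_along[OF that(1)] by (simp add: z differential_linear[OF that(1)])
  qed
  then show ?thesis by blast
qed

text \<open>A count in the normal space of \<open>V\<close>, of real dimension \<open>2 * c\<close>:
  by transversality the real vectors fill it, and by \<open>vanishing_differentials_span\<close>
  they fill at most two real dimensions.\<close>

lemma slice_codim_1:
  fixes V X :: "(complex ^ 'n::finite) set"
  assumes X: "real_variety X" "nonsingular_of_codim 2 X" and V: "transverse_to_RP V" "0 \<notin> V"
    and eq: "real_points X = real_points V" and x: "x \<in> real_points X" and c: "nonsingular_at c V (cvec x)"
  shows "c = 1"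
proof -
  let ?p = "cvec x"
  have xX: "?p \<in> X" "?p \<in> V" "x \<in> real_points V" using x eq by (auto simp: real_points_def)
  have nX: "nonsingular_at 2 X ?p" using X(2) xX(1) by (simp add: nonsingular_of_codim_def)
  obtain h where h: "\<forall>i<c. \<exists>d. homogeneous d (h i)" "\<forall>i<c. \<forall>y\<in>V. peval (h i) y = 0"
      "\<And>a. \<forall>v. (\<Sum>i<c. a i * differential (h i) ?p v) = 0 \<Longrightarrow> \<forall>i<c. a i = 0"
      "\<forall>\<^sub>F y in nhds ?p. (\<forall>i<c. peval (h i) y = 0) \<longrightarrow> y \<in> V"
    using nonsingular_at_forms[OF c xX(2) V(2)] by blast
  \<comment> \<open>Otherwise all real points near \<open>x\<close> would lie on \<open>X\<close>,
    and the differential of a local equation of \<open>X\<close> would vanish on real vectors, hence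
    on all.\<close>
  have "c \<noteq> 0"
  proof
    assume "c = 0"
    then have "\<forall>\<^sub>F y in nhds ?p. y \<in> V" using h(4) by simp
    then have "\<forall>\<^sub>F y in nhds x. cvec y \<in> V" by (rule eventually_cvec)
    then have ev: "\<forall>\<^sub>F y in nhds x. cvec y \<in> X"
    proof eventually_elim
      case (elim y)
      then have "y \<in> real_points V" using V(2) by (auto simp: real_points_def)
      then show ?case using eq by (auto simp: real_points_def)
    qed
    have "0 \<notin> X" using X(1) by (auto simp: real_variety_def zero_locus_def)
    then obtain k where k: "\<forall>i<2::nat. \<exists>d. homogeneous d (k i)" "\<forall>i<2::nat. \<forall>y\<in>X. peval (k i) y = 0"
      "\<And>a. \<forall>v. (\<Sum>i<2. a i * differential (k i) ?p v) = 0 \<Longrightarrow> \<forall>i<2::nat. a i = 0"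
      using nonsingular_at_forms[OF nX xX(1)] by blast
    obtain d where k0: "homogeneous d (k 0)" using k(1)[rule_format, of 0] by auto
    have "((\<lambda>y. peval (k 0) (cvec y)) has_derivative (\<lambda>v. differential (k 0) ?p (cvec v))) (at x)"
      by (rule has_derivative_compose[OF bounded_linear_imp_has_derivative[OF bounded_linear_cvec] differential_has_derivative[OF k0]])
    moreover have "((\<lambda>y. peval (k 0) (cvec y)) has_derivative (\<lambda>v. 0)) (at x)"
    proof (rule has_derivative_transform_eventually[OF has_derivative_const[of 0]])
      have "\<forall>\<^sub>F y in nhds x. 0 = peval (k 0) (cvec y)"
        using ev by eventually_elim (use k(2) in auto)
      then show "\<forall>\<^sub>F y in at x. 0 = peval (k 0) (cvec y)" "0 = peval (k 0) (cvec x)"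
        by (auto simp: eventually_nhds_conv_at elim: eventually_mono)
    qed simp
    ultimately have "(\<lambda>v. differential (k 0) ?p (cvec v)) = (\<lambda>v. 0)" by (rule has_derivative_unique)
    then have "differential (k 0) ?p (cvec v) = 0" for v by metis
    then have "differential (k 0) ?p v = 0" for v by (rule differential_cvec_eq_0[OF k0])
    then have "\<forall>v. (\<Sum>i<2. (if i = 0 then 1 else 0) * differential (k i) ?p v) = 0"
      by (simp add: numeral_2_eq_2)
    from k(3)[OF this, rule_format, of 0] show False by simp
  qed
  moreover have "\<not> c \<ge> 2"
  proof
    assume "c \<ge> 2"
    then have "0 < c" "1 < c" by auto
    then obtain d0 d1 where hd: "homogeneous d0 (h 0)" "homogeneous d1 (h 1)"
      using h(1) by blast
    have hV: "\<forall>y\<in>V. peval (h 0) y = 0" "\<forall>y\<in>V. peval (h 1) y = 0" using h(2) \<open>c \<ge> 2\<close> by auto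
    have ind: "a = 0 \<and> b = 0" if "\<forall>v. a * differential (h 0) ?p v + b * differential (h 1) ?p v = 0" for a b
    proof -
      define \<alpha> where "\<alpha> = (\<lambda>i::nat. if i = 0 then a else if i = 1 then b else 0)"
      have "(\<Sum>i<c. \<alpha> i * differential (h i) ?p v) = (\<Sum>i\<in>{0,1}. \<alpha> i * differential (h i) ?p v)" for v
        using \<open>c \<ge> 2\<close> by (intro sum.mono_neutral_right) (auto simp: \<alpha>_def)
      then have "\<forall>v. (\<Sum>i<c. \<alpha> i * differential (h i) ?p v) = 0" using that by (simp add: \<alpha>_def)
      from h(3)[OF this] have "\<alpha> 0 = 0" "\<alpha> 1 = 0" using \<open>c \<ge> 2\<close> by auto
      then show ?thesis by (simp add: \<alpha>_def)
    qed
    obtain v1 v2 where v12: "\<And>v. \<exists>\<alpha> \<beta>. \<forall>f d. homogeneous d f \<longrightarrow> (\<forall>y\<in>real_points X. peval f (cvec y) = 0) \<longrightarrow>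
      differential f ?p (cvec v) = complex_of_real \<alpha> * differential f ?p (cvec v1) + complex_of_real \<beta> * differential f ?p (cvec v2)"
      using vanishing_differentials_span[OF X(1) nX x] by blast
    define w where "w = (\<lambda>v. (differential (h 0) ?p (cvec v), differential (h 1) ?p (cvec v)))"
    have "t \<in> span {w v1, w v2}" for t
    proof -
      obtain z where z: "t = (differential (h 0) ?p z, differential (h 1) ?p z)"
        using differential_pair_surj[OF hd ind] unfolding surj_def by blast
      obtain u where "\<forall>f d. homogeneous d f \<longrightarrow> (\<forall>y\<in>V. peval f y = 0) \<longrightarrow> differential f ?p z = differential f ?p (cvec u)"
        using transverse_real_direction[OF V(1) xX(3)] by blast
      then have "t = w u" using hd hV by (auto simp: z w_def)
      obtain \<alpha> \<beta> where ab: "\<forall>f d. homogeneous d f \<longrightarrow> (\<forall>y\<in>real_points X. peval f (cvec y) = 0) \<longrightarrow>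
        differential f ?p (cvec u) = complex_of_real \<alpha> * differential f ?p (cvec v1) + complex_of_real \<beta> * differential f ?p (cvec v2)"
        using v12 by blast
      have "\<forall>y\<in>real_points X. peval (h 0) (cvec y) = 0" "\<forall>y\<in>real_points X. peval (h 1) (cvec y) = 0"
        unfolding eq using hV by (auto simp: real_points_def)
      then have "w u = \<alpha> *\<^sub>R w v1 + \<beta> *\<^sub>R w v2" using ab hd by (auto simp: w_def scaleR_conv_of_real[where 'a = complex])
      moreover have "w v1 \<in> span {w v1, w v2}" "w v2 \<in> span {w v1, w v2}" by (simp_all add: span_base)
      ultimately show ?thesis unfolding \<open>t = w u\<close> by (metis span_add span_scale)
    qed
    then have "span {w v1, w v2} = UNIV" by blast
    then have "dim (UNIV :: (complex \<times> complex) set) \<le> card {w v1, w v2}"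
      using dim_le_card[of UNIV "{w v1, w v2}"] by simp
    also have "\<dots> \<le> 2" by (simp add: card_insert_if)
    finally show False by (simp add: dim_UNIV)
  qed
  ultimately show ?thesis by linarith
qed

subsection \<open>The hypersurface slicing a variety\<close>

lemma isCont_smult_line: "isCont (\<lambda>s. z + s *s (e :: complex ^ 'n::finite)) u"
  by (intro continuous_add continuous_const linear_continuous_at bounded_linear_smult_vec)

lemma form_vanishing_near:
  assumes f: "form d f" and ev: "\<forall>\<^sub>F s in nhds 0. f (z + s *s e) = 0"
  shows "f (z + s *s e) = 0"
proof -
  obtain r where r: "r > 0" "\<And>s. dist s 0 < r \<Longrightarrow> poly (poly_along e f z) s = 0"
    using ev by (auto simp: eventually_nhds_metric poly_poly_along[OF f])
  have "poly_along e f z = 0"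
  proof (rule ccontr)
    assume "poly_along e f z \<noteq> 0"
    moreover have "ball 0 r \<subseteq> {s. poly (poly_along e f z) s = 0}" using r(2) by (auto simp: dist_commute)
    ultimately have "finite (ball (0::complex) r)" using poly_roots_finite finite_subset by blast
    then show False using uncountable_ball[OF r(1)] countable_finite by blast
  qed
  then show ?thesis using poly_poly_along[OF f, of e z s] by simp
qed

text \<open>The final clause is transversality of \<open>P = 0\<close> at the real points, in the
  form that the pencil will use.\<close>

lemma hypersurface_of_slice:
  fixes V X :: "(complex ^ 'n::finite) set"
  assumes X: "real_variety X" "nonsingular_of_codim 2 X"
    and V: "complex_variety V" "nonsingular V" "transverse_to_RP V"
    and eq: "real_points X = real_points V" and x0: "x0 \<in> real_points X"
  shows "\<exists>d P. homogeneous d P \<and> (\<forall>z. z \<noteq> 0 \<longrightarrow> peval P z = 0 \<longrightarrow> (\<exists>v. differential P z v \<noteq> 0)) \<and>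
    (\<forall>x. x \<noteq> 0 \<longrightarrow> (peval P (cvec x) = 0 \<longleftrightarrow> x \<in> real_points X)) \<and>
    (\<forall>x\<in>real_points X. \<forall>a. \<exists>u. differential P (cvec x) (cvec u) = a)"
proof -
  have V0: "0 \<notin> V" using V(1) by (auto simp: complex_variety_def zero_locus_def)
  have rp: "cvec x \<in> V" if "x \<in> real_points X" for x using that eq by (auto simp: real_points_def)
  have local_eq: "\<exists>d f. homogeneous d f \<and> (\<forall>y\<in>V. peval f y = 0) \<and> (\<exists>v. differential f (cvec x) v \<noteq> 0) \<and>
      (\<forall>\<^sub>F y in nhds (cvec x). peval f y = 0 \<longrightarrow> y \<in> V)" if x: "x \<in> real_points X" for x
  proof -
    obtain c where c: "nonsingular_at c V (cvec x)" using V(2) rp[OF x] by (auto simp: nonsingular_def)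
    then have "c = 1" using slice_codim_1[OF X V(3) V0 eq x] by blast
    then obtain h where h: "\<forall>i<1::nat. \<exists>d. homogeneous d (h i)" "\<forall>i<1::nat. \<forall>y\<in>V. peval (h i) y = 0"
      "\<And>a. \<forall>v. (\<Sum>i<1::nat. a i * differential (h i) (cvec x) v) = 0 \<Longrightarrow> \<forall>i<1::nat. a i = 0"
      "\<forall>\<^sub>F y in nhds (cvec x). (\<forall>i<1::nat. peval (h i) y = 0) \<longrightarrow> y \<in> V"
      using nonsingular_at_forms[OF c rp[OF x] V0] by blast
    have "\<exists>v. differential (h 0) (cvec x) v \<noteq> 0"
    proof (rule ccontr)
      assume "\<not> ?thesis"
      then have "\<forall>v. (\<Sum>i<1::nat. (1::complex) * differential (h i) (cvec x) v) = 0" by simp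
      from h(3)[OF this, rule_format, of 0] show False by simp
    qed
    then show ?thesis using h by auto
  qed
  obtain d0 f0 where f0: "homogeneous d0 f0" "\<forall>y\<in>V. peval f0 y = 0" "\<exists>v. differential f0 (cvec x0) v \<noteq> 0"
    using local_eq[OF x0] by blast
  note form_f0 = homogeneous_imp_form[OF f0(1)]
  have "\<exists>e. peval f0 e \<noteq> 0"
  proof (rule ccontr)
    assume "\<not> ?thesis"
    then have "peval f0 = (\<lambda>x. 0)" by auto
    then have "(peval f0 has_derivative (\<lambda>v. 0)) (at (cvec x0))" by simp
    then show False using f0(3) differential_eqI by metis
  qed
  then obtain e where e: "peval f0 e \<noteq> 0" by blast
  have "e \<noteq> 0"
  proof
    assume "e = 0"
    then have "d0 = 0" using gform_at_zero[OF form_f0[unfolded form_def]] e by auto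
    then have "peval f0 (cvec x0) = peval f0 0"
      using gform_degree_0[of "\<lambda>t. peval f0" 0 "cvec x0"] form_f0 by (simp add: form_def)
    then show False using f0(2) rp[OF x0] e \<open>e = 0\<close> by simp
  qed
  \<comment> \<open>Only germs of \<open>V\<close> at real points count, so components without real
    points impose nothing. The neighbourhood may depend on the function and on the point.\<close>
  define M where "M = {f :: complex ^ 'n \<Rightarrow> complex. \<forall>x\<in>real_points X. \<forall>\<^sub>F y in nhds (cvec x). y \<in> V \<longrightarrow> f y = 0}"
  have MI: "peval f \<in> M" if "\<forall>y\<in>V. peval f y = 0" for f using that by (simp add: M_def)
  have "\<exists>k G. form (int k) G \<and> G \<in> M \<and> (\<forall>f d. form d f \<longrightarrow> f \<in> M \<longrightarrow> (\<exists>q d'. form d' q \<and> (\<forall>x. f x = q x * G x)))"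
  proof (rule principal_ideal_of_forms[OF _ _ MI[OF f0(2)] form_f0 e \<open>e \<noteq> 0\<close>])
    fix f g assume fg: "f \<in> M" "g \<in> M"
    show "(\<lambda>x. f x - g x) \<in> M" unfolding M_def mem_Collect_eq
    proof
      fix x assume "x \<in> real_points X"
      then have "\<forall>\<^sub>F y in nhds (cvec x). y \<in> V \<longrightarrow> f y = 0" "\<forall>\<^sub>F y in nhds (cvec x). y \<in> V \<longrightarrow> g y = 0"
        using fg by (simp_all add: M_def)
      then show "\<forall>\<^sub>F y in nhds (cvec x). y \<in> V \<longrightarrow> f y - g y = 0" by eventually_elim simp
    qed
  next
    fix f and q :: "complex ^ 'n \<Rightarrow> complex" assume f: "f \<in> M"
    show "(\<lambda>x. q x * f x) \<in> M" unfolding M_def mem_Collect_eq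
    proof
      fix x assume "x \<in> real_points X"
      then have "\<forall>\<^sub>F y in nhds (cvec x). y \<in> V \<longrightarrow> f y = 0" using f by (simp add: M_def)
      then show "\<forall>\<^sub>F y in nhds (cvec x). y \<in> V \<longrightarrow> q y * f y = 0" by eventually_elim simp
    qed
  next
    fix b f db df
    assume b: "form db b" "\<exists>y. b y \<noteq> 0" "\<And>y s. b (y + s *s e) = b y" and f: "form df f" and bf: "(\<lambda>x. b x * f x) \<in> M"
    obtain y0 where y0: "b y0 \<noteq> 0" using b(2) by blast
    show "f \<in> M" unfolding M_def mem_Collect_eq
    proof
      fix x assume x: "x \<in> real_points X"
      obtain d g where g: "homogeneous d g" "\<forall>y\<in>V. peval g y = 0"
          "\<forall>\<^sub>F y in nhds (cvec x). peval g y = 0 \<longrightarrow> y \<in> V"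
        using local_eq[OF x] by blast
      have "\<forall>\<^sub>F y in nhds (cvec x). y \<in> V \<longrightarrow> b y * f y = 0" using bf x by (simp add: M_def)
      with g(3) have "\<forall>\<^sub>F y in nhds (cvec x). (peval g y = 0 \<longrightarrow> y \<in> V) \<and> (y \<in> V \<longrightarrow> b y * f y = 0)"
        by (rule eventually_conj)
      then obtain r where r: "r > 0" "\<And>y. dist y (cvec x) < r \<Longrightarrow> (peval g y = 0 \<longrightarrow> y \<in> V) \<and> (y \<in> V \<longrightarrow> b y * f y = 0)"
        unfolding eventually_nhds_metric by blast
      \<comment> \<open>Near \<open>x\<close> the points of \<open>V\<close> are the zeros of
        \<open>g\<close>. If \<open>f z \<noteq> 0\<close>, then \<open>zero_set_dense\<close> moves
        \<open>z\<close> within these zeros off \<open>b = 0\<close>, where \<open>b * f = 0\<close>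
        forces \<open>f = 0\<close>, against continuity.\<close>
      have "f z = 0" if z: "dist z (cvec x) < r" "z \<in> V" for z
      proof (rule ccontr)
        assume "f z \<noteq> 0"
        then obtain \<delta> where \<delta>: "\<delta> > 0" "\<And>y. dist z y < \<delta> \<Longrightarrow> f y \<noteq> 0"
          using continuous_at_avoid[OF form_isCont[OF f]] by blast
        \<comment> \<open>Otherwise \<open>V\<close> contains a piece of the line through
          \<open>z\<close> with direction \<open>e\<close>, and \<open>f0\<close> vanishes on this
          line, though its leading coefficient along \<open>e\<close> is
          \<open>peval f0 e\<close>.\<close>
        have "\<exists>s. peval g (z + s *s e) \<noteq> 0"
        proof (rule ccontr)
          assume 0: "\<not> ?thesis"
          have "open ((\<lambda>s. z + s *s e) -` ball (cvec x) r)"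
            by (intro open_vimage open_ball continuous_at_imp_continuous_on ballI isCont_smult_line)
          then have "\<forall>\<^sub>F s in nhds 0. s \<in> (\<lambda>s. z + s *s e) -` ball (cvec x) r"
            using z(1) by (intro eventually_nhds_in_open) (auto simp: dist_commute)
          then have ev: "\<forall>\<^sub>F s in nhds 0. peval f0 (z + s *s e) = 0"
          proof eventually_elim
            case (elim s)
            then have "z + s *s e \<in> V" using r(2) 0 by (auto simp: dist_commute)
            then show ?case using f0(2) by blast
          qed
          have "poly (poly_along e (peval f0) z) s = 0" for s
            using form_vanishing_near[OF form_f0 ev] by (simp add: poly_poly_along[OF form_f0])
          then have "poly_along e (peval f0) z = 0" using poly_all_0_iff_0 by blast
          then show False using coeff_poly_along_top(2)[OF form_f0, of e z] e by simp
        qed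
        then obtain s where s: "peval g (z + s *s e) \<noteq> 0" by blast
        have "min \<delta> (r - dist z (cvec x)) > 0" using \<delta>(1) z(1) by simp
        then obtain z' where z': "dist z' z < min \<delta> (r - dist z (cvec x))" "peval g z' = 0" "b z' \<noteq> 0"
          using zero_set_dense[OF homogeneous_imp_form[OF g(1)] b(1) y0 b(3) _ s] g(2) z(2) by blast
        then have "dist z' (cvec x) < r" using dist_triangle[of z' "cvec x" z] by simp
        then have "b z' * f z' = 0" using r(2) z'(2) by blast
        then show False using z' \<delta>(2)[of z'] by (simp add: dist_commute)
      qed
      then show "\<forall>\<^sub>F y in nhds (cvec x). y \<in> V \<longrightarrow> f y = 0"
        unfolding eventually_nhds_metric using r(1) by blast
    qed
  qed
  then obtain k G where G: "form (int k) G" "G \<in> M"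
    and Gdvd: "\<And>f d. form d f \<Longrightarrow> f \<in> M \<Longrightarrow> \<exists>q d'. form d' q \<and> (\<forall>x. f x = q x * G x)" by blast
  obtain P where P: "homogeneous k P" "G = peval P" using G(1) by (auto simp: form_iff)
  have dvd: "\<exists>q. (\<forall>z. peval f z = q z * peval P z) \<and>
      (\<forall>z. peval P z = 0 \<longrightarrow> (\<forall>v. differential f z v = q z * differential P z v))"
    if f: "homogeneous d f" "\<forall>y\<in>V. peval f y = 0" for f d
  proof -
    obtain q d' where q: "form d' q" "\<And>z. peval f z = q z * peval P z"
      using Gdvd[OF homogeneous_imp_form[OF f(1)] MI[OF f(2)]] P(2) by blast
    have "differential f z v = q z * differential P z v" if "peval P z = 0" for z v
    proof -
      obtain q' where q': "(q has_derivative q') (at z)" using form_has_derivative[OF q(1)] by blast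
      have "((\<lambda>z. q z * peval P z) has_derivative (\<lambda>v. q z * differential P z v + q' v * peval P z)) (at z)"
        by (rule has_derivative_mult[OF q' differential_has_derivative[OF P(1)]])
      moreover have "peval f = (\<lambda>z. q z * peval P z)" using q(2) by auto
      ultimately have "(peval f has_derivative (\<lambda>v. q z * differential P z v + q' v * peval P z)) (at z)"
        by (simp only:)
      from differential_eqI[OF this] show ?thesis using that by simp
    qed
    then show ?thesis using q(2) by blast
  qed
  have zV: "z \<in> V" if "z \<noteq> 0" "peval P z = 0" for z
  proof -
    obtain F where F: "\<forall>f\<in>F. \<exists>d. homogeneous d f" "V = zero_locus F"
      using V(1) unfolding complex_variety_def by blast
    have "peval f z = 0" if fF: "f \<in> F" for f
    proof -
      obtain d where "homogeneous d f" using F(1) fF by blast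
      moreover have "\<forall>y\<in>V. peval f y = 0" using fF F(2) by (auto simp: zero_locus_def)
      ultimately obtain q where "peval f z = q z * peval P z" using dvd by blast
      then show ?thesis using \<open>peval P z = 0\<close> by simp
    qed
    then show ?thesis using F(2) that by (simp add: zero_locus_def)
  qed
  have Px: "peval P (cvec x) = 0" if "x \<in> real_points X" for x
    using G(2) that rp[OF that] eventually_nhds_x_imp_x unfolding M_def P(2) by fastforce
  \<comment> \<open>A form vanishing on \<open>V\<close> with nonzero differential at
    \<open>z\<close> is a multiple of \<open>P\<close>, so its differential there is a multiple of
    that of \<open>P\<close>. Such a form exists unless \<open>c = 0\<close>, when \<open>f0\<close>
    would vanish near \<open>z\<close> and hence identically.\<close>
  have "\<exists>v. differential P z v \<noteq> 0" if z: "z \<noteq> 0" "peval P z = 0" for z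
  proof -
    obtain c where c: "nonsingular_at c V z" using zV[OF z] V(2) by (auto simp: nonsingular_def)
    obtain h where h: "\<forall>i<c. \<exists>d. homogeneous d (h i)" "\<forall>i<c. \<forall>y\<in>V. peval (h i) y = 0"
      "\<And>a. \<forall>v. (\<Sum>i<c. a i * differential (h i) z v) = 0 \<Longrightarrow> \<forall>i<c. a i = 0"
      "\<forall>\<^sub>F y in nhds z. (\<forall>i<c. peval (h i) y = 0) \<longrightarrow> y \<in> V"
      using nonsingular_at_forms[OF c zV[OF z] V0] by blast
    have "c \<noteq> 0"
    proof
      assume "c = 0"
      have ev: "\<forall>\<^sub>F y in nhds z. peval f0 y = 0"
        using h(4) by (rule eventually_mono) (use f0(2) \<open>c = 0\<close> in auto)
      have "isCont (\<lambda>s. z + s *s (e - z)) 0" by (rule isCont_smult_line)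
      then have "filterlim (\<lambda>s. z + s *s (e - z)) (nhds z) (nhds 0)"
        by (simp add: isCont_def tendsto_nhds_iff)
      then have "\<forall>\<^sub>F s in nhds 0. peval f0 (z + s *s (e - z)) = 0"
        using ev by (rule eventually_compose_filterlim[rotated])
      from form_vanishing_near[OF form_f0 this, of 1] show False using e by simp
    qed
    then have "0 < c" by simp
    obtain d where h0: "homogeneous d (h 0)" using h(1) \<open>0 < c\<close> by blast
    have "\<exists>v. differential (h 0) z v \<noteq> 0"
    proof (rule ccontr)
      assume "\<not> ?thesis"
      then have "\<forall>v. (\<Sum>i<c. (if i = 0 then 1 else 0) * differential (h i) z v) = 0"
        by (intro allI sum.neutral ballI) auto
      from h(3)[OF this, rule_format, OF \<open>0 < c\<close>] show False by simp
    qed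
    moreover obtain q where "\<And>v. differential (h 0) z v = q z * differential P z v"
      using dvd[OF h0] h(2) \<open>0 < c\<close> z(2) by blast
    ultimately show ?thesis by auto
  qed
  moreover have "peval P (cvec x) = 0 \<longleftrightarrow> x \<in> real_points X" if "x \<noteq> 0" for x
  proof -
    have "x \<in> real_points X" if "cvec x \<in> V"
      unfolding eq using that \<open>x \<noteq> 0\<close> by (simp add: real_points_def)
    then show ?thesis using Px zV[of "cvec x"] that by auto
  qed
  moreover have "\<exists>u. differential P (cvec x) (cvec u) = a" if x: "x \<in> real_points X" for x a
  proof -
    obtain d g where g: "homogeneous d g" "\<forall>y\<in>V. peval g y = 0" "\<exists>v. differential g (cvec x) v \<noteq> 0"
      using local_eq[OF x] by blast
    obtain q where q: "\<And>v. differential g (cvec x) v = q (cvec x) * differential P (cvec x) v"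
      using dvd[OF g(1,2)] Px[OF x] by blast
    obtain v where v: "differential g (cvec x) v \<noteq> 0" using g(3) by blast
    \<comment> \<open>A complex vector with value \<open>a\<close> is exchanged for a real one by
      transversality, applied to \<open>g\<close>, whose differential is that of \<open>P\<close> up
      to the nonzero factor \<open>q (cvec x)\<close>.\<close>
    define z where "z = (a / differential P (cvec x) v) *s v"
    have nz: "q (cvec x) \<noteq> 0" "differential P (cvec x) v \<noteq> 0" using v q by auto
    then have "differential P (cvec x) z = a" by (simp add: z_def differential_smult[OF P(1)])
    moreover obtain u where "differential g (cvec x) z = differential g (cvec x) (cvec u)"
      using transverse_real_direction[OF V(3), of x z] x g(1,2) eq by blast
    ultimately show ?thesis using nz(1) by (auto simp: q)
  qed
  ultimately show ?thesis using P(1) by blast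
qed

subsection \<open>Pencils\<close>

lemma homogeneous_sum: "(\<And>i. i \<in> I \<Longrightarrow> homogeneous d (f i)) \<Longrightarrow> homogeneous d (\<Sum>i\<in>I. f i)"
  by (induction I rule: infinite_finite_induct) (simp_all add: homogeneous_add)

lemma zero_locus_pair:
  "z \<in> zero_locus {complexify R, complexify S} \<longleftrightarrow> z \<noteq> 0 \<and> peval (complexify R) z = 0 \<and> peval (complexify S) z = 0"
  by (simp add: zero_locus_def)

lemma real_points_zero_locus_pair:
  "x \<in> real_points (zero_locus {complexify R, complexify S}) \<longleftrightarrow> x \<noteq> 0 \<and> peval R x = 0 \<and> peval S x = 0"
  by (simp add: real_points_def zero_locus_pair peval_complexify_cvec)

lemma pencil_base_eq:
  "pencil_base (pencil R S) = zero_locus {complexify R, complexify S}"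
proof -
  have ev: "peval (complexify (scale l R + scale m S)) z = complex_of_real l * peval (complexify R) z + complex_of_real m * peval (complexify S) z" for l m z
    by (simp add: complexify_add complexify_scale peval_add peval_scale)
  have "peval (complexify R) z = 0 \<and> peval (complexify S) z = 0 \<longleftrightarrow> (\<forall>f\<in>pencil R S. peval (complexify f) z = 0)" for z
  proof
    assume *: "\<forall>f\<in>pencil R S. peval (complexify f) z = 0"
    have "scale 1 R + scale 0 S \<in> pencil R S"
      unfolding pencil_def by (rule CollectI, rule exI[of _ 1], rule exI[of _ 0]) simp
    moreover have "scale 0 R + scale 1 S \<in> pencil R S"
      unfolding pencil_def by (rule CollectI, rule exI[of _ 0], rule exI[of _ 1]) simp
    ultimately show "peval (complexify R) z = 0 \<and> peval (complexify S) z = 0"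
      using * ev[of 1 0 z] ev[of 0 1 z] by auto
  qed (auto simp: pencil_def ev)
  then show ?thesis by (auto simp: pencil_base_def zero_locus_def)
qed

text \<open>Independent members arise from \<open>R0\<close>, \<open>S0\<close> by a real
  substitution with determinant \<Delta>; independence makes it nonzero, and Cramer's rule inverts
  the substitution.\<close>

lemma pencil_base_members:
  assumes "R \<in> pencil R0 S0" "S \<in> pencil R0 S0" and ind: "independent_pair R S"
  shows "zero_locus {complexify R, complexify S} = pencil_base (pencil R0 S0)"
proof -
  obtain l1 m1 l2 m2 where RS: "R = scale l1 R0 + scale m1 S0" "S = scale l2 R0 + scale m2 S0"
    using assms(1,2) unfolding pencil_def by blast
  have ev: "peval (complexify R) z = complex_of_real l1 * peval (complexify R0) z + complex_of_real m1 * peval (complexify S0) z"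
    "peval (complexify S) z = complex_of_real l2 * peval (complexify R0) z + complex_of_real m2 * peval (complexify S0) z" for z
    by (simp_all add: RS complexify_add complexify_scale peval_add peval_scale)
  have lk: "scale a R + scale b S = scale (a * l1 + b * l2) R0 + scale (a * m1 + b * m2) S0" for a b
    by (rule poly_mapping_eqI) (simp add: RS scale_def lookup_add lookup_map algebra_simps)
  have z0: "scale 0 p = 0" for p :: "('a, real) mpoly"
    by (rule poly_mapping_eqI) (simp add: scale_def lookup_map)
  define \<Delta> where "\<Delta> = l1 * m2 - l2 * m1"
  have "\<Delta> \<noteq> 0"
  proof
    assume "\<Delta> = 0"
    have "scale m2 R + scale (- m1) S = 0" "scale l2 R + scale (- l1) S = 0"
      unfolding lk using \<open>\<Delta> = 0\<close> by (simp_all add: \<Delta>_def z0 mult.commute)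
    then have "l1 = 0" "m1 = 0" "l2 = 0" "m2 = 0" using ind unfolding independent_pair_def by fastforce+
    then have "scale 1 R + scale 0 S = 0" unfolding lk by (simp add: z0)
    then show False using ind unfolding independent_pair_def by fastforce
  qed
  have "peval (complexify R) z = 0 \<and> peval (complexify S) z = 0 \<longleftrightarrow>
    peval (complexify R0) z = 0 \<and> peval (complexify S0) z = 0" for z
  proof
    assume "peval (complexify R) z = 0 \<and> peval (complexify S) z = 0"
    then have e: "complex_of_real l1 * peval (complexify R0) z + complex_of_real m1 * peval (complexify S0) z = 0"
      "complex_of_real l2 * peval (complexify R0) z + complex_of_real m2 * peval (complexify S0) z = 0"
      by (simp_all add: ev)
    have "complex_of_real \<Delta> * peval (complexify R0) z = m2 * (l1 * peval (complexify R0) z + m1 * peval (complexify S0) z)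
       - m1 * (l2 * peval (complexify R0) z + m2 * peval (complexify S0) z)"
      by (simp add: \<Delta>_def algebra_simps)
    then have "complex_of_real \<Delta> * peval (complexify R0) z = 0" unfolding e by simp
    moreover have "complex_of_real \<Delta> * peval (complexify S0) z = l1 * (l2 * peval (complexify R0) z + m2 * peval (complexify S0) z)
       - l2 * (l1 * peval (complexify R0) z + m1 * peval (complexify S0) z)"
      by (simp add: \<Delta>_def algebra_simps)
    then have "complex_of_real \<Delta> * peval (complexify S0) z = 0" unfolding e by simp
    ultimately show "peval (complexify R0) z = 0 \<and> peval (complexify S0) z = 0"
      using \<open>\<Delta> \<noteq> 0\<close> by simp
  qed (simp add: ev)
  then show ?thesis unfolding pencil_base_eq by (auto simp: zero_locus_def)
qed

text \<open>If one differential is zero, its kernel alone is everything, and the tangent spaces span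
  without the pair being onto; hence the vectors \<open>r\<close> and \<open>s\<close> in the second
  part.\<close>

lemma tangents_span:
  fixes R S :: "('n::finite, real) mpoly"
  assumes R: "homogeneous d R" and S: "homogeneous e S"
  shows "(\<And>a b. \<exists>u. differential R x u = a \<and> differential S x u = b) \<Longrightarrow>
      {v + w | v w. v \<in> hypersurface_tangent R x \<and> w \<in> hypersurface_tangent S x} = UNIV"
    and "{v + w | v w. v \<in> hypersurface_tangent R x \<and> w \<in> hypersurface_tangent S x} = UNIV \<Longrightarrow>
      differential R x r \<noteq> 0 \<Longrightarrow> differential S x s \<noteq> 0 \<Longrightarrow> \<exists>u. differential R x u = a \<and> differential S x u = b"
proof -
  have lin: "linear (differential R x)" "linear (differential S x)"
    using has_derivative_linear[OF real_differential(1)] R S by blast+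
  show "{v + w | v w. v \<in> hypersurface_tangent R x \<and> w \<in> hypersurface_tangent S x} = UNIV"
    if surj: "\<And>a b. \<exists>u. differential R x u = a \<and> differential S x u = b"
  proof -
    have "z \<in> {v + w | v w. v \<in> hypersurface_tangent R x \<and> w \<in> hypersurface_tangent S x}" for z
    proof -
      obtain v where v: "differential R x v = 0" "differential S x v = differential S x z" using surj by blast
      have "z = v + (z - v)" by simp
      moreover have "v \<in> hypersurface_tangent R x" "z - v \<in> hypersurface_tangent S x"
        using v by (simp_all add: hypersurface_tangent_def linear_diff[OF lin(2)])
      ultimately show ?thesis by blast
    qed
    then show ?thesis by blast
  qed
  assume sp: "{v + w | v w. v \<in> hypersurface_tangent R x \<and> w \<in> hypersurface_tangent S x} = UNIV"
    and r: "differential R x r \<noteq> 0" and s: "differential S x s \<noteq> 0"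
  have "r \<in> {v + w | v w. v \<in> hypersurface_tangent R x \<and> w \<in> hypersurface_tangent S x}"
    "s \<in> {v + w | v w. v \<in> hypersurface_tangent R x \<and> w \<in> hypersurface_tangent S x}"
    using sp by blast+
  then obtain v1 w1 v2 w2 where vw: "r = v1 + w1" "s = v2 + w2" "differential R x v1 = 0" "differential S x w1 = 0"
    "differential R x v2 = 0" "differential S x w2 = 0"
    unfolding hypersurface_tangent_def by blast
  define u where "u = (a / differential R x r) *\<^sub>R w1 + (b / differential S x s) *\<^sub>R v2"
  have "differential R x w1 = differential R x r" "differential S x v2 = differential S x s"
    using vw by (simp_all add: linear_add[OF lin(1)] linear_add[OF lin(2)])
  then have "differential R x u = a" "differential S x u = b"
    using vw r s by (simp_all add: u_def linear_add[OF lin(1)] linear_add[OF lin(2)] linear_cmul[OF lin(1)] linear_cmul[OF lin(2)])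
  then show "\<exists>u. differential R x u = a \<and> differential S x u = b" by blast
qed

section \<open>Varieties without real points\<close>

definition quadric :: "('n::finite \<Rightarrow> real) \<Rightarrow> ('n, real) mpoly" where
  "quadric c = (\<Sum>i\<in>UNIV. Poly_Mapping.single (Poly_Mapping.single i 2) (c i))"

lemma peval_single_square:
  "peval (Poly_Mapping.single (Poly_Mapping.single k 2) a) x = a * (x $ k)\<^sup>2"
proof -
  have eq: "(x $ i) ^ (if i = k then 2 else 0) = (if i = k then (x $ i)\<^sup>2 else 1)" for i by simp
  show ?thesis by (simp add: peval_single lookup_single when_def eq eq_commute[of k])
qed

lemma quadric:
  shows homogeneous_quadric: "homogeneous 2 (quadric c)"
    and peval_quadric: "peval (quadric c) x = (\<Sum>i\<in>UNIV. c i * (x $ i)\<^sup>2)"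
    and peval_complexify_quadric: "peval (complexify (quadric c)) z = (\<Sum>i\<in>UNIV. complex_of_real (c i) * (z $ i)\<^sup>2)"
proof -
  show "homogeneous 2 (quadric c)" unfolding quadric_def
    by (rule homogeneous_sum) (simp add: homogeneous_def lookup_single when_def)
  show "peval (quadric c) x = (\<Sum>i\<in>UNIV. c i * (x $ i)\<^sup>2)"
    unfolding quadric_def by (simp add: peval_sum peval_single_square)
  have "complexify (quadric c) = (\<Sum>i\<in>UNIV. Poly_Mapping.single (Poly_Mapping.single i 2) (complex_of_real (c i)))"
    by (rule poly_mapping_eqI) (simp add: complexify_def quadric_def lookup_map lookup_sum lookup_single when_def if_distrib cong: if_cong)
  then show "peval (complexify (quadric c)) z = (\<Sum>i\<in>UNIV. complex_of_real (c i) * (z $ i)\<^sup>2)"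
    by (simp add: peval_sum peval_single_square)
qed

lemma nonsingular_quadric:
  fixes c :: "'n::finite \<Rightarrow> real"
  assumes "\<And>i. c i \<noteq> 0" shows "nonsingular_hypersurface (quadric c)"
  unfolding nonsingular_hypersurface_def
proof
  fix z :: "complex ^ 'n" assume "z \<in> zero_locus {complexify (quadric c)}"
  then obtain j where j: "z $ j \<noteq> 0" by (auto simp: zero_locus_def Finite_Cartesian_Product.vec_eq_iff)
  have "((\<lambda>z. \<Sum>i\<in>UNIV. complex_of_real (c i) * (z $ i)\<^sup>2) has_derivative
     (\<lambda>v. \<Sum>i\<in>UNIV. complex_of_real (c i) * (2 * z $ i * v $ i))) (at z)"
    by (rule has_derivative_sum) (auto intro!: derivative_eq_intros bounded_linear_imp_has_derivative[OF bounded_linear_vec_nth])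
  moreover have "peval (complexify (quadric c)) = (\<lambda>z. \<Sum>i\<in>UNIV. complex_of_real (c i) * (z $ i)\<^sup>2)"
    by (simp add: fun_eq_iff peval_complexify_quadric)
  ultimately have "(peval (complexify (quadric c)) has_derivative
     (\<lambda>v. \<Sum>i\<in>UNIV. complex_of_real (c i) * (2 * z $ i * v $ i))) (at z)" by (simp only:)
  from differential_eqI[OF this]
  have "differential (complexify (quadric c)) z (axis j 1) = (\<Sum>i\<in>UNIV. complex_of_real (c i) * (2 * z $ i * axis j 1 $ i))"
    by simp
  also have "\<dots> = (\<Sum>i\<in>UNIV. if i = j then complex_of_real (c i) * (2 * z $ i) else 0)"
    by (intro sum.cong) (auto simp: axis_def)
  also have "\<dots> = complex_of_real (c j) * (2 * z $ j)" by simp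
  finally show "\<exists>v. differential (complexify (quadric c)) z v \<noteq> 0"
    using j assms[of j] by (intro exI[of _ "axis j 1"]) simp
qed

lemma generic_pair_imp_base:
  fixes R S :: "('n::finite, real) mpoly"
  assumes "homogeneous d R" "homogeneous d S" "independent_pair R S" "nonsingular_hypersurface R" "nonsingular_hypersurface S"
    "transverse_hypersurfaces R S" "real_points X = real_points (zero_locus {complexify R, complexify S})"
  shows "is_base_of_generic_pencil X" "regular_complete_intersection d d X"
proof -
  have s1: "scale 1 p = p" "scale 0 p = 0" for p :: "('n, real) mpoly"
    by (rule poly_mapping_eqI, simp add: scale_def lookup_map)+
  have "R = scale 1 R + scale 0 S" "S = scale 0 R + scale 1 S" by (simp_all add: s1)
  then have "R \<in> pencil R S" "S \<in> pencil R S" unfolding pencil_def by force+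
  then have "generic_pencil (pencil R S)" unfolding generic_pencil_def using assms by blast
  moreover have "real_pencil d (pencil R S)" unfolding real_pencil_def using assms by blast
  ultimately show "is_base_of_generic_pencil X"
    unfolding is_base_of_generic_pencil_def using assms(7) pencil_base_eq by metis
  show "regular_complete_intersection d d X" unfolding regular_complete_intersection_def using assms by blast
qed

text \<open>A sum of squares has no real zeros, which makes transversality vacuous, and nonzero
  coefficients make a diagonal quadric nonsingular. The coefficient 2 at a single coordinate, with a
  second coordinate left for comparison, makes the two quadrics independent.\<close>

lemma quadric_pair:
  fixes X :: "(complex ^ 'n::finite) set"
  assumes "CARD('n) \<ge> 2" "real_points X = {}"
  shows "\<exists>R S. homogeneous 2 R \<and> homogeneous 2 S \<and> independent_pair R S \<and> nonsingular_hypersurface R \<and>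
    nonsingular_hypersurface S \<and> transverse_hypersurfaces R S \<and> real_points X = real_points (zero_locus {complexify R, complexify S})"
proof -
  obtain j k :: 'n where jk: "j \<noteq> k"
    using assms(1) card_2_iff' ex_card[of 2 "UNIV :: 'n set"] by (metis card_2_iff)
  define R where "R = quadric (\<lambda>i::'n. 1)"
  define S where "S = quadric (\<lambda>i. if i = k then 2 else 1)"
  have none: "real_points (zero_locus {complexify R, complexify S}) = {}"
  proof -
    have "x = 0" if "peval R x = 0" for x :: "real ^ 'n"
    proof -
      have "(\<Sum>i\<in>UNIV. (x $ i)\<^sup>2) = 0" using that by (simp add: R_def peval_quadric)
      then have "\<forall>i. (x $ i)\<^sup>2 = 0" by (subst (asm) sum_nonneg_eq_0_iff) auto
      then show ?thesis by (simp add: Finite_Cartesian_Product.vec_eq_iff)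
    qed
    then show ?thesis using real_points_zero_locus_pair[of _ R S] by blast
  qed
  have "independent_pair R S"
    unfolding independent_pair_def
  proof (intro allI impI)
    fix a b assume *: "scale a R + scale b S = 0"
    have ev: "a * peval R x + b * peval S x = 0" for x
      using arg_cong[OF *, of "\<lambda>p. peval p x"] by (simp add: peval_add peval_scale)
    have ax: "(\<Sum>i\<in>UNIV. c i * (axis l 1 $ i)\<^sup>2) = c l" for c :: "'n \<Rightarrow> real" and l
      by (simp add: axis_def if_distrib[of "\<lambda>t. t\<^sup>2"] if_distrib[of "\<lambda>t. _ * t"] cong: if_cong)
    have "a + b * 2 = 0" "a + b = 0"
      using ev[of "axis k 1"] ev[of "axis j 1"] jk unfolding R_def S_def peval_quadric ax by simp_all
    then show "a = 0 \<and> b = 0" by simp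
  qed
  moreover have "nonsingular_hypersurface R" "nonsingular_hypersurface S"
    unfolding R_def S_def by (rule nonsingular_quadric; simp)+
  moreover have "transverse_hypersurfaces R S" unfolding transverse_hypersurfaces_def using none by simp
  moreover have "homogeneous 2 R" "homogeneous 2 S" unfolding R_def S_def by (rule homogeneous_quadric)+
  ultimately show ?thesis using none assms(2) by metis
qed

section \<open>Passing between slices and pencils\<close>

lemma slice_imp_generic_pair:
  fixes X :: "(complex ^ 'n::finite) set"
  assumes "CARD('n) \<ge> 2" and X: "real_variety X" "nonsingular_of_codim 2 X" and sl: "slice X"
  shows "\<exists>d R S. homogeneous d R \<and> homogeneous d S \<and> independent_pair R S \<and> nonsingular_hypersurface R \<and>
    nonsingular_hypersurface S \<and> transverse_hypersurfaces R S \<and> real_points X = real_points (zero_locus {complexify R, complexify S})"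
proof (cases "real_points X = {}")
  case True
  then show ?thesis using quadric_pair[OF assms(1)] by blast
next
  case False
  then obtain x0 where x0: "x0 \<in> real_points X" by blast
  obtain V where V: "complex_variety V" "nonsingular V" "transverse_to_RP V" "real_points X = real_points V"
    using sl unfolding slice_def by blast
  obtain d P where P: "homogeneous d P" "\<And>z. z \<noteq> 0 \<Longrightarrow> peval P z = 0 \<Longrightarrow> \<exists>v. differential P z v \<noteq> 0"
    "\<And>x. x \<noteq> 0 \<Longrightarrow> peval P (cvec x) = 0 \<longleftrightarrow> x \<in> real_points X"
    "\<And>x a. x \<in> real_points X \<Longrightarrow> \<exists>u. differential P (cvec x) (cvec u) = a"
    using hypersurface_of_slice[OF X V x0] by blast
  define A where "A = re_part P"
  define B where "B = im_part P"
  have AB: "homogeneous d A" "homogeneous d B" unfolding A_def B_def using homogeneous_parts[OF P(1)] by auto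
  note cAB = homogeneous_complexify[OF AB(1)] homogeneous_complexify[OF AB(2)]
  have ev: "peval P z = peval (complexify A) z + \<i> * peval (complexify B) z"
    and dv: "differential P z v = differential (complexify A) z v + \<i> * differential (complexify B) z v" for z v
    unfolding A_def B_def using peval_parts differential_parts[OF P(1)] by auto
  define sing where "sing = (\<lambda>t. \<exists>x. x \<noteq> 0 \<and> peval (complexify A) x + t * peval (complexify B) x = 0 \<and>
    (\<forall>v. differential (complexify A) x v + t * differential (complexify B) x v = 0))"
  have "\<not> sing \<i>" unfolding sing_def ev[symmetric] dv[symmetric] using P(2) by blast
  then have "finite {t. sing t}"
    unfolding sing_def using singular_pencil_members_finite[OF cAB, of \<i>] by blast
  then have fin: "finite (complex_of_real -` {t. sing t})"
    by (rule finite_vimageI) (simp add: inj_on_def)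
  obtain t1 where t1: "\<not> sing (complex_of_real t1)"
    using ex_new_if_finite[OF infinite_UNIV_char_0 fin] by auto
  obtain t2 where t2: "\<not> sing (complex_of_real t2)" "t2 \<noteq> t1"
    using ex_new_if_finite[OF infinite_UNIV_char_0, of "insert t1 (complex_of_real -` {t. sing t})"] fin by auto
  define Q where "Q = (\<lambda>t. A + scale t B)"
  have hQ: "homogeneous d (Q t)" for t unfolding Q_def by (intro homogeneous_add homogeneous_scale AB)
  have evQ: "peval (complexify (Q t)) z = peval (complexify A) z + complex_of_real t * peval (complexify B) z" for t z
    by (simp add: Q_def complexify_add complexify_scale peval_add peval_scale)
  have evQr: "peval (Q t) x = peval A x + t * peval B x" for t x
    by (simp add: Q_def peval_add peval_scale)
  have dvQ: "differential (complexify (Q t)) z v = differential (complexify A) z v + complex_of_real t * differential (complexify B) z v" for t z v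
    unfolding Q_def complexify_add complexify_scale
    by (simp add: differential_plus[OF cAB(1) homogeneous_scale[OF cAB(2)]] differential_scale[OF cAB(2)])
  have dvQr: "differential (Q t) x v = differential A x v + t * differential B x v" for t x v
  proof -
    have "complex_of_real (differential (Q t) x v) = complex_of_real (differential A x v + t * differential B x v)"
      by (simp add: real_differential(2)[OF hQ] real_differential(2)[OF AB(1)] real_differential(2)[OF AB(2)] dvQ)
    then show ?thesis by (simp only: of_real_eq_iff)
  qed
  have ns: "nonsingular_hypersurface (Q t)" if "\<not> sing (complex_of_real t)" for t
    using that unfolding nonsingular_hypersurface_def sing_def by (auto simp: zero_locus_def evQ dvQ)
  \<comment> \<open>At a real vector the values of \<open>A\<close> and \<open>B\<close> are the
    real and imaginary parts of \<open>P\<close>; distinct parameters \<open>t1\<close>,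
    \<open>t2\<close> recover both values from the two members.\<close>
  have zero_iff: "peval (Q t1) x = 0 \<and> peval (Q t2) x = 0 \<longleftrightarrow> x \<in> real_points X" if "x \<noteq> 0" for x
  proof -
    have "peval P (cvec x) = complex_of_real (peval A x) + \<i> * complex_of_real (peval B x)"
      by (simp add: ev peval_complexify_cvec)
    then have "peval P (cvec x) = 0 \<longleftrightarrow> peval A x = 0 \<and> peval B x = 0" by (simp add: complex_eq_iff)
    moreover have "peval A x + t1 * peval B x = 0 \<and> peval A x + t2 * peval B x = 0 \<longleftrightarrow> peval A x = 0 \<and> peval B x = 0"
    proof
      assume *: "peval A x + t1 * peval B x = 0 \<and> peval A x + t2 * peval B x = 0"
      have "(t2 - t1) * peval B x = (peval A x + t2 * peval B x) - (peval A x + t1 * peval B x)"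
        by (simp add: algebra_simps)
      then have "(t2 - t1) * peval B x = 0" using * by simp
      then show "peval A x = 0 \<and> peval B x = 0" using * t2(2) by auto
    qed auto
    ultimately show ?thesis using P(3)[OF that] by (simp add: evQr)
  qed
  have "real_points X = real_points (zero_locus {complexify (Q t1), complexify (Q t2)})"
  proof (rule Set.set_eqI)
    fix x show "x \<in> real_points X \<longleftrightarrow> x \<in> real_points (zero_locus {complexify (Q t1), complexify (Q t2)})"
      using zero_iff[of x] unfolding real_points_zero_locus_pair by (auto simp: real_points_def)
  qed
  moreover have surj: "\<exists>u. differential (Q t1) x u = a \<and> differential (Q t2) x u = b" if x: "x \<in> real_points X" for x a b
  proof -
    \<comment> \<open>For the differentials, the equations \<open>A' + t1 * B' = a\<close> and
      \<open>A' + t2 * B' = b\<close> have the solution \<open>B' = \<beta>\<close>,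
      \<open>A' = a - t1 * \<beta>\<close>, and \<open>P\<close> realizes it on a real
      vector.\<close>
    define \<beta> where "\<beta> = (b - a) / (t2 - t1)"
    obtain u where u: "differential P (cvec x) (cvec u) = Complex (a - t1 * \<beta>) \<beta>" using P(4)[OF x] by blast
    have "differential P (cvec x) (cvec u) = complex_of_real (differential A x u) + \<i> * complex_of_real (differential B x u)"
      by (simp add: dv real_differential(2)[OF AB(1)] real_differential(2)[OF AB(2)])
    with u have eq: "complex_of_real (differential A x u) + \<i> * complex_of_real (differential B x u) = Complex (a - t1 * \<beta>) \<beta>"
      by simp
    have "differential A x u = a - t1 * \<beta>" using arg_cong[OF eq, of Re] by simp
    moreover have "differential B x u = \<beta>" using arg_cong[OF eq, of Im] by simp
    moreover have "(t2 - t1) * \<beta> = b - a" using t2(2) by (simp add: \<beta>_def)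
    ultimately have "differential (Q t1) x u = a" "differential (Q t2) x u = b"
      by (simp_all add: dvQr algebra_simps)
    then show ?thesis by blast
  qed
  moreover have "transverse_hypersurfaces (Q t1) (Q t2)"
    unfolding transverse_hypersurfaces_def
    using tangents_span(1)[OF hQ hQ surj] calculation(1) by blast
  moreover have "independent_pair (Q t1) (Q t2)"
    unfolding independent_pair_def
  proof (intro allI impI)
    fix a b assume *: "scale a (Q t1) + scale b (Q t2) = 0"
    \<comment> \<open>A relation between the polynomials gives one between their differentials at
      \<open>x0\<close>, where the pair is onto.\<close>
    then have "(\<lambda>x. a * peval (Q t1) x + b * peval (Q t2) x) = (\<lambda>x. 0)"
      by (metis (no_types, lifting) ext peval_add peval_scale peval_zero)
    moreover have "((\<lambda>x. a * peval (Q t1) x + b * peval (Q t2) x) has_derivative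
       (\<lambda>v. a * differential (Q t1) x0 v + b * differential (Q t2) x0 v)) (at x0)"
      by (intro has_derivative_add has_derivative_mult_right real_differential(1)[OF hQ])
    ultimately have "((\<lambda>x. 0) has_derivative (\<lambda>v. a * differential (Q t1) x0 v + b * differential (Q t2) x0 v)) (at x0)" by simp
    then have "(\<lambda>v. a * differential (Q t1) x0 v + b * differential (Q t2) x0 v) = (\<lambda>v. 0)"
      by (rule has_derivative_unique) (rule has_derivative_const)
    then have 0: "a * differential (Q t1) x0 v + b * differential (Q t2) x0 v = 0" for v by metis
    obtain u1 where u1: "differential (Q t1) x0 u1 = 1" "differential (Q t2) x0 u1 = 0" using surj[OF x0] by blast
    obtain u2 where u2: "differential (Q t1) x0 u2 = 0" "differential (Q t2) x0 u2 = 1" using surj[OF x0] by blast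
    show "a = 0 \<and> b = 0" using 0[of u1] 0[of u2] u1 u2 by simp
  qed
  ultimately show ?thesis using hQ ns[OF t1] ns[OF t2(1)] by blast
qed

lemma base_imp_slice:
  fixes X :: "(complex ^ 'n::finite) set"
  assumes "is_base_of_generic_pencil X"
  shows "slice X"
proof -
  obtain d L where L: "real_pencil d L" "generic_pencil L" "real_points X = real_points (pencil_base L)"
    using assms unfolding is_base_of_generic_pencil_def by blast
  obtain R0 S0 where RS0: "homogeneous d R0" "homogeneous d S0" "L = pencil R0 S0"
    using L(1) unfolding real_pencil_def by blast
  obtain R S where RS: "R \<in> L" "S \<in> L" "independent_pair R S" "nonsingular_hypersurface R" "nonsingular_hypersurface S"
    "transverse_hypersurfaces R S" using L(2) unfolding generic_pencil_def by blast
  have hom: "homogeneous d f" if "f \<in> L" for f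
    using that RS0 by (auto simp: pencil_def intro: homogeneous_add homogeneous_scale)
  note hR = hom[OF RS(1)] and hS = hom[OF RS(2)]
  note cRS = homogeneous_complexify[OF hR] homogeneous_complexify[OF hS]
  have Xeq: "x \<in> real_points X \<longleftrightarrow> x \<noteq> 0 \<and> peval R x = 0 \<and> peval S x = 0" for x
    using pencil_base_members[of R R0 S0 S] RS(1-3) RS0(3) L(3) real_points_zero_locus_pair[of x R S] by simp
  define sing where "sing = (\<lambda>t. \<exists>x. x \<noteq> 0 \<and> peval (complexify R) x + t * peval (complexify S) x = 0 \<and>
    (\<forall>v. differential (complexify R) x v + t * differential (complexify S) x v = 0))"
  have "\<not> sing 0" using RS(4) unfolding sing_def nonsingular_hypersurface_def by (auto simp: zero_locus_def)
  then have "finite {t. sing t}"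
    unfolding sing_def using singular_pencil_members_finite[OF cRS, of 0] by blast
  then have "finite ((\<lambda>t. \<i> * complex_of_real t) -` {t. sing t})"
    by (rule finite_vimageI) (simp add: inj_on_def)
  then obtain t where t: "\<not> sing (\<i> * complex_of_real t)" "t \<noteq> 0"
    using ex_new_if_finite[OF infinite_UNIV_char_0, of "insert 0 ((\<lambda>t. \<i> * complex_of_real t) -` {t. sing t})"] by auto
  define P where "P = complexify R + scale (\<i> * complex_of_real t) (complexify S)"
  have hP: "homogeneous d P" unfolding P_def by (intro homogeneous_add homogeneous_scale cRS)
  have ev: "peval P z = peval (complexify R) z + \<i> * complex_of_real t * peval (complexify S) z"
    and dv: "differential P z v = differential (complexify R) z v + \<i> * complex_of_real t * differential (complexify S) z v" for z v
    by (simp_all add: P_def peval_add peval_scale differential_plus[OF cRS(1) homogeneous_scale[OF cRS(2)]] differential_scale[OF cRS(2)])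
  have nsP: "\<exists>v. differential P z v \<noteq> 0" if "z \<noteq> 0" "peval P z = 0" for z
    using t(1) that unfolding sing_def ev dv by blast
  define V where "V = zero_locus {P}"
  have Veq: "z \<in> V \<longleftrightarrow> z \<noteq> 0 \<and> peval P z = 0" for z by (auto simp: V_def zero_locus_def)
  have "complex_variety V" unfolding complex_variety_def V_def using hP by (intro exI[of _ "{P}"]) auto
  moreover have "nonsingular V"
    unfolding nonsingular_def
  proof
    fix z assume z: "z \<in> V"
    obtain v where v: "differential P z v \<noteq> 0" using nsP z Veq by blast
    have one: "peval 1 y = 1" for y :: "complex ^ 'n" using peval_single[of 0 1 y] by simp
    have "nonsingular_at 1 V z"
      unfolding nonsingular_at_def
    proof (rule exI[of _ "\<lambda>i. P"], rule exI[of _ 1], intro conjI)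
      show "\<exists>d. homogeneous d (1 :: ('n, complex) mpoly)" by (rule exI[of _ 0]) (simp add: homogeneous_def)
      show "\<forall>i<1::nat. \<exists>d. homogeneous d P" using hP by blast
      show "V \<inter> {y. peval 1 y \<noteq> 0} = zero_locus ((\<lambda>i. P) ` {..<1::nat}) \<inter> {y. peval 1 y \<noteq> 0}"
        by (auto simp: V_def zero_locus_def)
      show "\<forall>a. (\<forall>v. (\<Sum>i<1::nat. a i * differential P z v) = 0) \<longrightarrow> (\<forall>i<1::nat. a i = 0)"
        using v by auto
      show "peval 1 z \<noteq> 0" by (simp add: one)
    qed
    then show "\<exists>c. nonsingular_at c V z" by blast
  qed
  \<comment> \<open>At a real vector \<open>R\<close> and \<open>S\<close> take real values, so with
    \<open>t \<noteq> 0\<close> the vanishing of \<open>P\<close> separates into two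
    equations.\<close>
  moreover have rV: "x \<in> real_points V \<longleftrightarrow> x \<noteq> 0 \<and> peval R x = 0 \<and> peval S x = 0" for x
    using t(2) by (auto simp: real_points_def Veq ev peval_complexify_cvec complex_eq_iff)
  then have "real_points X = real_points V" using Xeq by blast
  moreover have "transverse_to_RP V"
    unfolding transverse_to_RP_def
  proof
    fix x assume x: "x \<in> real_points V"
    then have xz: "x \<noteq> 0" "peval R x = 0" "peval S x = 0" using rV by auto
    have xV: "cvec x \<in> V" using x by (simp add: real_points_def)
    obtain vP where vP: "differential P (cvec x) vP \<noteq> 0" using nsP xV Veq by blast
    \<comment> \<open>Near \<open>cvec x\<close> the variety \<open>V\<close> is the zero set of
      \<open>P\<close>, so the differential of any form vanishing on \<open>V\<close> kills the
      kernel of the differential of \<open>P\<close>.\<close>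
    have tan: "v \<in> tangent_space V (cvec x)" if "differential P (cvec x) v = 0" for v
      unfolding tangent_space_def
    proof (intro CollectI allI impI, elim conjE)
      fix f e assume f: "homogeneous e f" "\<forall>y\<in>V. peval f y = 0"
      have "surj (differential P (cvec x))"
        unfolding surj_def
      proof
        fix a have "a = differential P (cvec x) ((a / differential P (cvec x) vP) *s vP)"
          using vP by (simp add: differential_smult[OF hP])
        then show "\<exists>v. a = differential P (cvec x) v" by blast
      qed
      moreover have "\<forall>\<^sub>F y in nhds (cvec x). peval P y = 0 \<longrightarrow> peval f y = 0"
      proof -
        have "\<forall>\<^sub>F y in nhds (cvec x). y \<in> - {0}" using xz(1) by (intro eventually_nhds_in_open open_Compl) auto
        then show ?thesis by eventually_elim (use f(2) Veq in auto)
      qed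
      ultimately show "differential f (cvec x) v = 0"
        using derivative_vanishes_on_tangent[OF C1_peval[OF hP] _ _ that differential_has_derivative[OF f(1)]] xV Veq by blast
    qed
    \<comment> \<open>The span condition holds trivially where a real differential vanishes.
      Nonsingularity excludes this, since a complex linear functional that is zero on real vectors
      is zero.\<close>
    have "\<exists>r. differential Q x r \<noteq> 0" if Q: "nonsingular_hypersurface Q" "homogeneous d Q" "peval Q x = 0" for Q
    proof (rule ccontr)
      assume "\<not> ?thesis"
      then have "differential (complexify Q) (cvec x) (cvec u) = 0" for u
        using real_differential(2)[OF Q(2), of x u] by simp
      then have "differential (complexify Q) (cvec x) v = 0" for v
        by (rule differential_cvec_eq_0[OF homogeneous_complexify[OF Q(2)]])
      moreover have "cvec x \<in> zero_locus {complexify Q}"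
        using Q(3) xz(1) by (simp add: zero_locus_def peval_complexify_cvec)
      ultimately show False using Q(1) unfolding nonsingular_hypersurface_def by blast
    qed
    then obtain r s where rs: "differential R x r \<noteq> 0" "differential S x s \<noteq> 0"
      using RS(4,5) hR hS xz by blast
    have sp: "{v + w | v w. v \<in> hypersurface_tangent R x \<and> w \<in> hypersurface_tangent S x} = UNIV"
      using RS(6) xz unfolding transverse_hypersurfaces_def by (simp add: real_points_zero_locus_pair)
    have "z \<in> {v + w | v w. v \<in> tangent_space V (cvec x) \<and> w \<in> tangent_space_RP x}" for z
    proof -
      let ?c = "differential P (cvec x) z"
      \<comment> \<open>The value \<open>?c\<close> is attained on a real vector by matching real
        and imaginary parts; the difference \<open>z - cvec u\<close> is then tangent to
        \<open>V\<close>.\<close>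
      obtain u where u: "differential R x u = Re ?c" "differential S x u = Im ?c / t"
        using tangents_span(2)[OF hR hS sp rs] by blast
      have "differential P (cvec x) (cvec u) = complex_of_real (Re ?c) + \<i> * complex_of_real t * complex_of_real (Im ?c / t)"
        unfolding dv[of _ "cvec u"] real_differential(2)[OF hR, symmetric] real_differential(2)[OF hS, symmetric] u ..
      also have "\<dots> = complex_of_real (Re ?c) + \<i> * complex_of_real (Im ?c)" using t(2) by simp
      also have "\<dots> = ?c" by (rule complex_eq[symmetric])
      finally have "differential P (cvec x) (cvec u) = ?c" .
      then have "differential P (cvec x) (z - cvec u) = 0"
        using differential_add[OF hP, of "cvec x" "z - cvec u" "cvec u"] by simp
      then have "z - cvec u \<in> tangent_space V (cvec x)" by (rule tan)
      moreover have "cvec u + 0 *s cvec x \<in> tangent_space_RP x" unfolding tangent_space_RP_def by blast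
      moreover have "z = (z - cvec u) + (cvec u + 0 *s cvec x)" by simp
      ultimately show ?thesis by blast
    qed
    then show "{v + w | v w. v \<in> tangent_space V (cvec x) \<and> w \<in> tangent_space_RP x} = UNIV" by blast
  qed
  ultimately show ?thesis unfolding slice_def by blast
qed

theorem theorem3:
  fixes X :: "(complex ^ 'n::finite) set" and n :: nat
  assumes "CARD('n) = n + 1" and "n \<ge> 2"
    and "real_variety X" and "nonsingular_of_codim 2 X"
  shows "(slice X \<longleftrightarrow> is_base_of_generic_pencil X) \<and>
         (slice X \<longrightarrow> (\<exists>d. regular_complete_intersection d d X))"
proof -
  have "CARD('n) \<ge> 2" using assms(1,2) by simp
  then have "is_base_of_generic_pencil X \<and> (\<exists>d. regular_complete_intersection d d X)" if "slice X"
    using slice_imp_generic_pair[OF _ assms(3,4) that] generic_pair_imp_base[of _ _ _ X] by blast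
  then show ?thesis using base_imp_slice by blast
qed

end
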